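(* The finite satisfiability problem for $\mathsf{BST}^{\otimes}$-formulae (deciding whether a given $\mathsf{BST}^{\otimes}$-formula has a model with finite, equivalently hereditarily finite, set domain) belongs to the complexity class NEXPTIME.
   Context: Sets range over the von Neumann universe of well-founded sets; $\mathsf{HF}$ is the set of hereditarily finite sets. For sets $s,t$, $s\otimes t=\{\{u,v\} : u\in s,\ v\in t\}$. A $\mathsf{BST}^{\otimes}$-formula is a propositional combination of atoms $x=y\cup z$, $x=y\cap z$, $x=y\setminus z$, $x=y\otimes z$, $x\subseteq y$ with $x,y,z$ set variables. A set assignment $M$ satisfies $\Phi$ if $\Phi$ is true when each variable $v$ is interpreted as $Mv$. $\Phi$ is finitely (resp. hereditarily finitely) satisfiable if it has a satisfying assignment $M$ on its variables with $\bigcup_v Mv$ finite (resp. in $\mathsf{HF}$). *)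

theory Defs
  imports Main
begin

text \<open>Every hereditarily finite set is represented by its Ackermann code, a natural
number: the code of a set s is the sum of 2^(code of u) over the members u of s.
This is a bijection between HF and the natural numbers, so membership is bit testing.\<close>

definition hf_mem :: "nat \<Rightarrow> nat \<Rightarrow> bool" where
  "hf_mem u s \<longleftrightarrow> bit s u"

definition hf_elems :: "nat \<Rightarrow> nat set" where
  "hf_elems s = {u. hf_mem u s}"

definition hf_of_set :: "nat set \<Rightarrow> nat" where
  "hf_of_set S = (\<Sum>u\<in>S. 2 ^ u)"

definition hf_upair :: "nat \<Rightarrow> nat \<Rightarrow> nat" where
  "hf_upair u v = hf_of_set {u, v}"

type_synonym bvar = nat

datatype bst_atom =
    AUn bvar bvar bvar       \<comment> \<open>x = y \<union> z\<close>
  | AInt bvar bvar bvar      \<comment> \<open>x = y \<inter> z\<close>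
  | ADiff bvar bvar bvar     \<comment> \<open>x = y \<setminus> z\<close>
  | AOtimes bvar bvar bvar   \<comment> \<open>x = y \<otimes> z\<close>
  | ASub bvar bvar

datatype bst_form =
    FAtom bst_atom
  | FNot bst_form
  | FAnd bst_form bst_form
  | FOr bst_form bst_form

fun atom_holds :: "(bvar \<Rightarrow> nat) \<Rightarrow> bst_atom \<Rightarrow> bool" where
  "atom_holds M (AUn x y z) \<longleftrightarrow> hf_elems (M x) = hf_elems (M y) \<union> hf_elems (M z)"
| "atom_holds M (AInt x y z) \<longleftrightarrow> hf_elems (M x) = hf_elems (M y) \<inter> hf_elems (M z)"
| "atom_holds M (ADiff x y z) \<longleftrightarrow> hf_elems (M x) = hf_elems (M y) - hf_elems (M z)"
| "atom_holds M (AOtimes x y z) \<longleftrightarrow>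
     hf_elems (M x) = {hf_upair u v | u v. u \<in> hf_elems (M y) \<and> v \<in> hf_elems (M z)}"
| "atom_holds M (ASub x y) \<longleftrightarrow> hf_elems (M x) \<subseteq> hf_elems (M y)"

fun form_holds :: "(bvar \<Rightarrow> nat) \<Rightarrow> bst_form \<Rightarrow> bool" where
  "form_holds M (FAtom a) \<longleftrightarrow> atom_holds M a"
| "form_holds M (FNot f) \<longleftrightarrow> \<not> form_holds M f"
| "form_holds M (FAnd f g) \<longleftrightarrow> form_holds M f \<and> form_holds M g"
| "form_holds M (FOr f g) \<longleftrightarrow> form_holds M f \<or> form_holds M g"

text \<open>Hereditarily finite satisfiability (equivalently, finite satisfiability).\<close>
definition hf_satisfiable :: "bst_form \<Rightarrow> bool" where
  "hf_satisfiable \<phi> \<longleftrightarrow> (\<exists>M. form_holds M \<phi>)"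

text \<open>Input alphabet: symbols 1 (bit 0) and 2 (bit 1); 0 is the blank.\<close>
definition b0 :: nat where "b0 = 1"
definition b1 :: nat where "b1 = 2"

text \<open>Self-delimiting binary code of a natural number: each binary digit d
(least significant first) is written as 1 d, and the code is terminated by 0.\<close>
fun enc_nat :: "nat \<Rightarrow> nat list" where
  "enc_nat 0 = [b0]"
| "enc_nat (Suc m) = [b1, (if odd (Suc m) then b1 else b0)] @ enc_nat (Suc m div 2)"

fun enc_atom :: "bst_atom \<Rightarrow> nat list" where
  "enc_atom (AUn x y z) = [b0,b0,b0] @ enc_nat x @ enc_nat y @ enc_nat z"
| "enc_atom (AInt x y z) = [b0,b0,b1] @ enc_nat x @ enc_nat y @ enc_nat z"
| "enc_atom (ADiff x y z) = [b0,b1,b0] @ enc_nat x @ enc_nat y @ enc_nat z"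
| "enc_atom (AOtimes x y z) = [b0,b1,b1] @ enc_nat x @ enc_nat y @ enc_nat z"
| "enc_atom (ASub x y) = [b1,b0,b0] @ enc_nat x @ enc_nat y"

fun enc_form :: "bst_form \<Rightarrow> nat list" where
  "enc_form (FAtom a) = [b0,b0] @ enc_atom a"
| "enc_form (FNot f) = [b0,b1] @ enc_form f"
| "enc_form (FAnd f g) = [b1,b0] @ enc_form f @ enc_form g"
| "enc_form (FOr f g) = [b1,b1] @ enc_form f @ enc_form g"

text \<open>Moves: -1 (left), 0 (stay), 1 (right).  Symbols are naturals, 0 is the blank.\<close>
record ntm =
  ntm_delta :: "(nat \<times> nat \<times> nat \<times> nat \<times> int) set"
    \<comment> \<open>(state, read symbol, new state, written symbol, move)\<close>
  ntm_start :: nat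
  ntm_accept :: nat

definition ntm_wf :: "ntm \<Rightarrow> bool" where
  "ntm_wf M \<longleftrightarrow> finite (ntm_delta M) \<and>
     (\<forall>(q,a,q',b,d)\<in>ntm_delta M. d \<in> {-1, 0, 1})"

type_synonym config = "nat \<times> (int \<Rightarrow> nat) \<times> int"  \<comment> \<open>state, tape, head\<close>

definition ntm_init :: "ntm \<Rightarrow> nat list \<Rightarrow> config" where
  "ntm_init M w = (ntm_start M,
     (\<lambda>i. if 0 \<le> i \<and> i < int (length w) then w ! nat i else 0), 0)"

definition ntm_step :: "ntm \<Rightarrow> config \<Rightarrow> config \<Rightarrow> bool" where
  "ntm_step M c c' \<longleftrightarrow> (case c of (q, tp, h) \<Rightarrow>
     (\<exists>q' b d. (q, tp h, q', b, d) \<in> ntm_delta M \<and> c' = (q', tp(h := b), h + d)))"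

inductive ntm_reach :: "ntm \<Rightarrow> config \<Rightarrow> nat \<Rightarrow> config \<Rightarrow> bool" for M where
  reach_refl: "ntm_reach M c 0 c"
| reach_step: "ntm_step M c c' \<Longrightarrow> ntm_reach M c' n c'' \<Longrightarrow> ntm_reach M c (Suc n) c''"

definition ntm_accepts_within :: "ntm \<Rightarrow> nat list \<Rightarrow> nat \<Rightarrow> bool" where
  "ntm_accepts_within M w t \<longleftrightarrow>
     (\<exists>n c. n \<le> t \<and> ntm_reach M (ntm_init M w) n c \<and> fst c = ntm_accept M)"

definition NEXPTIME :: "nat list set \<Rightarrow> bool" where
  "NEXPTIME L \<longleftrightarrow> L \<subseteq> lists {b0, b1} \<and>
     (\<exists>M c k. ntm_wf M \<and>
        (\<forall>w \<in> lists {b0, b1}. w \<in> L \<longleftrightarrow> ntm_accepts_within M w (2 ^ (c * (length w + 1) ^ k))))"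

definition FINSAT_BST_otimes :: "nat list set" where
  "FINSAT_BST_otimes = {enc_form \<phi> | \<phi>. hf_satisfiable \<phi>}"

end

theory Submission
  imports Defs "HOL-Library.Countable" "HOL-Library.Nat_Bijection"
begin

text \<open>Over the Venn regions of a model only two facts about \<open>\<otimes>\<close> matter: whenever the product of two
regions has to lie in the domain, some region of the right kind contains a pair of higher rank, and
every region of pairs contains a pair of elements of lower rank.  Listing the regions by rank (first
and last occurrences suffice) turns this into a purely combinatorial system of exponential size;
conversely, such a system yields a finite model: build the listed elements backwards from fresh
sets, taking enough copies, then close forward under products, always choosing a later region, so
that the process stops.

A machine can guess the system together with a parse of the input as a set of marks on a tape of
exponential length and check a fixed first-order formula with addition and multiplication about
them.  Such a formula is evaluated by nested loops over registers, each of which is a mark on the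
tape; a loop never has to repeat a register content, which bounds the running time by a polynomial
in the length of the tape.\<close>

section \<open>Satisfiability by place systems\<close>

text \<open>Two regions may lie in the same products and differ on the variables. Both must then be
  inhabited, possibly by pairs from the same two sources, and one pair cannot serve both. So each
  region needs pairs of its own, and a source needs a larger stock than the regions built from it:
  the stock grows exponentially towards low indices. The size of the model does not enter the
  complexity bound; only the list of regions is guessed, with length at most twice
  \<open>2 ^ (card V + card Ot)\<close>. On the machine side, soundness is shown for every tape
  length. The length is therefore guessed rather than computed, and time has to be bounded only for
  the good guess. Marks are unary predicates, whereas a certificate has binary and ternary
  relations; a pairing polynomial turns these into sets of cells, which is why the formulas have
  addition and multiplication. Conditions on the guessed parse relations lead only from a claim to
  its local justification. That suffices, because a justification refers to positions further right,
  so claims cannot support each other in a circle.\<close>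

lemma hf_elems_eq_set_decode: "hf_elems = set_decode"
  by (auto simp: hf_elems_def hf_mem_def set_decode_def bit_iff_odd fun_eq_iff)

lemma hf_of_set_eq_set_encode: "hf_of_set = set_encode"
  by (auto simp: hf_of_set_def set_encode_def fun_eq_iff)

lemma finite_hf_elems [simp]: "finite (hf_elems s)"
  by (simp add: hf_elems_eq_set_decode)

lemma hf_elems_of_set [simp]: "finite S \<Longrightarrow> hf_elems (hf_of_set S) = S"
  by (simp add: hf_elems_eq_set_decode hf_of_set_eq_set_encode)

lemma hf_elems_upair [simp]: "hf_elems (hf_upair u v) = {u, v}"
  by (simp add: hf_upair_def)

lemma hf_upair_eq_iff: "hf_upair u v = hf_upair u' v' \<longleftrightarrow> {u, v} = {u', v'}"
  by (metis hf_elems_upair hf_upair_def)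

lemma hf_upair_commute: "hf_upair u v = hf_upair v u"
  by (simp add: hf_upair_def insert_commute)

text \<open>The code of a pair has \<open>2 ^ u\<close> as a summand, and \<open>u < 2 ^ u\<close>.
  Codes thus grow along membership, so they can themselves play the role of ranks.\<close>

lemma less_hf_upair: "u < hf_upair u v" "v < hf_upair u v"
proof -
  have "u < hf_upair u v" for u v
  proof -
    have "(2::nat) ^ u \<le> (\<Sum>x\<in>{u, v}. 2 ^ x)"
      by (rule member_le_sum) auto
    then show ?thesis
      using less_exp[of u] unfolding hf_upair_def hf_of_set_def by (rule less_le_trans[rotated])
  qed
  from this[of u v] this[of v u] show "u < hf_upair u v" "v < hf_upair u v"
    by (simp_all add: hf_upair_commute)
qed

definition hf_product :: "nat \<Rightarrow> nat \<Rightarrow> nat set" where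
  "hf_product s t = {hf_upair u v | u v. u \<in> hf_elems s \<and> v \<in> hf_elems t}"

lemma finite_hf_product [simp]: "finite (hf_product s t)"
proof -
  have "hf_product s t = (\<lambda>(u, v). hf_upair u v) ` (hf_elems s \<times> hf_elems t)"
    by (auto simp: hf_product_def)
  then show ?thesis by simp
qed

text \<open>An index \<open>k \<in> P\<close> stands for a nonempty Venn region: \<open>Mem k x\<close> says that the region lies
inside the variable \<open>x\<close>, and \<open>Prd k y z\<close> that it lies inside \<open>y \<otimes> z\<close>.  The order of the
indices mirrors membership rank: a region whose product with another one has to be placed finds
a later region for it, and a region of pairs has earlier regions supplying such pairs.\<close>

definition pair_sig :: "(nat \<times> nat) set \<Rightarrow> (nat \<Rightarrow> nat \<Rightarrow> bool) \<Rightarrow> nat \<Rightarrow> nat \<Rightarrow> (nat \<times> nat) set" where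
  "pair_sig Ot Mem i j = {(y, z) \<in> Ot. Mem i y \<and> Mem j z \<or> Mem i z \<and> Mem j y}"

definition place_sig :: "(nat \<times> nat) set \<Rightarrow> (nat \<Rightarrow> nat \<Rightarrow> nat \<Rightarrow> bool) \<Rightarrow> nat \<Rightarrow> (nat \<times> nat) set" where
  "place_sig Ot Prd k = {(y, z) \<in> Ot. Prd k y z}"

locale place_system =
  fixes P :: "nat set" and Ot :: "(nat \<times> nat) set"
    and Mem :: "nat \<Rightarrow> nat \<Rightarrow> bool" and Prd :: "nat \<Rightarrow> nat \<Rightarrow> nat \<Rightarrow> bool"
  assumes finite_P: "finite P"
    and target: "\<lbrakk>i \<in> P; j \<in> P; pair_sig Ot Mem i j \<noteq> {}\<rbrakk> \<Longrightarrow>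
      \<exists>k\<in>P. i < k \<and> j < k \<and> place_sig Ot Prd k = pair_sig Ot Mem i j"
    and source: "\<lbrakk>k \<in> P; place_sig Ot Prd k \<noteq> {}\<rbrakk> \<Longrightarrow>
      \<exists>i\<in>P. \<exists>j\<in>P. i < k \<and> j < k \<and> pair_sig Ot Mem i j = place_sig Ot Prd k"

section \<open>Building a finite model from a place system\<close>

definition hf_fresh :: "nat \<Rightarrow> nat" where
  "hf_fresh m = hf_of_set {0, 1, m + 2}"

lemma hf_fresh_eq_iff [simp]: "hf_fresh m = hf_fresh m' \<longleftrightarrow> m = m'"
proof
  assume "hf_fresh m = hf_fresh m'"
  then have "hf_elems (hf_fresh m) = hf_elems (hf_fresh m')" by simp
  then have "{0, 1, m + 2} = {0, 1, m' + 2}" by (simp add: hf_fresh_def)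
  then show "m = m'" by (auto simp: insert_eq_iff)
qed simp

text \<open>A fresh set has three members, since the offset 2 keeps the last one away from 0 and 1;
  a pair has at most two.\<close>

lemma hf_fresh_neq_upair [simp]: "hf_fresh m \<noteq> hf_upair u v"
proof
  assume "hf_fresh m = hf_upair u v"
  then have "hf_elems (hf_fresh m) = hf_elems (hf_upair u v)" by simp
  then have "{0, 1, m + 2} = {u, v}" by (simp add: hf_fresh_def)
  then have "card {0, 1, m + 2} = card {u, v}" by simp
  then show False by (auto simp: card_insert_if split: if_splits)
qed

lemma pair_sig_commute: "pair_sig Ot Mem i j = pair_sig Ot Mem j i"
  by (auto simp: pair_sig_def)

context place_system
begin

abbreviation "psig \<equiv> pair_sig Ot Mem"
abbreviation "wsig \<equiv> place_sig Ot Prd"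

definition src :: "nat \<Rightarrow> nat \<times> nat" where
  "src k = (SOME (i, j). i \<in> P \<and> j \<in> P \<and> i < k \<and> j < k \<and> psig i j = wsig k)"

definition tgt :: "nat \<Rightarrow> nat \<Rightarrow> nat" where
  "tgt i j = (SOME k. k \<in> P \<and> i < k \<and> j < k \<and> wsig k = psig i j)"

definition bnd :: nat where "bnd = Suc (Max (insert 0 P))"

lemma less_bnd: "k \<in> P \<Longrightarrow> k < bnd"
  using finite_P by (simp add: bnd_def le_imp_less_Suc)

lemma src_props:
  assumes "k \<in> P" "wsig k \<noteq> {}"
  shows "fst (src k) \<in> P" "snd (src k) \<in> P" "fst (src k) < k" "snd (src k) < k"
    "psig (fst (src k)) (snd (src k)) = wsig k"
proof -
  obtain i j where ij: "i \<in> P" "j \<in> P" "i < k" "j < k" "psig i j = wsig k"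
    using source[OF assms] by blast
  have "case src k of (i, j) \<Rightarrow> i \<in> P \<and> j \<in> P \<and> i < k \<and> j < k \<and> psig i j = wsig k"
    unfolding src_def by (rule someI[of _ "(i, j)"]) (use ij in simp)
  then show "fst (src k) \<in> P" "snd (src k) \<in> P" "fst (src k) < k" "snd (src k) < k"
    "psig (fst (src k)) (snd (src k)) = wsig k"
    by (auto split: prod.splits)
qed

lemma tgt_props:
  assumes "i \<in> P" "j \<in> P" "psig i j \<noteq> {}"
  shows "tgt i j \<in> P" "i < tgt i j" "j < tgt i j" "wsig (tgt i j) = psig i j"
proof -
  have "\<exists>k. k \<in> P \<and> i < k \<and> j < k \<and> wsig k = psig i j"
    using target[OF assms] by blast
  from someI_ex[OF this] show "tgt i j \<in> P" "i < tgt i j" "j < tgt i j" "wsig (tgt i j) = psig i j"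
    unfolding tgt_def by auto
qed

text \<open>Pairs are unordered, so the label of a new pair must not depend on the order of its
  components. The choice is symmetric because the predicate chosen from is.\<close>

lemma tgt_commute: "tgt i j = tgt j i"
proof -
  have "(\<lambda>k. k \<in> P \<and> i < k \<and> j < k \<and> wsig k = psig i j) =
    (\<lambda>k. k \<in> P \<and> j < k \<and> i < k \<and> wsig k = psig j i)"
    by (auto simp: fun_eq_iff pair_sig_commute)
  then show ?thesis by (simp add: tgt_def)
qed

text \<open>Every index gets a stock of copies, numbered by \<open>c\<close>.  A copy of a region of pairs consumes
its own private copies of the two source regions, so copies are pairwise different sets.\<close>

function copy :: "nat \<Rightarrow> nat \<Rightarrow> nat" where
  "copy k c = (if k \<in> P \<and> wsig k \<noteq> {}
     then hf_upair (copy (fst (src k)) (c * bnd + k)) (copy (snd (src k)) (c * bnd + k))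
     else hf_fresh (c * bnd + k))"
  by auto
termination
  by (relation "measure fst") (auto dest: src_props)

declare copy.simps [simp del]

lemma copy_pair:
  "\<lbrakk>k \<in> P; wsig k \<noteq> {}\<rbrakk> \<Longrightarrow> copy k c =
    hf_upair (copy (fst (src k)) (c * bnd + k)) (copy (snd (src k)) (c * bnd + k))"
  by (subst copy.simps) (simp only: if_True simp_thms)

lemma copy_fresh: "wsig k = {} \<Longrightarrow> copy k c = hf_fresh (c * bnd + k)"
  by (subst copy.simps) (simp only: if_False simp_thms)

text \<open>The stamp \<open>c * bnd + k\<close> is a number in base \<open>bnd\<close> with last
  digit \<open>k\<close>; indices in \<open>P\<close> are below \<open>bnd\<close>.\<close>

lemma stamp_inj: 
  assumes "c * bnd + k = c' * bnd + k'" "k \<in> P" "k' \<in> P"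
  shows "k = k' \<and> c = c'"
proof -
  have "(c * bnd + k) mod bnd = k" "(c' * bnd + k') mod bnd = k'"
    using less_bnd[OF assms(2)] less_bnd[OF assms(3)] by simp_all
  then have "k = k'" using assms(1) by metis
  moreover have "bnd > 0" by (simp add: bnd_def)
  ultimately show ?thesis using assms(1) by simp
qed

text \<open>A copy reveals its origin. Fresh sets and pairs differ in size, and both components of a
  pair carry the stamp of the pair, so the induction hypothesis recovers it however the components
  of two equal pairs are matched.\<close>

lemma copy_inj:
  "\<lbrakk>copy k c = copy k' c'; k \<in> P; k' \<in> P\<rbrakk> \<Longrightarrow> k = k' \<and> c = c'"
proof (induction k arbitrary: c k' c' rule: less_induct)
  case (less k)
  let ?f = "c * bnd + k" and ?f' = "c' * bnd + k'"
  consider "wsig k = {}" "wsig k' = {}" | "wsig k \<noteq> {}" "wsig k' \<noteq> {}"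
    using less.prems copy_fresh copy_pair hf_fresh_neq_upair by metis
  then show ?case
  proof cases
    case 1
    then have "?f = ?f'" using less.prems(1) by (simp add: copy_fresh)
    then show ?thesis using stamp_inj less.prems by blast
  next
    case 2
    have "{copy (fst (src k)) ?f, copy (snd (src k)) ?f} = {copy (fst (src k')) ?f', copy (snd (src k')) ?f'}"
      using less.prems(1)
      unfolding copy_pair[OF less.prems(2) 2(1)] copy_pair[OF less.prems(3) 2(2)] hf_upair_eq_iff .
    then have "copy (fst (src k)) ?f = copy (fst (src k')) ?f' \<or> copy (fst (src k)) ?f = copy (snd (src k')) ?f'"
      by (simp add: doubleton_eq_iff) blast
    then have "?f = ?f'"
      using less.IH[of "fst (src k)"] src_props[OF less.prems(2) 2(1)] src_props[OF less.prems(3) 2(2)]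
      by blast
    then show ?thesis using stamp_inj less.prems by blast
  qed
qed

text \<open>Copy \<open>c\<close> of \<open>k\<close> consumes the copies numbered
  \<open>c * bnd + k\<close> of smaller indices. The stock gains a factor \<open>bnd\<close> with
  each step down so that these numbers are still available there.\<close>

definition seeds :: "nat set" where
  "seeds = {copy k c | k c. k \<in> P \<and> c < bnd ^ (bnd - k)}"

text \<open>The label of a set is the region it is assigned to. Some pairs are already seeds with a
  prescribed label; excluding them from the second rule keeps labels unique.\<close>

inductive lab :: "nat \<Rightarrow> nat \<Rightarrow> bool" where
  seed: "\<lbrakk>k \<in> P; c < bnd ^ (bnd - k)\<rbrakk> \<Longrightarrow> lab (copy k c) k"
| pair: "\<lbrakk>lab u i; lab v j; psig i j \<noteq> {}; hf_upair u v \<notin> seeds\<rbrakk> \<Longrightarrow> lab (hf_upair u v) (tgt i j)"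

lemma lab_in_P: "lab u k \<Longrightarrow> k \<in> P"
  by (induction rule: lab.induct) (auto intro: tgt_props)

lemma lab_unique: "lab u k \<Longrightarrow> lab u k' \<Longrightarrow> k = k'"
proof (induction arbitrary: k' rule: lab.induct)
  case (seed k c)
  from seed.prems show ?case
  proof cases
    case (seed d)
    with \<open>k \<in> P\<close> show ?thesis using copy_inj by blast
  next
    case (pair u i v j)
    then show ?thesis using seed.hyps by (auto simp: seeds_def)
  qed
next
  case (pair u i v j)
  from pair.prems show ?case
  proof cases
    case (seed d)
    then show ?thesis using pair.hyps by (auto simp: seeds_def)
  next
    case (pair u' i' v' j')
    from pair(1) consider "u = u'" "v = v'" | "u = v'" "v = u'"
      by (auto simp: hf_upair_eq_iff doubleton_eq_iff)
    then show ?thesis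
    proof cases
      case 1
      then have "i = i'" "j = j'" using pair \<open>\<And>k'. lab u k' \<Longrightarrow> i = k'\<close> \<open>\<And>k'. lab v k' \<Longrightarrow> j = k'\<close> by blast+
      then show ?thesis using pair by simp
    next
      case 2
      then have "i = j'" "j = i'" using pair \<open>\<And>k'. lab u k' \<Longrightarrow> i = k'\<close> \<open>\<And>k'. lab v k' \<Longrightarrow> j = k'\<close> by blast+
      then show ?thesis using pair tgt_commute by simp
    qed
  qed
qed

text \<open>This is where the forward closure stops: a target lies strictly above both components,
  so a set labelled \<open>k\<close> is one of finitely many seeds or a pair of sets with smaller
  labels.\<close>

lemma finite_lab: "finite {u. lab u k}"
proof (induction k rule: less_induct)
  case (less k)
  let ?X = "\<Union>i<k. {u. lab u i}"
  have "{u. lab u k} \<subseteq> copy k ` {..< bnd ^ (bnd - k)} \<union> (\<lambda>(u, v). hf_upair u v) ` (?X \<times> ?X)"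
  proof
    fix u assume "u \<in> {u. lab u k}"
    then have "lab u k" by simp
    then show "u \<in> copy k ` {..< bnd ^ (bnd - k)} \<union> (\<lambda>(u, v). hf_upair u v) ` (?X \<times> ?X)"
    proof cases
      case (pair u i v j)
      then have "i < k" "j < k" using tgt_props lab_in_P by auto
      with pair show ?thesis by auto
    qed auto
  qed
  then show ?case
    using less by (auto intro: finite_subset)
qed

lemma seed_sources:
  assumes "k \<in> P" "wsig k \<noteq> {}" "c < bnd ^ (bnd - k)"
  obtains u v i j where "copy k c = hf_upair u v" "lab u i" "lab v j" "psig i j = wsig k"
proof
  note s = src_props[OF assms(1,2)]
  let ?f = "c * bnd + k"
  show "copy k c = hf_upair (copy (fst (src k)) ?f) (copy (snd (src k)) ?f)"
    by (rule copy_pair[OF assms(1,2)])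
  \<comment> \<open>\<open>?f\<close> has one digit more than \<open>c\<close> in base
    \<open>bnd\<close>, and an index below \<open>k\<close> has at least one more factor
    \<open>bnd\<close> in its stock.\<close>
  have le: "?f < bnd ^ (bnd - i)" if "i < k" for i
  proof -
    have "?f < (c + 1) * bnd" using less_bnd[OF assms(1)] by simp
    also have "\<dots> \<le> bnd ^ (bnd - k) * bnd" using assms(3) by (intro mult_right_mono) auto
    also have "\<dots> = bnd ^ Suc (bnd - k)" by simp
    also have "\<dots> \<le> bnd ^ (bnd - i)"
      using that less_bnd[OF assms(1)] by (intro power_increasing) auto
    finally show ?thesis .
  qed
  show "lab (copy (fst (src k)) ?f) (fst (src k))" "lab (copy (snd (src k)) ?f) (snd (src k))"
    using s le by (auto intro!: lab.seed)
  show "psig (fst (src k)) (snd (src k)) = wsig k" by fact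
qed

lemma lab_exists: "k \<in> P \<Longrightarrow> \<exists>u. lab u k"
  using lab.seed[of k 0] by (auto simp: bnd_def)

lemma lab_pair_sources:
  assumes "lab s k" "wsig k \<noteq> {}"
  obtains u v i j where "s = hf_upair u v" "lab u i" "lab v j" "psig i j = wsig k"
  using assms(1)
proof cases
  case (seed c)
  then show ?thesis using seed_sources[of k c] assms that by metis
next
  case (pair u i v j)
  then show ?thesis using that tgt_props lab_in_P by metis
qed

text \<open>The delicate case is a pair that happens to be a seed. It is not a fresh copy, and its
  components carry the labels of the sources chosen for it; as labels are unique, its product
  signature is the required one.\<close>

lemma lab_pair_target:
  assumes "lab u i" "lab v j" "psig i j \<noteq> {}"
  obtains k where "lab (hf_upair u v) k" "wsig k = psig i j"
proof (cases "hf_upair u v \<in> seeds")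
  case False
  then show ?thesis using lab.pair[OF assms] that tgt_props lab_in_P assms by metis
next
  case True
  then obtain k c where k: "hf_upair u v = copy k c" "k \<in> P" "c < bnd ^ (bnd - k)"
    by (auto simp: seeds_def)
  then have ne: "wsig k \<noteq> {}"
    using copy_fresh hf_fresh_neq_upair by metis
  obtain u' v' i' j' where "copy k c = hf_upair u' v'" "lab u' i'" "lab v' j'" "psig i' j' = wsig k"
    using seed_sources[OF k(2) ne k(3)] by metis
  then have "u = u' \<and> v = v' \<or> u = v' \<and> v = u'"
    using k(1) by (simp add: hf_upair_eq_iff doubleton_eq_iff)
  then have "i = i' \<and> j = j' \<or> i = j' \<and> j = i'"
    using lab_unique assms \<open>lab u' i'\<close> \<open>lab v' j'\<close> by blast
  then have "wsig k = psig i j"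
    using \<open>psig i' j' = wsig k\<close> pair_sig_commute[of Ot Mem i' j'] by auto
  moreover have "lab (hf_upair u v) k" using lab.seed k by simp
  ultimately show ?thesis using that by blast
qed

definition model :: "nat \<Rightarrow> nat" where
  "model x = hf_of_set {u. \<exists>k. lab u k \<and> Mem k x}"

lemma hf_elems_model: "hf_elems (model x) = {u. \<exists>k. lab u k \<and> Mem k x}"
proof -
  have "{u. \<exists>k. lab u k \<and> Mem k x} \<subseteq> (\<Union>k\<in>P. {u. lab u k})" using lab_in_P by auto
  then have "finite {u. \<exists>k. lab u k \<and> Mem k x}"
    by (rule finite_subset) (simp add: finite_lab finite_P)
  then show ?thesis by (simp add: model_def)
qed

text \<open>Each condition of a place system yields one inclusion: targets put every pair into a
  region with the right products, and sources show that a region inside a product consists of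
  suitable pairs.\<close>

lemma model_product:
  assumes "(y, z) \<in> Ot"
  shows "hf_product (model y) (model z) = {u. \<exists>k. lab u k \<and> Prd k y z}"
proof (intro set_eqI iffI)
  fix s assume "s \<in> hf_product (model y) (model z)"
  then obtain u v i j where s: "s = hf_upair u v" "lab u i" "Mem i y" "lab v j" "Mem j z"
    by (auto simp: hf_product_def hf_elems_model)
  then have yz: "(y, z) \<in> psig i j" using assms by (auto simp: pair_sig_def)
  then obtain k where "lab s k" "wsig k = psig i j" using s lab_pair_target by blast
  then show "s \<in> {u. \<exists>k. lab u k \<and> Prd k y z}" using yz by (auto simp: place_sig_def)
next
  fix s assume "s \<in> {u. \<exists>k. lab u k \<and> Prd k y z}"
  then obtain k where k: "lab s k" "Prd k y z" by auto
  then have yz: "(y, z) \<in> wsig k" using assms by (auto simp: place_sig_def)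
  then obtain u v i j where s: "s = hf_upair u v" "lab u i" "lab v j" "psig i j = wsig k"
    using lab_pair_sources[OF k(1)] by blast
  then have "Mem i y \<and> Mem j z \<or> Mem i z \<and> Mem j y" using yz by (auto simp: pair_sig_def)
  then show "s \<in> hf_product (model y) (model z)"
  proof
    assume "Mem i y \<and> Mem j z"
    then show ?thesis using s unfolding hf_product_def hf_elems_model by blast
  next
    assume "Mem i z \<and> Mem j y"
    moreover have "s = hf_upair v u" using s hf_upair_commute by simp
    ultimately show ?thesis using s unfolding hf_product_def hf_elems_model by blast
  qed
qed

end

section \<open>Evaluating formulas on regions\<close>

fun place_atom :: "nat set \<Rightarrow> (nat \<Rightarrow> nat \<Rightarrow> bool) \<Rightarrow> (nat \<Rightarrow> nat \<Rightarrow> nat \<Rightarrow> bool) \<Rightarrow> bst_atom \<Rightarrow> bool" where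
  "place_atom P Mem Prd (AUn x y z) \<longleftrightarrow> (\<forall>k\<in>P. Mem k x \<longleftrightarrow> Mem k y \<or> Mem k z)"
| "place_atom P Mem Prd (AInt x y z) \<longleftrightarrow> (\<forall>k\<in>P. Mem k x \<longleftrightarrow> Mem k y \<and> Mem k z)"
| "place_atom P Mem Prd (ADiff x y z) \<longleftrightarrow> (\<forall>k\<in>P. Mem k x \<longleftrightarrow> Mem k y \<and> \<not> Mem k z)"
| "place_atom P Mem Prd (AOtimes x y z) \<longleftrightarrow> (\<forall>k\<in>P. Mem k x \<longleftrightarrow> Prd k y z)"
| "place_atom P Mem Prd (ASub x y) \<longleftrightarrow> (\<forall>k\<in>P. Mem k x \<longrightarrow> Mem k y)"

fun place_form :: "nat set \<Rightarrow> (nat \<Rightarrow> nat \<Rightarrow> bool) \<Rightarrow> (nat \<Rightarrow> nat \<Rightarrow> nat \<Rightarrow> bool) \<Rightarrow> bst_form \<Rightarrow> bool" where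
  "place_form P Mem Prd (FAtom a) \<longleftrightarrow> place_atom P Mem Prd a"
| "place_form P Mem Prd (FNot f) \<longleftrightarrow> \<not> place_form P Mem Prd f"
| "place_form P Mem Prd (FAnd f g) \<longleftrightarrow> place_form P Mem Prd f \<and> place_form P Mem Prd g"
| "place_form P Mem Prd (FOr f g) \<longleftrightarrow> place_form P Mem Prd f \<or> place_form P Mem Prd g"

fun atom_vars :: "bst_atom \<Rightarrow> nat set" where
  "atom_vars (AUn x y z) = {x, y, z}"
| "atom_vars (AInt x y z) = {x, y, z}"
| "atom_vars (ADiff x y z) = {x, y, z}"
| "atom_vars (AOtimes x y z) = {x, y, z}"
| "atom_vars (ASub x y) = {x, y}"

fun atom_prods :: "bst_atom \<Rightarrow> (nat \<times> nat) set" where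
  "atom_prods (AOtimes x y z) = {(y, z)}"
| "atom_prods _ = {}"

fun form_vars :: "bst_form \<Rightarrow> nat set" where
  "form_vars (FAtom a) = atom_vars a"
| "form_vars (FNot f) = form_vars f"
| "form_vars (FAnd f g) = form_vars f \<union> form_vars g"
| "form_vars (FOr f g) = form_vars f \<union> form_vars g"

fun form_prods :: "bst_form \<Rightarrow> (nat \<times> nat) set" where
  "form_prods (FAtom a) = atom_prods a"
| "form_prods (FNot f) = form_prods f"
| "form_prods (FAnd f g) = form_prods f \<union> form_prods g"
| "form_prods (FOr f g) = form_prods f \<union> form_prods g"

text \<open>The labels partition the domain into nonempty classes indexed by \<open>P\<close>, so a
  Boolean relation between unions of classes can be tested index by index.\<close>

lemma (in place_system) model_atom:
  assumes "atom_prods a \<subseteq> Ot"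
  shows "atom_holds model a \<longleftrightarrow> place_atom P Mem Prd a"
proof -
  have *: "{u. \<exists>k. lab u k \<and> Q k} = {u. \<exists>k. lab u k \<and> R k} \<longleftrightarrow> (\<forall>k\<in>P. Q k \<longleftrightarrow> R k)" for Q R
  proof
    assume eq: "{u. \<exists>k. lab u k \<and> Q k} = {u. \<exists>k. lab u k \<and> R k}"
    show "\<forall>k\<in>P. Q k \<longleftrightarrow> R k"
    proof
      fix k assume "k \<in> P"
      then obtain u where "lab u k" using lab_exists by blast
      then show "Q k \<longleftrightarrow> R k" using eq lab_unique by blast
    qed
  qed (use lab_in_P in auto)
  have un: "{u. \<exists>k. lab u k \<and> Q k} \<union> {u. \<exists>k. lab u k \<and> R k} = {u. \<exists>k. lab u k \<and> (Q k \<or> R k)}"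
    and int: "{u. \<exists>k. lab u k \<and> Q k} \<inter> {u. \<exists>k. lab u k \<and> R k} = {u. \<exists>k. lab u k \<and> (Q k \<and> R k)}"
    and dif: "{u. \<exists>k. lab u k \<and> Q k} - {u. \<exists>k. lab u k \<and> R k} = {u. \<exists>k. lab u k \<and> (Q k \<and> \<not> R k)}" for Q R
    using lab_unique by blast+
  have sub: "{u. \<exists>k. lab u k \<and> Q k} \<subseteq> {u. \<exists>k. lab u k \<and> R k} \<longleftrightarrow> (\<forall>k\<in>P. Q k \<longrightarrow> R k)" for Q R
    unfolding le_iff_inf int * by auto
  show ?thesis
  proof (cases a)
    case (AOtimes x y z)
    then have "(y, z) \<in> Ot" using assms by simp
    from model_product[OF this] show ?thesis
      unfolding AOtimes atom_holds.simps place_atom.simps hf_product_def[symmetric]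
      by (simp add: hf_elems_model *)
  qed (simp_all add: hf_elems_model un int dif sub *)
qed

lemma (in place_system) model_form:
  "form_prods f \<subseteq> Ot \<Longrightarrow> form_holds model f \<longleftrightarrow> place_form P Mem Prd f"
  by (induction f) (simp_all add: model_atom)

section \<open>Extracting a small place system from a model\<close>

definition region :: "nat set \<Rightarrow> (nat \<times> nat) set \<Rightarrow> (nat \<Rightarrow> nat \<Rightarrow> bool) \<Rightarrow> (nat \<Rightarrow> nat \<Rightarrow> nat \<Rightarrow> bool) \<Rightarrow>
    nat \<Rightarrow> nat set \<times> (nat \<times> nat) set" where
  "region V Ot Mem Prd k = ({x \<in> V. Mem k x}, place_sig Ot Prd k)"

text \<open>Each atom says that all regions have some property \<open>A\<close> of a single region.
  Formulas therefore see only which regions occur, neither their order nor their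
  multiplicity.\<close>

lemma place_form_cong:
  assumes reg: "region V Ot Mem Prd ` P = region V Ot Mem' Prd' ` P'"
    and "form_vars f \<subseteq> V" "form_prods f \<subseteq> Ot"
  shows "place_form P Mem Prd f \<longleftrightarrow> place_form P' Mem' Prd' f"
  using assms(2,3)
proof (induction f)
  case (FAtom a)
  define A where "A = (case a of
      AUn x y z \<Rightarrow> \<lambda>r. x \<in> fst r \<longleftrightarrow> y \<in> fst r \<or> z \<in> fst r
    | AInt x y z \<Rightarrow> \<lambda>r. x \<in> fst r \<longleftrightarrow> y \<in> fst r \<and> z \<in> fst r
    | ADiff x y z \<Rightarrow> \<lambda>r. x \<in> fst r \<longleftrightarrow> y \<in> fst r \<and> z \<notin> fst r
    | AOtimes x y z \<Rightarrow> \<lambda>r. x \<in> fst r \<longleftrightarrow> (y, z) \<in> snd r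
    | ASub x y \<Rightarrow> \<lambda>r::nat set \<times> (nat \<times> nat) set. x \<in> fst r \<longrightarrow> y \<in> fst r)"
  have "place_atom Q M R a \<longleftrightarrow> (\<forall>r \<in> region V Ot M R ` Q. A r)" for Q M R
    using FAtom by (cases a) (auto simp: A_def region_def place_sig_def)
  then show ?case unfolding place_form.simps by (simp only: reg)
qed auto

lemma pair_sig_region:
  assumes "Ot \<subseteq> V \<times> V" "region V Ot Mem Prd i = region V Ot Mem' Prd' i'"
    "region V Ot Mem Prd j = region V Ot Mem' Prd' j'"
  shows "pair_sig Ot Mem i j = pair_sig Ot Mem' i' j'"
proof -
  have "Mem i y = Mem' i' y" "Mem j y = Mem' j' y" if "y \<in> V" for y
    using assms(2,3) that by (auto simp: region_def)
  then show ?thesis using assms(1) unfolding pair_sig_def by blast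
qed

lemma place_sig_region:
  "region V Ot Mem Prd i = region V Ot Mem' Prd' i' \<Longrightarrow> place_sig Ot Prd i = place_sig Ot Prd' i'"
  by (simp add: region_def)

lemma hf_upair_in_product:
  "hf_upair u v \<in> hf_product s t \<longleftrightarrow>
    u \<in> hf_elems s \<and> v \<in> hf_elems t \<or> u \<in> hf_elems t \<and> v \<in> hf_elems s"
proof
  assume "hf_upair u v \<in> hf_product s t"
  then show "u \<in> hf_elems s \<and> v \<in> hf_elems t \<or> u \<in> hf_elems t \<and> v \<in> hf_elems s"
    by (auto simp: hf_product_def hf_upair_eq_iff doubleton_eq_iff)
next
  assume "u \<in> hf_elems s \<and> v \<in> hf_elems t \<or> u \<in> hf_elems t \<and> v \<in> hf_elems s"
  then show "hf_upair u v \<in> hf_product s t"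
    unfolding hf_product_def using hf_upair_commute[of u v] by blast
qed

text \<open>The elements of a model serve as indices: the Ackermann code of a pair exceeds those of
its components.\<close>

lemma place_system_of_model:
  fixes M :: "nat \<Rightarrow> nat"
  assumes "finite V" "finite Ot" "Ot \<subseteq> V \<times> V"
  defines "D \<equiv> (\<Union>x\<in>V. hf_elems (M x)) \<union> (\<Union>(y, z)\<in>Ot. hf_product (M y) (M z))"
    and "Mem \<equiv> \<lambda>u x. u \<in> hf_elems (M x)" and "Prd \<equiv> \<lambda>u y z. u \<in> hf_product (M y) (M z)"
  shows "place_system D Ot Mem Prd"
    and "\<lbrakk>form_vars f \<subseteq> V; form_prods f \<subseteq> Ot\<rbrakk> \<Longrightarrow> place_form D Mem Prd f \<longleftrightarrow> form_holds M f"
proof -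
  \<comment> \<open>A pair lies in exactly those products that its components demand. Hence
    \<open>hf_upair i j\<close> itself is the target, and the components of an element of a product
    are its sources.\<close>
  have sig: "place_sig Ot Prd (hf_upair u v) = pair_sig Ot Mem u v" for u v
    by (auto simp: place_sig_def pair_sig_def Prd_def Mem_def hf_upair_in_product)
  show "place_system D Ot Mem Prd"
  proof
    show "finite D" using assms by auto
  next
    fix i j assume "i \<in> D" "j \<in> D" "pair_sig Ot Mem i j \<noteq> {}"
    then have "hf_upair i j \<in> D"
      by (auto simp: sig[symmetric] place_sig_def Prd_def D_def)
    then show "\<exists>k\<in>D. i < k \<and> j < k \<and> place_sig Ot Prd k = pair_sig Ot Mem i j"
      using sig less_hf_upair by blast
  next
    fix k assume "place_sig Ot Prd k \<noteq> {}"
    then obtain y z where "(y, z) \<in> Ot" "k \<in> hf_product (M y) (M z)"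
      by (auto simp: place_sig_def Prd_def)
    then obtain u v where uv: "k = hf_upair u v" "u \<in> hf_elems (M y)" "v \<in> hf_elems (M z)" "y \<in> V" "z \<in> V"
      using assms(3) by (auto simp: hf_product_def)
    then have "u \<in> D" "v \<in> D" by (auto simp: D_def)
    then show "\<exists>i\<in>D. \<exists>j\<in>D. i < k \<and> j < k \<and> pair_sig Ot Mem i j = place_sig Ot Prd k"
      using uv(1) sig less_hf_upair by metis
  qed
  show "place_form D Mem Prd f \<longleftrightarrow> form_holds M f" if "form_vars f \<subseteq> V" "form_prods f \<subseteq> Ot"
    using that
  proof (induction f)
    case (FAtom a)
    have sub: "hf_elems (M x) \<subseteq> D" if "x \<in> V" for x using that by (auto simp: D_def)
    have prd: "hf_product (M y) (M z) \<subseteq> D" if "(y, z) \<in> Ot" for y z using that by (auto simp: D_def)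
    show ?case
    proof (cases a)
      case (AOtimes x y z)
      then show ?thesis using FAtom sub[of x] prd[of y z]
        by (auto simp: Mem_def Prd_def hf_product_def[symmetric])
    qed (use FAtom sub in \<open>auto simp: Mem_def\<close>)
  qed auto
qed

text \<open>Only the first and the last occurrence of each region matter: the last ones for the
indices that need a later target, the first ones for those that need earlier sources.\<close>

lemma place_system_compress:
  assumes ps: "place_system P Ot Mem Prd" and "finite V" "finite Ot" "Ot \<subseteq> V \<times> V"
  defines "reg \<equiv> region V Ot Mem Prd"
  obtains Q where "place_system Q Ot Mem Prd" "reg ` Q = reg ` P"
    "card Q \<le> 2 * 2 ^ (card V + card Ot)"
proof
  interpret place_system P Ot Mem Prd by fact
  define fst_occ where "fst_occ r = Min {l \<in> P. reg l = r}" for r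
  define lst_occ where "lst_occ r = Max {l \<in> P. reg l = r}" for r
  have f: "fst_occ (reg k) \<in> P" "reg (fst_occ (reg k)) = reg k" "fst_occ (reg k) \<le> k"
    and l: "lst_occ (reg k) \<in> P" "reg (lst_occ (reg k)) = reg k" "k \<le> lst_occ (reg k)" if "k \<in> P" for k
  proof -
    have fin: "finite {l \<in> P. reg l = reg k}" and ne: "{l \<in> P. reg l = reg k} \<noteq> {}"
      using finite_P that by auto
    show "fst_occ (reg k) \<in> P" "reg (fst_occ (reg k)) = reg k" "lst_occ (reg k) \<in> P" "reg (lst_occ (reg k)) = reg k"
      using Min_in[OF fin ne] Max_in[OF fin ne] by (simp_all add: fst_occ_def lst_occ_def)
    show "fst_occ (reg k) \<le> k" "k \<le> lst_occ (reg k)"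
      using Min_le[OF fin, of k] Max_ge[OF fin, of k] that by (simp_all add: fst_occ_def lst_occ_def)
  qed
  define Q where "Q = fst_occ ` reg ` P \<union> lst_occ ` reg ` P"
  have QP: "Q \<subseteq> P" using f l by (auto simp: Q_def)
  have psig: "psig i j = psig i' j'" if "reg i = reg i'" "reg j = reg j'" for i j i' j'
    using pair_sig_region assms(4) that unfolding reg_def by blast
  have wsig: "wsig i = wsig i'" if "reg i = reg i'" for i i'
    using place_sig_region that unfolding reg_def by blast
  show "place_system Q Ot Mem Prd"
  proof
    show "finite Q" using QP finite_P finite_subset by blast
  next
    fix i j assume ij: "i \<in> Q" "j \<in> Q" "psig i j \<noteq> {}"
    then have P: "i \<in> P" "j \<in> P" using QP by auto
    \<comment> \<open>A target of the last occurrences lies above every occurrence of both regions,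
      in particular above \<open>i\<close> and \<open>j\<close>; moving it to its own last
      occurrence only raises it. Sources are treated dually with first occurrences.\<close>
    let ?i = "lst_occ (reg i)" and ?j = "lst_occ (reg j)"
    have "psig ?i ?j = psig i j" using l P by (intro psig) auto
    then obtain k where k: "k \<in> P" "?i < k" "?j < k" "wsig k = psig i j"
      using target[of ?i ?j] l P ij by metis
    let ?k = "lst_occ (reg k)"
    have "i < ?k" "j < ?k" "wsig ?k = psig i j"
      using k l(3)[of k] l(3)[of i] l(3)[of j] P wsig[of ?k k] l(2)[of k] by auto
    moreover have "?k \<in> Q" using k by (auto simp: Q_def)
    ultimately show "\<exists>k\<in>Q. i < k \<and> j < k \<and> wsig k = psig i j" by blast
  next
    fix k assume kQ: "k \<in> Q" "wsig k \<noteq> {}"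
    then have P: "k \<in> P" using QP by auto
    let ?k = "fst_occ (reg k)"
    have "wsig ?k = wsig k" using f P by (intro wsig) auto
    then obtain i j where ij: "i \<in> P" "j \<in> P" "i < ?k" "j < ?k" "psig i j = wsig k"
      using source[of ?k] f P kQ by metis
    let ?i = "fst_occ (reg i)" and ?j = "fst_occ (reg j)"
    have "?i < k" "?j < k" "psig ?i ?j = wsig k"
      using ij f(3)[of k] f(3)[of i] f(3)[of j] P psig[of ?i i ?j j] f(2)[of i] f(2)[of j] by auto
    moreover have "?i \<in> Q" "?j \<in> Q" using ij by (auto simp: Q_def)
    ultimately show "\<exists>i\<in>Q. \<exists>j\<in>Q. i < k \<and> j < k \<and> psig i j = wsig k" by blast
  qed
  show "reg ` Q = reg ` P"
  proof
    show "reg ` P \<subseteq> reg ` Q"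
    proof
      fix r assume "r \<in> reg ` P"
      then have "r = reg (fst_occ r)" "fst_occ r \<in> Q" using f(2) by (auto simp: Q_def)
      then show "r \<in> reg ` Q" by blast
    qed
  qed (use QP in auto)
  have "reg ` P \<subseteq> Pow V \<times> Pow Ot" by (auto simp: reg_def region_def place_sig_def)
  then have "card (reg ` P) \<le> card (Pow V \<times> Pow Ot)"
    using assms by (intro card_mono) auto
  then have c: "card (reg ` P) \<le> 2 ^ (card V + card Ot)"
    using assms by (simp add: card_cartesian_product card_Pow power_add)
  have "card Q \<le> card (fst_occ ` reg ` P) + card (lst_occ ` reg ` P)"
    unfolding Q_def by (rule card_Un_le)
  also have "\<dots> \<le> card (reg ` P) + card (reg ` P)"
    using finite_P by (intro add_mono card_image_le) auto
  finally show "card Q \<le> 2 * 2 ^ (card V + card Ot)" using c by simp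
qed

text \<open>Only the order of the indices counts, and sorting preserves it. Indices taken from a
  model are codes of sets and may be huge; after renumbering they fit on a tape of exponential
  length.\<close>

lemma place_system_reindex:
  assumes ps: "place_system P Ot Mem Prd"
  obtains e where "bij_betw e {..<card P} P"
    "place_system {..<card P} Ot (\<lambda>k. Mem (e k)) (\<lambda>k. Prd (e k))"
proof
  interpret place_system P Ot Mem Prd by fact
  let ?e = "\<lambda>k. sorted_list_of_set P ! k"
  have len: "length (sorted_list_of_set P) = card P" by simp
  show bij: "bij_betw ?e {..<card P} P"
    using finite_P by (intro bij_betw_nth) auto
  have mono: "?e i < ?e j \<longleftrightarrow> i < j" if "i < card P" "j < card P" for i j
  proof -
    have lt: "?e i < ?e j" if "i < j" "j < card P" for i j
      using sorted_wrt_nth_less[OF strict_sorted_list_of_set[of P], of i j] that len by simp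
    show ?thesis
      using lt[of i j] lt[of j i] that by (cases i j rule: linorder_cases) auto
  qed
  have psig': "pair_sig Ot (\<lambda>k. Mem (?e k)) i j = psig (?e i) (?e j)" for i j by (simp add: pair_sig_def)
  have wsig': "place_sig Ot (\<lambda>k. Prd (?e k)) i = wsig (?e i)" for i by (simp add: place_sig_def)
  have surj: "\<exists>i<card P. k = ?e i" if "k \<in> P" for k
    using bij that by (auto simp: bij_betw_def)
  have mem: "?e i \<in> P" if "i < card P" for i
    using bij that by (auto simp: bij_betw_def)
  show "place_system {..<card P} Ot (\<lambda>k. Mem (?e k)) (\<lambda>k. Prd (?e k))"
  proof
    fix i j assume ij: "i \<in> {..<card P}" "j \<in> {..<card P}" "pair_sig Ot (\<lambda>k. Mem (?e k)) i j \<noteq> {}"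
    then obtain k where "k \<in> P" "?e i < k" "?e j < k" "wsig k = psig (?e i) (?e j)"
      using target[of "?e i" "?e j"] mem by (auto simp: psig')
    moreover then obtain k' where "k' < card P" "k = ?e k'" using surj by blast
    ultimately show "\<exists>k\<in>{..<card P}. i < k \<and> j < k \<and> place_sig Ot (\<lambda>k. Prd (?e k)) k = pair_sig Ot (\<lambda>k. Mem (?e k)) i j"
      using ij mono by (auto simp: psig' wsig')
  next
    fix k assume k: "k \<in> {..<card P}" "place_sig Ot (\<lambda>k. Prd (?e k)) k \<noteq> {}"
    then obtain i j where "i \<in> P" "j \<in> P" "i < ?e k" "j < ?e k" "psig i j = wsig (?e k)"
      using source[of "?e k"] mem by (auto simp: wsig')
    moreover then obtain i' j' where "i' < card P" "i = ?e i'" "j' < card P" "j = ?e j'" using surj by blast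
    ultimately show "\<exists>i\<in>{..<card P}. \<exists>j\<in>{..<card P}. i < k \<and> j < k \<and>
        pair_sig Ot (\<lambda>k. Mem (?e k)) i j = place_sig Ot (\<lambda>k. Prd (?e k)) k"
      using k mono by (auto simp: psig' wsig')
  qed simp
qed

theorem small_place_system:
  assumes "finite V" "finite Ot" "Ot \<subseteq> V \<times> V"
  obtains n Mem Prd where "n \<le> 2 * 2 ^ (card V + card Ot)" "place_system {..<n} Ot Mem Prd"
    "\<And>f. \<lbrakk>form_vars f \<subseteq> V; form_prods f \<subseteq> Ot\<rbrakk> \<Longrightarrow> place_form {..<n} Mem Prd f \<longleftrightarrow> form_holds M f"
proof -
  define D where "D = (\<Union>x\<in>V. hf_elems (M x)) \<union> (\<Union>(y, z)\<in>Ot. hf_product (M y) (M z))"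
  define Mem where "Mem u x \<longleftrightarrow> u \<in> hf_elems (M x)" for u x
  define Prd where "Prd u y z \<longleftrightarrow> u \<in> hf_product (M y) (M z)" for u y z
  have ps: "place_system D Ot Mem Prd"
    and pf: "\<And>f. \<lbrakk>form_vars f \<subseteq> V; form_prods f \<subseteq> Ot\<rbrakk> \<Longrightarrow> place_form D Mem Prd f \<longleftrightarrow> form_holds M f"
    using place_system_of_model[OF assms, where M = M] unfolding D_def Mem_def Prd_def by blast+
  obtain Q where Q: "place_system Q Ot Mem Prd" "region V Ot Mem Prd ` Q = region V Ot Mem Prd ` D"
    "card Q \<le> 2 * 2 ^ (card V + card Ot)"
    using place_system_compress[OF ps assms] by blast
  obtain e where e: "bij_betw e {..<card Q} Q"
    "place_system {..<card Q} Ot (\<lambda>k. Mem (e k)) (\<lambda>k. Prd (e k))"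
    using place_system_reindex[OF Q(1)] by blast
  have "region V Ot (\<lambda>k. Mem (e k)) (\<lambda>k. Prd (e k)) k = region V Ot Mem Prd (e k)" for k
    by (simp add: region_def place_sig_def)
  then have "region V Ot (\<lambda>k. Mem (e k)) (\<lambda>k. Prd (e k)) ` {..<card Q} = region V Ot Mem Prd ` e ` {..<card Q}"
    by (simp add: image_image)
  also have "\<dots> = region V Ot Mem Prd ` D" using e(1) Q(2) by (simp add: bij_betw_def)
  finally have "place_form {..<card Q} (\<lambda>k. Mem (e k)) (\<lambda>k. Prd (e k)) f \<longleftrightarrow> form_holds M f"
    if "form_vars f \<subseteq> V" "form_prods f \<subseteq> Ot" for f
    using place_form_cong that pf by metis
  then show ?thesis using that Q(3) e(2) by blast
qed

section \<open>Regular programs and nondeterministic Turing machines\<close>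

datatype 'a prog = Act 'a | Seq "'a prog" "'a prog" | Alt "'a prog" "'a prog" | Star "'a prog"

primrec sem :: "('a \<Rightarrow> ('s \<times> 's) set) \<Rightarrow> 'a prog \<Rightarrow> ('s \<times> 's) set" where
  "sem f (Act a) = f a"
| "sem f (Seq p q) = sem f p O sem f q"
| "sem f (Alt p q) = sem f p \<union> sem f q"
| "sem f (Star p) = (sem f p)\<^sup>*"

text \<open>A control state is the list of programs still to be executed.\<close>

inductive silent :: "'a prog list \<Rightarrow> 'a prog list \<Rightarrow> bool" where
  "silent (Seq p q # k) (p # q # k)"
| "silent (Alt p q # k) (p # k)"
| "silent (Alt p q # k) (q # k)"
| "silent (Star p # k) k"
| "silent (Star p # k) (p # Star p # k)"

definition step :: "('a \<Rightarrow> ('s \<times> 's) set) \<Rightarrow> 'a prog list \<times> 's \<Rightarrow> 'a prog list \<times> 's \<Rightarrow> bool" where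
  "step f c c' \<longleftrightarrow> (\<exists>a. fst c = Act a # fst c' \<and> (snd c, snd c') \<in> f a) \<or>
     silent (fst c) (fst c') \<and> snd c' = snd c"

text \<open>The induction is on the number of steps because unfolding \<open>Star p\<close> leaves
  \<open>Star p\<close> on the list. The strict inequality \<open>m < n\<close> makes the hypothesis
  applicable to the rest of the run.\<close>

lemma steps_sound:
  "(step f ^^ n) (p # k, s) ([], t) \<Longrightarrow>
    \<exists>s' m. (s, s') \<in> sem f p \<and> m < n \<and> (step f ^^ m) (k, s') ([], t)"
proof (induction n arbitrary: p k s rule: less_induct)
  case (less n)
  show ?case
  proof (cases n)
    case 0
    then show ?thesis using less.prems by simp
  next
    case (Suc m)
    obtain l s1 where s1: "step f (p # k, s) (l, s1)" and m: "(step f ^^ m) (l, s1) ([], t)"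
      using less.prems[unfolded Suc] by (metis relpowp_Suc_D2 surj_pair)
    show ?thesis
    proof (cases p)
      case (Act a)
      then have "(s, s1) \<in> f a" "l = k" using s1 by (auto simp: step_def elim: silent.cases)
      then show ?thesis using m Suc Act by auto
    next
      case (Seq q r)
      then have "l = q # r # k" "s1 = s" using s1 by (auto simp: step_def elim: silent.cases)
      then obtain s2 m2 where 2: "(s, s2) \<in> sem f q" "m2 < m" "(step f ^^ m2) (r # k, s2) ([], t)"
        using less.IH[of m q "r # k" s] m Suc by auto
      then obtain s3 m3 where "(s2, s3) \<in> sem f r" "m3 < m2" "(step f ^^ m3) (k, s3) ([], t)"
        using less.IH[of m2 r k s2] Suc by auto
      then show ?thesis using 2 Suc Seq by (intro exI[of _ s3] exI[of _ m3]) auto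
    next
      case (Alt q r)
      then have "l = q # k \<or> l = r # k" "s1 = s" using s1 by (auto simp: step_def elim: silent.cases)
      then show ?thesis
        using less.IH[of m q k s] less.IH[of m r k s] m Suc Alt
        by simp (meson UnI1 UnI2 less_SucI)
    next
      case (Star q)
      then have "l = k \<or> l = q # Star q # k" "s1 = s" using s1 by (auto simp: step_def elim: silent.cases)
      then consider "l = k" "s1 = s" | "l = q # Star q # k" "s1 = s" by blast
      then show ?thesis
      proof cases
        case 1
        then show ?thesis using m Suc Star by auto
      next
        case 2
        then obtain s2 m2 where 2: "(s, s2) \<in> sem f q" "m2 < m" "(step f ^^ m2) (Star q # k, s2) ([], t)"
          using less.IH[of m q "Star q # k" s] m Suc by auto
        then obtain s3 m3 where "(s2, s3) \<in> (sem f q)\<^sup>*" "m3 < m2" "(step f ^^ m3) (k, s3) ([], t)"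
          using less.IH[of m2 "Star q" k s2] Suc by auto
        then show ?thesis using 2 Suc Star
          by (intro exI[of _ s3] exI[of _ m3]) (auto intro: converse_rtrancl_into_rtrancl)
      qed
    qed
  qed
qed

section \<open>Runs with a time bound\<close>

definition runs :: "('a \<Rightarrow> ('s \<times> 's) set) \<Rightarrow> nat \<Rightarrow> 'a prog list \<times> 's \<Rightarrow> 'a prog list \<times> 's \<Rightarrow> bool" where
  "runs f n c c' \<longleftrightarrow> (\<exists>m\<le>n. (step f ^^ m) c c')"

lemma runs_trans: "\<lbrakk>runs f m c c'; runs f n c' c''\<rbrakk> \<Longrightarrow> runs f (m + n) c c''"
proof -
  assume "runs f m c c'" "runs f n c' c''"
  then obtain i j where "i \<le> m" "(step f ^^ i) c c'" "j \<le> n" "(step f ^^ j) c' c''"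
    by (auto simp: runs_def)
  then have "i + j \<le> m + n" "(step f ^^ (i + j)) c c''" by (auto simp: relpowp_add)
  then show ?thesis unfolding runs_def by blast
qed

lemma runs_mono: "\<lbrakk>runs f m c c'; m \<le> n\<rbrakk> \<Longrightarrow> runs f n c c'"
  unfolding runs_def by (meson order_trans)

lemma runs_step: "step f c c' \<Longrightarrow> runs f 1 c c'"
  unfolding runs_def by (intro exI[of _ 1]) auto

lemma runs_Act: "(s, s') \<in> f a \<Longrightarrow> runs f 1 (Act a # k, s) (k, s')"
  by (rule runs_step) (simp add: step_def)

lemma runs_Seq:
  assumes "runs f m (p # q # k, s) (q # k, s')" "runs f n (q # k, s') (k, s'')"
  shows "runs f (1 + m + n) (Seq p q # k, s) (k, s'')"
  using assms by (intro runs_trans[OF runs_trans[OF runs_step]]) (auto simp: step_def silent.intros)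

lemma runs_Alt1: "runs f m (p # k, s) (k, s') \<Longrightarrow> runs f (1 + m) (Alt p q # k, s) (k, s')"
  by (rule runs_trans[OF runs_step]) (auto simp: step_def silent.intros)

lemma runs_Alt2: "runs f m (q # k, s) (k, s') \<Longrightarrow> runs f (1 + m) (Alt p q # k, s) (k, s')"
  by (rule runs_trans[OF runs_step]) (auto simp: step_def silent.intros)

lemma runs_Star_stop: "runs f 1 (Star p # k, s) (k, s)"
  by (rule runs_step) (auto simp: step_def silent.intros)

lemma runs_Star_more:
  "\<lbrakk>runs f m (p # Star p # k, s) (Star p # k, s'); runs f n (Star p # k, s') (k, s'')\<rbrakk> \<Longrightarrow>
    runs f (1 + m + n) (Star p # k, s) (k, s'')"
  by (intro runs_trans[OF runs_trans[OF runs_step]]) (auto simp: step_def silent.intros)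

text \<open>One continuation for each occurrence of a subprogram: that subprogram followed by what
  remains once it ends. Finitely many lists thus serve as states, however often a
  \<open>Star\<close> repeats.\<close>

primrec conts :: "'a prog \<Rightarrow> 'a prog list \<Rightarrow> 'a prog list set" where
  "conts (Act a) k = {Act a # k}"
| "conts (Seq p q) k = {Seq p q # k} \<union> conts p (q # k) \<union> conts q k"
| "conts (Alt p q) k = {Alt p q # k} \<union> conts p k \<union> conts q k"
| "conts (Star p) k = {Star p # k} \<union> conts p (Star p # k)"

lemma finite_conts: "finite (conts p k)"
  by (induction p arbitrary: k) auto

lemma conts_start: "p # k \<in> conts p k"
  by (cases p) auto

lemma conts_closed: "\<lbrakk>l \<in> conts p k; silent l l' \<or> (\<exists>a. l = Act a # l')\<rbrakk> \<Longrightarrow> l' \<in> conts p k \<or> l' = k"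
proof (induction p arbitrary: k)
  case (Seq p q)
  from Seq.prems(1) consider "l = Seq p q # k" | "l \<in> conts p (q # k)" | "l \<in> conts q k" by auto
  then show ?case
  proof cases
    case 1
    then show ?thesis using Seq.prems(2) conts_start by (auto elim: silent.cases)
  next
    case 2
    then show ?thesis using Seq.IH(1) Seq.prems(2) conts_start[of q k] by auto
  next
    case 3
    then show ?thesis using Seq.IH(2) Seq.prems(2) by auto
  qed
next
  case (Alt p q)
  from Alt.prems(1) consider "l = Alt p q # k" | "l \<in> conts p k" | "l \<in> conts q k" by auto
  then show ?case
  proof cases
    case 1
    then show ?thesis using Alt.prems(2) conts_start by (auto elim: silent.cases)
  qed (use Alt.IH Alt.prems(2) in auto)
next
  case (Star p)
  from Star.prems(1) consider "l = Star p # k" | "l \<in> conts p (Star p # k)" by auto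
  then show ?case
  proof cases
    case 1
    then show ?thesis using Star.prems(2) conts_start by (auto elim: silent.cases)
  next
    case 2
    then show ?thesis using Star.IH Star.prems(2) by auto
  qed
qed (auto elim: silent.cases)

section \<open>Translation into a Turing machine\<close>

type_synonym tape = "int \<Rightarrow> nat"
type_synonym action = "(nat \<times> nat \<times> int) set"

definition act_rel :: "nat set \<Rightarrow> action \<Rightarrow> ((tape \<times> int) \<times> (tape \<times> int)) set" where
  "act_rel \<Gamma> A = {((tp, h), (tp(h := b), h + d)) | tp h b d.
     (tp h, b, d) \<in> A \<and> tp h \<in> \<Gamma> \<and> b \<in> \<Gamma> \<and> d \<in> {-1, 0, 1}}"

definition input_tape :: "nat list \<Rightarrow> tape" where
  "input_tape w = (\<lambda>i. if 0 \<le> i \<and> i < int (length w) then w ! nat i else 0)"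

text \<open>States are codes of control lists, and a silent step becomes a move that rewrites the
  scanned symbol and stays. Time is bounded only in the completeness half: every accepting run must
  be right, but only one of them has to be short.\<close>

theorem prog_to_ntm:
  assumes "finite \<Gamma>"
  obtains M where "ntm_wf M"
    "\<And>w t. ntm_accepts_within M w t \<Longrightarrow> \<exists>c. ((input_tape w, 0), c) \<in> sem (act_rel \<Gamma>) p"
    "\<And>w t c. \<lbrakk>insert 0 (set w) \<subseteq> \<Gamma>; runs (act_rel \<Gamma>) t ([p], (input_tape w, 0)) ([], c)\<rbrakk> \<Longrightarrow>
        ntm_accepts_within M w t"
proof -
  define S where "S = insert [] (conts p [])"
  have finS: "finite S" by (simp add: S_def finite_conts)
  obtain cd :: "action prog list \<Rightarrow> nat" where inj: "inj_on cd S"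
    using finite_imp_inj_to_nat_seg[OF finS] by blast
  define tr where "tr l a l' b d \<longleftrightarrow> a \<in> \<Gamma> \<and> b \<in> \<Gamma> \<and> d \<in> {-1, 0, 1::int} \<and>
     ((\<exists>A. l = Act A # l' \<and> (a, b, d) \<in> A) \<or> silent l l' \<and> b = a \<and> d = 0)" for l a l' b d
  define \<Delta> where "\<Delta> = {(cd l, a, cd l', b, d) | l a l' b d. l \<in> S \<and> l' \<in> S \<and> tr l a l' b d}"
  define M where "M = \<lparr>ntm_delta = \<Delta>, ntm_start = cd [p], ntm_accept = cd []\<rparr>"
  have pS: "[p] \<in> S" using conts_start[of p "[]"] by (simp add: S_def)
  have S_closed: "l' \<in> S" if "l \<in> S" "step (act_rel \<Gamma>) (l, s) (l', s')" for l l' s s'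
  proof -
    from that(2) have *: "silent l l' \<or> (\<exists>a. l = Act a # l')" by (auto simp: step_def)
    then have "l \<noteq> []" by (auto elim: silent.cases)
    then show ?thesis using conts_closed[OF _ *, of p "[]"] that(1) by (auto simp: S_def)
  qed
  have wf: "ntm_wf M"
  proof -
    have "\<Delta> \<subseteq> cd ` S \<times> \<Gamma> \<times> cd ` S \<times> \<Gamma> \<times> {-1, 0, 1}" by (auto simp: \<Delta>_def tr_def)
    then have "finite \<Delta>" by (rule finite_subset) (simp add: finS assms)
    then show ?thesis by (auto simp: ntm_wf_def M_def \<Delta>_def tr_def)
  qed
  have step_tr: "step (act_rel \<Gamma>) (l, (tp, h)) (l', (tp', h')) \<longleftrightarrow>
      (\<exists>b d. tr l (tp h) l' b d \<and> tp' = tp(h := b) \<and> h' = h + d)" if "tp h \<in> \<Gamma>" for l tp h l' tp' h'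
    unfolding step_def tr_def act_rel_def using that by auto
  have ntm: "ntm_step M (cd l, tp, h) c' \<longleftrightarrow>
      (\<exists>l' tp' h'. c' = (cd l', tp', h') \<and> l' \<in> S \<and> tp h \<in> \<Gamma> \<and> step (act_rel \<Gamma>) (l, (tp, h)) (l', (tp', h')))"
    if "l \<in> S" for l tp h c'
  proof
    assume "ntm_step M (cd l, tp, h) c'"
    then obtain q' b d where q: "(cd l, tp h, q', b, d) \<in> \<Delta>" "c' = (q', tp(h := b), h + d)"
      by (auto simp: ntm_step_def M_def)
    then obtain l1 l' where l': "cd l1 = cd l" "l1 \<in> S" "l' \<in> S" "q' = cd l'" "tr l1 (tp h) l' b d"
      by (auto simp: \<Delta>_def)
    then have "tr l (tp h) l' b d" using inj that by (auto dest: inj_onD)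
    moreover then have "tp h \<in> \<Gamma>" by (simp add: tr_def)
    ultimately show "\<exists>l' tp' h'. c' = (cd l', tp', h') \<and> l' \<in> S \<and> tp h \<in> \<Gamma> \<and>
        step (act_rel \<Gamma>) (l, (tp, h)) (l', (tp', h'))"
      using q l' step_tr by blast
  next
    assume "\<exists>l' tp' h'. c' = (cd l', tp', h') \<and> l' \<in> S \<and> tp h \<in> \<Gamma> \<and>
        step (act_rel \<Gamma>) (l, (tp, h)) (l', (tp', h'))"
    then obtain l' tp' h' where *: "c' = (cd l', tp', h')" "l' \<in> S" "tp h \<in> \<Gamma>"
      "step (act_rel \<Gamma>) (l, (tp, h)) (l', (tp', h'))" by blast
    then obtain b d where "tr l (tp h) l' b d" "tp' = tp(h := b)" "h' = h + d" using step_tr by blast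
    moreover then have "(cd l, tp h, cd l', b, d) \<in> \<Delta>" using that *(2) unfolding \<Delta>_def by blast
    ultimately show "ntm_step M (cd l, tp, h) c'" using *(1) by (auto simp: ntm_step_def M_def)
  qed
  have init: "ntm_init M w = (cd [p], input_tape w, 0)" for w
    by (simp add: ntm_init_def M_def input_tape_def)
  have sound: "\<exists>l' s'. l' \<in> S \<and> c' = (cd l', s') \<and> (step (act_rel \<Gamma>) ^^ n) (l, (fst s, snd s)) (l', s')"
    if "ntm_reach M c n c'" "c = (cd l, s)" "l \<in> S" for c n c' l s
    using that
  proof (induction arbitrary: l s rule: ntm_reach.induct)
    case (reach_refl c)
    then show ?case by auto
  next
    case (reach_step c c1 n c')
    obtain tp h where s: "s = (tp, h)" by force
    obtain l1 tp1 h1 where 1: "c1 = (cd l1, tp1, h1)" "l1 \<in> S" "step (act_rel \<Gamma>) (l, (tp, h)) (l1, (tp1, h1))"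
      using reach_step.hyps(1) ntm[OF reach_step.prems(2)] unfolding reach_step.prems(1) s by blast
    obtain l' s' where "l' \<in> S" "c' = (cd l', s')" "(step (act_rel \<Gamma>) ^^ n) (l1, (tp1, h1)) (l', s')"
      using reach_step.IH[OF 1(1,2)] by auto
    then show ?case using 1(3) s relpowp_Suc_I2 by fastforce
  qed
  have complete: "ntm_reach M (cd l, tp, h) n (cd [], c)"
    if "(step (act_rel \<Gamma>) ^^ n) (l, (tp, h)) ([], c)" "l \<in> S" "range tp \<subseteq> \<Gamma>" for n l tp h c
    using that
  proof (induction n arbitrary: l tp h)
    case 0
    then show ?case by (auto intro: ntm_reach.intros)
  next
    case (Suc n)
    obtain l1 tp1 h1 where 1: "step (act_rel \<Gamma>) (l, (tp, h)) (l1, (tp1, h1))"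
      "(step (act_rel \<Gamma>) ^^ n) (l1, (tp1, h1)) ([], c)"
      using relpowp_Suc_D2[OF Suc.prems(1)] by (metis surj_pair)
    have tph: "tp h \<in> \<Gamma>" using Suc.prems(3) by blast
    then obtain b d where "tr l (tp h) l1 b d" "tp1 = tp(h := b)" using 1(1) step_tr by blast
    then have "range tp1 \<subseteq> \<Gamma>" using Suc.prems(3) by (auto simp: tr_def)
    moreover have l1: "l1 \<in> S" using S_closed[OF Suc.prems(2) 1(1)] .
    ultimately have "ntm_reach M (cd l1, tp1, h1) n (cd [], c)" using Suc.IH 1(2) by blast
    moreover have "ntm_step M (cd l, tp, h) (cd l1, tp1, h1)"
      using ntm[OF Suc.prems(2)] 1(1) l1 tph by blast
    ultimately show ?case by (rule reach_step[rotated])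
  qed
  show ?thesis
  proof
    show "ntm_wf M" by (rule wf)
  next
    fix w t assume "ntm_accepts_within M w t"
    then obtain n c where "ntm_reach M (ntm_init M w) n c" "fst c = cd []"
      by (auto simp: ntm_accepts_within_def M_def)
    then obtain l' s' where "l' \<in> S" "cd l' = cd []" "(step (act_rel \<Gamma>) ^^ n) ([p], (input_tape w, 0)) (l', s')"
      using sound[OF _ init pS] by (metis fst_conv prod.collapse)
    moreover then have "l' = []" using inj_onD[OF inj] by (simp add: S_def)
    ultimately show "\<exists>c. ((input_tape w, 0), c) \<in> sem (act_rel \<Gamma>) p"
      using steps_sound[of n "act_rel \<Gamma>" p "[]" "(input_tape w, 0)" s'] by blast
  next
    fix w t c assume w: "insert 0 (set w) \<subseteq> \<Gamma>" and r: "runs (act_rel \<Gamma>) t ([p], (input_tape w, 0)) ([], c)"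
    have "range (input_tape w) \<subseteq> \<Gamma>" using w by (auto simp: input_tape_def)
    moreover obtain m where "m \<le> t" "(step (act_rel \<Gamma>) ^^ m) ([p], (input_tape w, 0)) ([], c)"
      using r by (auto simp: runs_def)
    ultimately have "ntm_reach M (ntm_init M w) m (cd [], c)"
      using complete[OF _ pS] init by simp
    then show "ntm_accepts_within M w t"
      using \<open>m \<le> t\<close> unfolding ntm_accepts_within_def
      by (intro exI[of _ m] exI[of _ "(cd [], c)"]) (simp add: M_def)
  qed
qed

section \<open>Register programs on a marked tape\<close>

text \<open>The two tape ends, an input bit, a guessed predicate, and \<open>R r\<close> for the
  register whose value is the position of the cell.\<close>

datatype mark = LE | RE | I bool | G nat | R nat

instance mark :: countable
  by countable_datatype

text \<open>A cell of the working tape holds a set of marks.  The values 0, 1, 2 are the blank and the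
input symbols, hence the offset.\<close>

definition scode :: "mark set \<Rightarrow> nat" where
  "scode S = 3 + set_encode (to_nat ` S)"

lemma scode_neq [simp]: "scode S \<noteq> 0" "scode S \<noteq> Suc 0" "scode S \<noteq> 2"
  by (simp_all add: scode_def)

lemma scode_inject: "\<lbrakk>finite S; finite T\<rbrakk> \<Longrightarrow> scode S = scode T \<longleftrightarrow> S = T"
  by (simp add: scode_def set_encode_eq inj_image_eq_iff)

datatype reg_op = Has nat mark bool | Inc nat | Reset nat

primrec op_regs :: "reg_op \<Rightarrow> nat set" where
  "op_regs (Has r mk b) = insert r (case mk of R q \<Rightarrow> {q} | _ \<Rightarrow> {})"
| "op_regs (Inc r) = {r}"
| "op_regs (Reset r) = {r}"

definition inp :: "nat \<Rightarrow> mark set" where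
  "inp a = (if a = b0 then {I False} else if a = b1 then {I True} else {})"

locale marked_tape =
  fixes K m :: nat
begin

definition marks :: "mark set" where
  "marks = {LE, RE, I False, I True} \<union> G ` {..<m} \<union> R ` {..<K}"

definition \<Gamma> :: "nat set" where
  "\<Gamma> = {0, b0, b1} \<union> scode ` Pow marks"

lemma finite_marks [simp]: "finite marks"
  by (simp add: marks_def)

lemma finite_\<Gamma>: "finite \<Gamma>"
  by (simp add: \<Gamma>_def)

lemma marks_scode_inject: "\<lbrakk>S \<subseteq> marks; T \<subseteq> marks\<rbrakk> \<Longrightarrow> scode S = scode T \<longleftrightarrow> S = T"
  by (simp add: scode_inject finite_subset)

definition upd :: "(mark set \<Rightarrow> bool) \<Rightarrow> (mark set \<Rightarrow> mark set) \<Rightarrow> int \<Rightarrow> action" where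
  "upd Q F d = {(scode S, scode (F S), d) | S. S \<subseteq> marks \<and> Q S \<and> F S \<subseteq> marks}"

text \<open>The loop may stop anywhere. A premature stop is rejected by the guard of the action that
  follows in each gadget, and the guard inside the loop prevents overshooting.\<close>

definition seek :: "nat \<Rightarrow> action prog" where
  "seek r = Star (Act (upd (\<lambda>S. R r \<notin> S) id 1))"

definition leftwards :: "action prog" where
  "leftwards = Star (Act (upd (\<lambda>S. LE \<notin> S) id (-1)))"

definition home :: "action prog" where
  "home = Seq leftwards (Act (upd (\<lambda>S. LE \<in> S) id 0))"

text \<open>Every gadget starts and ends with the head on cell 0, which makes gadgets composable. An
  increment at the right end leaves the mark where it is, so registers saturate.\<close>

primrec gadget :: "reg_op \<Rightarrow> action prog" where
  "gadget (Has r mk b) = Seq (seek r) (Seq (Act (upd (\<lambda>S. R r \<in> S \<and> (mk \<in> S) = b) id 0)) home)"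
| "gadget (Inc r) = Seq (seek r) (Seq
     (Alt (Act (upd (\<lambda>S. R r \<in> S \<and> RE \<in> S) id 0))
       (Seq (Act (upd (\<lambda>S. R r \<in> S \<and> RE \<notin> S) (\<lambda>S. S - {R r}) 1)) (Act (upd (\<lambda>S. True) (insert (R r)) 0))))
     home)"
| "gadget (Reset r) = Seq (seek r) (Seq (Act (upd (\<lambda>S. R r \<in> S) (\<lambda>S. S - {R r}) 0))
     (Seq leftwards (Act (upd (\<lambda>S. LE \<in> S) (insert (R r)) 0))))"

end

section \<open>Register operations on the tape: correctness and cost\<close>

locale tape_content = marked_tape +
  fixes N :: nat and B :: "nat \<Rightarrow> mark set"
  assumes N_pos: "0 < N"
    and B_sub: "\<And>i. B i \<subseteq> {I False, I True} \<union> G ` {..<m}"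
    and B_outside: "\<And>i. N \<le> i \<Longrightarrow> B i = {}"
begin

definition cell :: "(nat \<Rightarrow> nat) \<Rightarrow> nat \<Rightarrow> mark set" where
  "cell s i = B i \<union> (if i = 0 then {LE} else {}) \<union> (if i = N then {RE} else {}) \<union> {R r | r. r < K \<and> s r = i}"

text \<open>A register value above \<open>N\<close> encodes a register whose mark is currently absent from the tape.\<close>

definition tp :: "(nat \<Rightarrow> nat) \<Rightarrow> tape" where
  "tp s = (\<lambda>i. if 0 \<le> i \<and> i \<le> int N then scode (cell s (nat i)) else 0)"

lemma cell_sub: "cell s i \<subseteq> marks"
  using B_sub[of i] by (auto simp: cell_def marks_def)

lemma cell_iff [simp]:
  "LE \<in> cell s i \<longleftrightarrow> i = 0" "RE \<in> cell s i \<longleftrightarrow> i = N" "R r \<in> cell s i \<longleftrightarrow> r < K \<and> s r = i"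
  "G t \<in> cell s i \<longleftrightarrow> G t \<in> B i" "I b \<in> cell s i \<longleftrightarrow> I b \<in> B i"
  using B_sub[of i] by (auto simp: cell_def)

lemma tp_at [simp]: "i \<le> N \<Longrightarrow> tp s (int i) = scode (cell s i)"
  by (simp add: tp_def)

lemma tp_scode:
  assumes "tp s h = scode S" "S \<subseteq> marks"
  obtains i where "h = int i" "i \<le> N" "S = cell s i"
proof -
  have h: "0 \<le> h \<and> h \<le> int N" using assms(1) scode_neq(1) by (auto simp: tp_def split: if_splits)
  then have "scode (cell s (nat h)) = scode S" using assms(1) by (simp add: tp_def)
  then have "S = cell s (nat h)" using marks_scode_inject[OF cell_sub assms(2)] by simp
  with h show ?thesis by (intro that[of "nat h"]) auto
qed

lemma tp_erase:
  assumes "s r = i" "i \<le> N"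
  shows "(tp s)(int i := scode (cell s i - {R r})) = tp (s(r := Suc N))"
proof
  fix j
  have "x \<in> cell s i - {R r} \<longleftrightarrow> x \<in> cell (s(r := Suc N)) i" for x
    using assms by (cases x) auto
  then have "cell s i - {R r} = cell (s(r := Suc N)) i" by blast
  moreover have "cell s k = cell (s(r := Suc N)) k" if "k \<noteq> i" "k \<le> N" for k
  proof -
    have "x \<in> cell s k \<longleftrightarrow> x \<in> cell (s(r := Suc N)) k" for x
      using that assms by (cases x) auto
    then show ?thesis by blast
  qed
  ultimately show "((tp s)(int i := scode (cell s i - {R r}))) j = tp (s(r := Suc N)) j"
    using assms by (auto simp: tp_def)
qed

lemma tp_put:
  assumes "s r = Suc N" "i \<le> N" "r < K"
  shows "(tp s)(int i := scode (insert (R r) (cell s i))) = tp (s(r := i))"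
proof
  fix j
  have "x \<in> insert (R r) (cell s i) \<longleftrightarrow> x \<in> cell (s(r := i)) i" for x
    using assms by (cases x) auto
  then have "insert (R r) (cell s i) = cell (s(r := i)) i" by blast
  moreover have "cell s k = cell (s(r := i)) k" if "k \<noteq> i" "k \<le> N" for k
  proof -
    have "x \<in> cell s k \<longleftrightarrow> x \<in> cell (s(r := i)) k" for x
      using that assms by (cases x) auto
    then show ?thesis by blast
  qed
  ultimately show "((tp s)(int i := scode (insert (R r) (cell s i)))) j = tp (s(r := i)) j"
    using assms by (auto simp: tp_def)
qed

definition op_rel :: "reg_op \<Rightarrow> ((nat \<Rightarrow> nat) \<times> (nat \<Rightarrow> nat)) set" where
  "op_rel p = (case p of
     Has r mk b \<Rightarrow> {(s, s) | s. (mk \<in> cell s (s r)) = b}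
   | Inc r \<Rightarrow> {(s, s(r := min N (Suc (s r)))) | s. True}
   | Reset r \<Rightarrow> {(s, s(r := 0)) | s. True})"

abbreviation "arel \<equiv> act_rel \<Gamma>"

lemma arel_upd:
  assumes "d \<in> {-1, 0, 1}"
  shows "((tp s, h), c') \<in> arel (upd Q F d) \<longleftrightarrow>
    (\<exists>i\<le>N. h = int i \<and> Q (cell s i) \<and> F (cell s i) \<subseteq> marks \<and> c' = ((tp s)(int i := scode (F (cell s i))), int i + d))"
    (is "?l \<longleftrightarrow> ?r")
proof
  assume ?l
  then obtain S where "S \<subseteq> marks" "tp s h = scode S" "Q S" "F S \<subseteq> marks"
    "c' = ((tp s)(h := scode (F S)), h + d)"
    by (auto simp: act_rel_def upd_def)
  moreover then obtain i where "h = int i" "i \<le> N" "S = cell s i" by (metis tp_scode)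
  ultimately show ?r by blast
next
  assume ?r
  then obtain i where i: "i \<le> N" "h = int i" "Q (cell s i)" "F (cell s i) \<subseteq> marks"
    "c' = ((tp s)(int i := scode (F (cell s i))), int i + d)" by blast
  have "(tp s h, scode (F (cell s i)), d) \<in> upd Q F d"
    using i cell_sub[of s i] unfolding upd_def by simp blast
  moreover have "tp s h \<in> \<Gamma>" "scode (F (cell s i)) \<in> \<Gamma>" using i cell_sub by (auto simp: \<Gamma>_def)
  ultimately show ?l using i assms unfolding act_rel_def by blast
qed

lemma arel_upd_id:
  assumes "d \<in> {-1, 0, 1}"
  shows "((tp s, h), c') \<in> arel (upd Q id d) \<longleftrightarrow>
    (\<exists>i\<le>N. h = int i \<and> Q (cell s i) \<and> c' = (tp s, int i + d))"
proof -
  have "(tp s)(int i := scode (cell s i)) = tp s" if "i \<le> N" for i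
    using that by (simp add: fun_upd_idem)
  then show ?thesis using arel_upd[OF assms, of s h c' Q id] cell_sub by auto
qed

lemma scan_sound:
  assumes "((tp s, h), c') \<in> (arel (upd Q id d))\<^sup>*" "d \<in> {-1, 0, 1}"
  obtains h' where "c' = (tp s, h')"
proof -
  have "\<exists>h'. c' = (tp s, h')"
    using assms(1)
  proof (induction rule: rtrancl_induct)
    case (step y z)
    then show ?case by (auto simp: arel_upd_id[OF assms(2)])
  qed simp
  then show ?thesis using that by blast
qed

lemma seek_sound:
  assumes "((tp s, h), c') \<in> sem arel (seek r)"
  obtains h' where "c' = (tp s, h')"
  by (rule scan_sound[OF assms[unfolded seek_def sem.simps]]) (simp_all add: that)

lemma leftwards_sound:
  assumes "((tp s, h), c') \<in> sem arel leftwards"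
  obtains h' where "c' = (tp s, h')"
  by (rule scan_sound[OF assms[unfolded leftwards_def sem.simps]]) (simp_all add: that)

lemma home_sound:
  assumes "((tp s, h), c') \<in> sem arel home"
  shows "c' = (tp s, 0)"
proof -
  obtain c where c: "((tp s, h), c) \<in> sem arel leftwards" "(c, c') \<in> arel (upd (\<lambda>S. LE \<in> S) id 0)"
    using assms by (auto simp: home_def)
  then obtain h' where "c = (tp s, h')" by (metis leftwards_sound)
  then show ?thesis using c(2) by (simp add: arel_upd_id)
qed

definition ok :: "(nat \<Rightarrow> nat) \<Rightarrow> bool" where
  "ok s \<longleftrightarrow> (\<forall>r. s r \<le> N)"

lemma ok_upd: "\<lbrakk>ok s; v \<le> N\<rbrakk> \<Longrightarrow> ok (s(r := v))"
  by (simp add: ok_def)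

lemma op_rel_ok: "\<lbrakk>(s, s') \<in> op_rel p; ok s\<rbrakk> \<Longrightarrow> ok s'"
  by (cases p) (auto simp: op_rel_def ok_def)

lemma gadget_sound:
  assumes "((tp s, 0), c') \<in> sem arel (gadget p)" "ok s"
  shows "\<exists>s'. c' = (tp s', 0) \<and> (s, s') \<in> op_rel p"
proof (cases p)
  case (Has r mk b)
  obtain c1 c2 where c: "((tp s, 0), c1) \<in> sem arel (seek r)"
    "(c1, c2) \<in> arel (upd (\<lambda>S. R r \<in> S \<and> (mk \<in> S) = b) id 0)" "(c2, c') \<in> sem arel home"
    using assms(1) by (auto simp: Has)
  then obtain h1 where 1: "c1 = (tp s, h1)" by (metis seek_sound)
  then obtain i where i: "i \<le> N" "r < K" "s r = i" "(mk \<in> cell s i) = b" "c2 = (tp s, int i)"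
    using c(2) by (auto simp: arel_upd_id)
  then have "c' = (tp s, 0)" using c(3) home_sound by blast
  then show ?thesis using i by (auto simp: Has op_rel_def)
next
  case (Inc r)
  obtain c1 c2 where c: "((tp s, 0), c1) \<in> sem arel (seek r)"
    "(c1, c2) \<in> arel (upd (\<lambda>S. R r \<in> S \<and> RE \<in> S) id 0) \<union>
      arel (upd (\<lambda>S. R r \<in> S \<and> RE \<notin> S) (\<lambda>S. S - {R r}) 1) O arel (upd (\<lambda>S. True) (insert (R r)) 0)"
    "(c2, c') \<in> sem arel home"
    using assms(1) unfolding Inc gadget.simps sem.simps by blast
  then obtain h1 where 1: "c1 = (tp s, h1)" by (metis seek_sound)
  have "\<exists>h2. c2 = (tp (s(r := min N (Suc (s r)))), h2)"
    using c(2)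
  proof
    assume "(c1, c2) \<in> arel (upd (\<lambda>S. R r \<in> S \<and> RE \<in> S) id 0)"
    then show ?thesis using 1 by (auto simp: arel_upd_id)
  next
    assume "(c1, c2) \<in> arel (upd (\<lambda>S. R r \<in> S \<and> RE \<notin> S) (\<lambda>S. S - {R r}) 1) O
      arel (upd (\<lambda>S. True) (insert (R r)) 0)"
    then obtain c3 where 3: "(c1, c3) \<in> arel (upd (\<lambda>S. R r \<in> S \<and> RE \<notin> S) (\<lambda>S. S - {R r}) 1)"
      "(c3, c2) \<in> arel (upd (\<lambda>S. True) (insert (R r)) 0)" by blast
    obtain i where i: "i \<le> N" "r < K" "s r = i" "i \<noteq> N"
      "c3 = ((tp s)(int i := scode (cell s i - {R r})), int i + 1)"
      using 3(1) by (auto simp: arel_upd 1)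
    then have "c3 = (tp (s(r := Suc N)), int (Suc i))" using tp_erase by simp
    then have "c2 = ((tp (s(r := Suc N)))(int (Suc i) := scode (insert (R r) (cell (s(r := Suc N)) (Suc i)))), int (Suc i))"
      using 3(2) by (auto simp: arel_upd simp del: of_nat_Suc)
    moreover have "min N (Suc (s r)) = Suc i" using i by simp
    ultimately show ?thesis using i tp_put[of "s(r := Suc N)" r "Suc i"] by (simp del: of_nat_Suc)
  qed
  then have "c' = (tp (s(r := min N (Suc (s r)))), 0)" using c(3) home_sound by blast
  then show ?thesis by (auto simp: Inc op_rel_def)
next
  case (Reset r)
  obtain c1 c2 c3 where c: "((tp s, 0), c1) \<in> sem arel (seek r)"
    "(c1, c2) \<in> arel (upd (\<lambda>S. R r \<in> S) (\<lambda>S. S - {R r}) 0)"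
    "(c2, c3) \<in> sem arel leftwards" "(c3, c') \<in> arel (upd (\<lambda>S. LE \<in> S) (insert (R r)) 0)"
    using assms(1) by (auto simp: Reset)
  then obtain h1 where 1: "c1 = (tp s, h1)" by (metis seek_sound)
  then obtain i where i: "i \<le> N" "r < K" "s r = i"
    "c2 = ((tp s)(int i := scode (cell s i - {R r})), int i)"
    using c(2) by (auto simp: arel_upd)
  then have "c2 = (tp (s(r := Suc N)), int i)" using tp_erase by simp
  then obtain h3 where "c3 = (tp (s(r := Suc N)), h3)" using c(3) by (metis leftwards_sound)
  then have "c' = ((tp (s(r := Suc N)))(int 0 := scode (insert (R r) (cell (s(r := Suc N)) 0))), 0)"
    using c(4) by (auto simp: arel_upd)
  then have "c' = (tp (s(r := 0)), 0)"
    using tp_put[of "s(r := Suc N)" r 0] i by simp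
  then show ?thesis by (auto simp: Reset op_rel_def)
qed

lemma runs_upd:
  assumes "i \<le> N" "Q (cell s i)" "F (cell s i) \<subseteq> marks" "d \<in> {-1, 0, 1}"
  shows "runs arel 1 (Act (upd Q F d) # k, (tp s, int i)) (k, ((tp s)(int i := scode (F (cell s i))), int i + d))"
  by (rule runs_Act) (use assms in \<open>simp only: arel_upd, blast\<close>)

lemma runs_upd_id:
  assumes "i \<le> N" "Q (cell s i)" "d \<in> {-1, 0, 1}"
  shows "runs arel 1 (Act (upd Q id d) # k, (tp s, int i)) (k, (tp s, int i + d))"
  by (rule runs_Act) (use assms in \<open>simp only: arel_upd_id, blast\<close>)

lemma runs_seek:
  assumes "s r \<le> N" "i \<le> s r" "r < K"
  shows "runs arel (2 * (s r - i) + 1) (seek r # k, (tp s, int i)) (k, (tp s, int (s r)))"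
  using assms(2)
proof (induction i rule: inc_induct)
  case base
  then show ?case by (simp add: seek_def runs_Star_stop[simplified])
next
  case (step i)
  have "runs arel 1 (Act (upd (\<lambda>S. R r \<notin> S) id 1) # seek r # k, (tp s, int i)) (seek r # k, (tp s, int i + 1))"
    by (rule runs_upd_id) (use step assms in auto)
  then have "runs arel 1 (Act (upd (\<lambda>S. R r \<notin> S) id 1) # seek r # k, (tp s, int i)) (seek r # k, (tp s, int (Suc i)))"
    by (simp add: add.commute)
  from runs_Star_more[OF this[unfolded seek_def] step.IH[unfolded seek_def]] step.hyps
  show ?case unfolding seek_def by (elim runs_mono) simp
qed

lemma runs_leftwards:
  assumes "i \<le> N"
  shows "runs arel (2 * i + 1) (leftwards # k, (tp s, int i)) (k, (tp s, 0))"
  using assms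
proof (induction i)
  case 0
  then show ?case by (simp add: leftwards_def runs_Star_stop[simplified])
next
  case (Suc i)
  have "runs arel 1 (Act (upd (\<lambda>S. LE \<notin> S) id (-1)) # leftwards # k, (tp s, int (Suc i)))
    (leftwards # k, (tp s, int (Suc i) + - 1))"
    by (rule runs_upd_id) (use Suc in auto)
  then have "runs arel 1 (Act (upd (\<lambda>S. LE \<notin> S) id (-1)) # leftwards # k, (tp s, int (Suc i)))
    (leftwards # k, (tp s, int i))" by simp
  from runs_Star_more[OF this[unfolded leftwards_def] Suc.IH[unfolded leftwards_def]] Suc.prems
  show ?case unfolding leftwards_def by simp
qed

lemma runs_home:
  assumes "i \<le> N"
  shows "runs arel (2 * N + 3) (home # k, (tp s, int i)) (k, (tp s, 0))"
proof -
  have "runs arel 1 (Act (upd (\<lambda>S. LE \<in> S) id 0) # k, (tp s, int 0)) (k, (tp s, int 0 + 0))"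
    by (rule runs_upd_id) auto
  from runs_Seq[OF runs_leftwards[OF assms] this[simplified]]
  show ?thesis unfolding home_def using assms by (elim runs_mono) auto
qed

text \<open>One sweep out and one back, at two steps per cell: the silent unfolding of
  \<open>Star\<close> and the move. The constant 20 is a generous allowance for the rest.\<close>

definition op_time :: nat where
  "op_time = 4 * N + 20"

lemma gadget_complete:
  assumes "(s, s') \<in> op_rel p" "ok s" "\<forall>r\<in>op_regs p. r < K"
  shows "runs arel op_time (gadget p # k, (tp s, 0)) (k, (tp s', 0))"
proof -
  have seek: "runs arel (2 * N + 1) (seek r # k, (tp s, 0)) (k, (tp s, int (s r)))" if "r < K" for r k
    using runs_seek[of s r 0 k] that assms(2) by (auto simp: ok_def elim!: runs_mono)
  show ?thesis
  proof (cases p)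
    case (Has r mk b)
    then have r: "r < K" "(mk \<in> cell s (s r)) = b" "s' = s" "s r \<le> N"
      using assms by (auto simp: op_rel_def ok_def)
    have "runs arel 1 (Act (upd (\<lambda>S. R r \<in> S \<and> (mk \<in> S) = b) id 0) # home # k, (tp s, int (s r)))
        (home # k, (tp s, int (s r) + 0))"
      by (rule runs_upd_id) (use r in auto)
    then have "runs arel 1 (Act (upd (\<lambda>S. R r \<in> S \<and> (mk \<in> S) = b) id 0) # home # k, (tp s, int (s r)))
        (home # k, (tp s, int (s r)))" by simp
    from runs_Seq[OF seek[OF r(1)] runs_Seq[OF this runs_home[OF r(4)]]]
    show ?thesis unfolding Has gadget.simps r(3) by (rule runs_mono) (simp add: op_time_def)
  next
    case (Inc r)
    then have r: "r < K" "s' = s(r := min N (Suc (s r)))" "s r \<le> N"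
      using assms by (auto simp: op_rel_def ok_def)
    let ?a = "Act (upd (\<lambda>S. R r \<in> S \<and> RE \<in> S) id 0)"
    let ?b = "Seq (Act (upd (\<lambda>S. R r \<in> S \<and> RE \<notin> S) (\<lambda>S. S - {R r}) 1)) (Act (upd (\<lambda>S. True) (insert (R r)) 0))"
    have "runs arel 4 (Alt ?a ?b # home # k, (tp s, int (s r))) (home # k, (tp s', int (s' r)))"
    proof (cases "s r = N")
      case True
      have "runs arel 1 (?a # home # k, (tp s, int (s r))) (home # k, (tp s, int (s r) + 0))"
        by (rule runs_upd_id) (use True r in auto)
      moreover have "s' = s" using True r by auto
      ultimately have "runs arel 1 (?a # home # k, (tp s, int (s r))) (home # k, (tp s', int (s' r)))"
        by simp
      from runs_Alt1[OF this] show ?thesis by (rule runs_mono) simp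
    next
      case False
      let ?s = "s(r := Suc N)"
      let ?c = "Act (upd (\<lambda>S. True) (insert (R r)) 0)"
      have "min N (Suc (s r)) = Suc (s r)" using False r(3) by simp
      have "runs arel 1 (Act (upd (\<lambda>S. R r \<in> S \<and> RE \<notin> S) (\<lambda>S. S - {R r}) 1) # ?c # home # k, (tp s, int (s r)))
         (?c # home # k, ((tp s)(int (s r) := scode (cell s (s r) - {R r})), int (s r) + 1))"
        by (rule runs_upd) (use False r cell_sub[of s "s r"] in auto)
      moreover have "(tp s)(int (s r) := scode (cell s (s r) - {R r})) = tp ?s"
        using r by (simp add: tp_erase)
      ultimately have 1: "runs arel 1 (Act (upd (\<lambda>S. R r \<in> S \<and> RE \<notin> S) (\<lambda>S. S - {R r}) 1) # ?c # home # k, (tp s, int (s r)))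
         (?c # home # k, (tp ?s, int (Suc (s r))))" by (simp add: add.commute)
      have "runs arel 1 (?c # home # k, (tp ?s, int (Suc (s r))))
         (home # k, ((tp ?s)(int (Suc (s r)) := scode (insert (R r) (cell ?s (Suc (s r))))), int (Suc (s r)) + 0))"
        by (rule runs_upd) (use False r cell_sub[of ?s "Suc (s r)"] in \<open>auto simp: marks_def\<close>)
      moreover have "(tp ?s)(int (Suc (s r)) := scode (insert (R r) (cell ?s (Suc (s r))))) = tp s'"
        using tp_put[of ?s r "Suc (s r)"] r False \<open>min N (Suc (s r)) = Suc (s r)\<close> by simp
      moreover have "s' r = Suc (s r)" using r False by auto
      ultimately have "runs arel 1 (?c # home # k, (tp ?s, int (Suc (s r)))) (home # k, (tp s', int (s' r)))"
        by simp
      from runs_Alt2[OF runs_Seq[OF 1 this]] show ?thesis by (simp add: numeral_eq_Suc)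
    qed
    moreover have "s' r \<le> N" using r by auto
    ultimately show ?thesis unfolding Inc gadget.simps
      by (intro runs_mono[OF runs_Seq[OF seek[OF r(1)] runs_Seq[OF _ runs_home]]]) (auto simp: op_time_def)
  next
    case (Reset r)
    then have r: "r < K" "s' = s(r := 0)" "s r \<le> N"
      using assms by (auto simp: op_rel_def ok_def)
    let ?s = "s(r := Suc N)"
    let ?a = "Act (upd (\<lambda>S. R r \<in> S) (\<lambda>S. S - {R r}) 0)" and ?b = "Act (upd (\<lambda>S. LE \<in> S) (insert (R r)) 0)"
    have "runs arel 1 (?a # k, (tp s, int (s r)))
      (k, ((tp s)(int (s r) := scode (cell s (s r) - {R r})), int (s r) + 0))" for k
      by (rule runs_upd) (use r cell_sub[of s "s r"] in auto)
    then have 1: "runs arel 1 (?a # k, (tp s, int (s r))) (k, (tp ?s, int (s r)))" for k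
      using r by (simp add: tp_erase)
    have "runs arel 1 (?b # k, (tp ?s, int 0)) (k, ((tp ?s)(int 0 := scode (insert (R r) (cell ?s 0))), int 0 + 0))"
      by (rule runs_upd) (use r cell_sub[of ?s 0] in \<open>auto simp: marks_def\<close>)
    moreover have "(tp ?s)(int 0 := scode (insert (R r) (cell ?s 0))) = tp s'"
      using tp_put[of ?s r 0] r by simp
    ultimately have 2: "runs arel 1 (?b # k, (tp ?s, 0)) (k, (tp s', 0))" by simp
    from runs_Seq[OF seek[OF r(1)] runs_Seq[OF 1 runs_Seq[OF runs_leftwards[OF r(3)] 2]]]
    show ?thesis unfolding Reset gadget.simps by (rule runs_mono) (use r in \<open>simp add: op_time_def\<close>)
  qed
qed

end

section \<open>Compiling register programs in polynomial time\<close>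

primrec psubst :: "('a \<Rightarrow> 'b prog) \<Rightarrow> 'a prog \<Rightarrow> 'b prog" where
  "psubst g (Act a) = g a"
| "psubst g (Seq p q) = Seq (psubst g p) (psubst g q)"
| "psubst g (Alt p q) = Alt (psubst g p) (psubst g q)"
| "psubst g (Star p) = Star (psubst g p)"

text \<open>A loop is charged one run of its body and one unfolding for each pair of stores, of
  which there are at most \<open>(N + 1) ^ (2 * K)\<close>, plus the exit. As \<open>K\<close> is
  fixed with the program, this is polynomial in \<open>N\<close>.\<close>

primrec ptime :: "nat \<Rightarrow> nat \<Rightarrow> reg_op prog \<Rightarrow> nat" where
  "ptime K N (Act a) = 4 * N + 20"
| "ptime K N (Seq p q) = 1 + ptime K N p + ptime K N q"
| "ptime K N (Alt p q) = 1 + ptime K N p + ptime K N q"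
| "ptime K N (Star p) = (N + 1) ^ (2 * K) * (ptime K N p + 1) + 1"

lemma polynomial_sum:
  fixes f g :: "nat \<Rightarrow> nat"
  assumes "f N \<le> C * (N + 1) ^ d" "g N \<le> C' * (N + 1) ^ d'"
  shows "1 + f N + g N \<le> (1 + C + C') * (N + 1) ^ (d + d')"
proof -
  have "C * (N + 1) ^ d \<le> C * (N + 1) ^ (d + d')" "C' * (N + 1) ^ d' \<le> C' * (N + 1) ^ (d + d')"
    by (intro mult_left_mono power_increasing; simp)+
  moreover have "1 \<le> (N + 1) ^ (d + d')" by simp
  ultimately have "1 + f N + g N \<le>
      (N + 1) ^ (d + d') + C * (N + 1) ^ (d + d') + C' * (N + 1) ^ (d + d')"
    using assms by linarith
  then show ?thesis by (simp add: algebra_simps)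
qed

lemma ptime_polynomial: "\<exists>C d. \<forall>N. ptime K N p \<le> C * (N + 1) ^ d"
proof (induction p)
  case (Act a)
  show ?case by (intro exI[of _ 24] exI[of _ 1]) simp
next
  case (Seq p q)
  then show ?case using polynomial_sum[of "\<lambda>N. ptime K N p" _ _ _ "\<lambda>N. ptime K N q"] by (simp del: One_nat_def) blast
next
  case (Alt p q)
  then show ?case using polynomial_sum[of "\<lambda>N. ptime K N p" _ _ _ "\<lambda>N. ptime K N q"] by (simp del: One_nat_def) blast
next
  case (Star p)
  then obtain C d where *: "\<And>N. ptime K N p \<le> C * (N + 1) ^ d"
    by blast
  have "ptime K N (Star p) \<le> (C + 2) * (N + 1) ^ (2 * K + d)" for N
  proof -
    have "(N + 1) ^ (2 * K) * (ptime K N p + 1) \<le> (N + 1) ^ (2 * K) * (C * (N + 1) ^ d + (N + 1) ^ d)"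
      using *[of N] by (intro mult_left_mono add_mono) auto
    also have "\<dots> = (C + 1) * (N + 1) ^ (2 * K + d)" by (simp add: power_add algebra_simps)
    finally have "ptime K N (Star p) \<le> (C + 1) * (N + 1) ^ (2 * K + d) + 1" by simp
    also have "\<dots> \<le> (C + 1) * (N + 1) ^ (2 * K + d) + (N + 1) ^ (2 * K + d)" by simp
    finally show ?thesis by (simp add: algebra_simps)
  qed
  then show ?case by blast
qed

context tape_content
begin

lemma sem_ok: "\<lbrakk>(s, s') \<in> sem op_rel p; ok s\<rbrakk> \<Longrightarrow> ok s'"
proof (induction p arbitrary: s s')
  case (Star p)
  from Star.prems(1)[simplified] Star.prems(2) show ?case
    by (induction rule: rtrancl_induct) (use Star.IH in auto)
qed (auto dest: op_rel_ok)

lemma psubst_sound: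
  "\<lbrakk>((tp s, 0), c') \<in> sem arel (psubst gadget p); ok s\<rbrakk> \<Longrightarrow>
    \<exists>s'. c' = (tp s', 0) \<and> (s, s') \<in> sem op_rel p"
proof (induction p arbitrary: s c')
  case (Act a)
  then show ?case using gadget_sound by simp
next
  case (Seq p q)
  obtain c where c: "((tp s, 0), c) \<in> sem arel (psubst gadget p)" "(c, c') \<in> sem arel (psubst gadget q)"
    using Seq.prems(1) unfolding psubst.simps sem.simps by blast
  then obtain s1 where 1: "c = (tp s1, 0)" "(s, s1) \<in> sem op_rel p" using Seq by blast
  then obtain s' where "c' = (tp s', 0)" "(s1, s') \<in> sem op_rel q"
    using c Seq.IH(2) sem_ok Seq.prems(2) by blast
  then show ?case using 1 by auto
next
  case (Alt p q)
  then show ?case unfolding psubst.simps sem.simps by blast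
next
  case (Star p)
  have "\<exists>s'. c' = (tp s', 0) \<and> (s, s') \<in> (sem op_rel p)\<^sup>*"
    using Star.prems(1)[unfolded psubst.simps sem.simps]
  proof (induction rule: rtrancl_induct)
    case (step y z)
    then obtain s1 where 1: "y = (tp s1, 0)" "(s, s1) \<in> (sem op_rel p)\<^sup>*" by blast
    then have "ok s1" using sem_ok[of s s1 "Star p"] Star.prems(2) by simp
    then obtain s2 where "z = (tp s2, 0)" "(s1, s2) \<in> sem op_rel p"
      using Star.IH step.hyps(2) 1 by blast
    then show ?case using rtrancl_into_rtrancl[OF 1(2)] by blast
  qed auto
  then show ?case by simp
qed

text \<open>Registers from \<open>K\<close> on have no mark on the tape. They are pinned to 0, since
  otherwise there would be infinitely many stores.\<close>

definition stores :: "(nat \<Rightarrow> nat) set" where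
  "stores = {s. ok s \<and> (\<forall>r\<ge>K. s r = 0)}"

lemma finite_stores: "finite stores" and card_stores: "card stores \<le> (N + 1) ^ K"
proof -
  let ?f = "\<lambda>s::nat \<Rightarrow> nat. map s [0..<K]"
  have inj: "inj_on ?f stores"
  proof
    fix s s' assume s: "s \<in> stores" "s' \<in> stores" and eq: "?f s = ?f s'"
    show "s = s'"
    proof
      fix r show "s r = s' r"
        using s eq by (cases "r < K") (auto simp: stores_def)
    qed
  qed
  have sub: "?f ` stores \<subseteq> {xs. set xs \<subseteq> {..N} \<and> length xs = K}"
    by (auto simp: stores_def ok_def)
  have fin: "finite {xs. set xs \<subseteq> {..N} \<and> length xs = K}"
    by (rule finite_lists_length_eq) simp
  show "finite stores" using finite_imageD[OF finite_subset[OF sub fin] inj] .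
  have "card stores = card (?f ` stores)" using inj by (simp add: card_image)
  also have "\<dots> \<le> (N + 1) ^ K"
    using card_mono[OF fin sub] card_lists_length_eq[of "{..N}" K] by simp
  finally show "card stores \<le> (N + 1) ^ K" .
qed

definition regs_ok :: "reg_op prog \<Rightarrow> bool" where
  "regs_ok p \<longleftrightarrow> (\<forall>a\<in>set_prog p. \<forall>r\<in>op_regs a. r < K)"

lemma regs_ok_simps [simp]:
  "regs_ok (Act a) \<longleftrightarrow> (\<forall>r\<in>op_regs a. r < K)"
  "regs_ok (Seq p q) \<longleftrightarrow> regs_ok p \<and> regs_ok q"
  "regs_ok (Alt p q) \<longleftrightarrow> regs_ok p \<and> regs_ok q"
  "regs_ok (Star p) \<longleftrightarrow> regs_ok p"
  by (auto simp: regs_ok_def)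

lemma sem_stores: "\<lbrakk>(s, s') \<in> sem op_rel p; regs_ok p; s \<in> stores\<rbrakk> \<Longrightarrow> s' \<in> stores"
proof (induction p arbitrary: s s')
  case (Act a)
  then have "ok s'" using op_rel_ok by (auto simp: stores_def)
  moreover have "\<forall>r\<ge>K. s' r = 0"
    using Act by (cases a) (auto simp: op_rel_def regs_ok_def stores_def)
  ultimately show ?case by (simp add: stores_def)
next
  case (Seq p q)
  then show ?case by auto
next
  case (Alt p q)
  then show ?case by auto
next
  case (Star p)
  have "regs_ok p" using Star.prems(2) by (simp add: regs_ok_def)
  from Star.prems(1)[simplified] Star.prems(3) show ?case
    by (induction rule: rtrancl_induct) (use Star.IH \<open>regs_ok p\<close> in auto)
qed

text \<open>A loop need not visit a store twice, so the number of stores bounds its length.\<close>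

lemma psubst_complete:
  "\<lbrakk>(s, s') \<in> sem op_rel p; regs_ok p; s \<in> stores\<rbrakk> \<Longrightarrow>
    runs arel (ptime K N p) (psubst gadget p # k, (tp s, 0)) (k, (tp s', 0))"
proof (induction p arbitrary: s s' k)
  case (Act a)
  then show ?case using gadget_complete[of s s' a k] by (simp add: op_time_def regs_ok_def stores_def)
next
  case (Seq p q)
  then obtain s1 where 1: "(s, s1) \<in> sem op_rel p" "(s1, s') \<in> sem op_rel q" by auto
  have r: "regs_ok p" "regs_ok q" using Seq.prems(2) by (auto simp: regs_ok_def)
  have "s1 \<in> stores" using sem_stores 1 r Seq.prems by blast
  then show ?case
    using runs_Seq[OF Seq.IH(1)[OF 1(1) r(1) Seq.prems(3)] Seq.IH(2)[OF 1(2) r(2)]] by simp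
next
  case (Alt p q)
  have r: "regs_ok p" "regs_ok q" using Alt.prems(2) by (auto simp: regs_ok_def)
  from Alt.prems(1) consider "(s, s') \<in> sem op_rel p" | "(s, s') \<in> sem op_rel q" by auto
  then show ?case
  proof cases
    case 1
    from runs_Alt1[OF Alt.IH(1)[OF this r(1) Alt.prems(3)]] show ?thesis
      unfolding psubst.simps by (rule runs_mono) simp
  next
    case 2
    from runs_Alt2[OF Alt.IH(2)[OF this r(2) Alt.prems(3)]] show ?thesis
      unfolding psubst.simps by (rule runs_mono) simp
  qed
next
  case (Star p)
  have r: "regs_ok p" using Star.prems(2) by (simp add: regs_ok_def)
  define Rl where "Rl = sem op_rel p \<inter> stores \<times> stores"
  have "(s, s') \<in> Rl\<^sup>*"
    using Star.prems(1)[unfolded sem.simps]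
  proof (induction rule: rtrancl_induct)
    case (step y z)
    then have "y \<in> stores" using sem_stores[of s y "Star p"] Star.prems by simp
    then have "(y, z) \<in> Rl" using step.hyps(2) sem_stores[OF _ r] by (auto simp: Rl_def)
    then show ?case using step.IH by (meson rtrancl_into_rtrancl)
  qed simp
  moreover have sub: "Rl \<subseteq> stores \<times> stores" and fs: "finite (stores \<times> stores)"
    using finite_stores by (auto simp: Rl_def)
  then have fin: "finite Rl" and "card Rl \<le> card (stores \<times> stores)"
    using finite_subset[OF sub fs] card_mono[OF fs sub] by auto
  then have card: "card Rl \<le> (N + 1) ^ (2 * K)"
    using mult_mono[OF card_stores card_stores]
    by (simp add: card_cartesian_product mult_2 power_add)
  \<comment> \<open>A path in a finite relation can be shortened to at most as many steps as the
    relation has edges. Counting edges rather than stores gives the exponent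
    \<open>2 * K\<close>.\<close>
  ultimately obtain n where n: "n \<le> card Rl" "(s, s') \<in> Rl ^^ n"
    using rtrancl_finite_eq_relpow[OF fin] by auto
  have "runs arel (n * (ptime K N p + 1) + 1) (Star (psubst gadget p) # k, (tp s, 0)) (k, (tp s', 0))"
    using n(2)
  proof (induction n arbitrary: s)
    case 0
    then show ?case using runs_Star_stop[of arel "psubst gadget p" k] by simp
  next
    case (Suc n)
    then obtain s1 where 1: "(s, s1) \<in> Rl" "(s1, s') \<in> Rl ^^ n" by (meson relpow_Suc_E2)
    then have "(s, s1) \<in> sem op_rel p" "s \<in> stores" by (auto simp: Rl_def)
    from runs_Star_more[OF Star.IH[OF this(1) r this(2)] Suc.IH[OF 1(2)]]
    show ?case by (rule runs_mono) simp
  qed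
  moreover have "n * (ptime K N p + 1) + 1 \<le> ptime K N (Star p)"
    using n(1) card by (simp only: ptime.simps) (intro add_mono mult_right_mono; linarith)
  ultimately show ?case unfolding psubst.simps by (rule runs_mono)
qed

end

section \<open>Guessing the marked tape\<close>

context marked_tape
begin

text \<open>The certificate is guessed here: the symbol read becomes a mark, joined with an
  arbitrary set of guess marks. Blanks are accepted too, so the tape may extend beyond the
  input.\<close>

definition fill :: "mark set \<Rightarrow> action" where
  "fill E = {(a, scode (E \<union> inp a \<union> X), 1) | a X. a \<in> {0, b0, b1} \<and> X \<subseteq> G ` {..<m}}"

definition first_marks :: "mark set" where
  "first_marks = insert LE (R ` {..<K})"

text \<open>The sweep may end at any blank, which amounts to guessing the length \<open>N\<close>.
  Demanding a blank where \<open>RE\<close> is written ensures that the whole input has been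
  read.\<close>

definition prepare :: "action prog" where
  "prepare = Seq (Act (fill first_marks)) (Seq (Star (Act (fill {}))) (Seq (Act {(0, scode {RE}, 0)}) home))"

definition part :: "tape \<Rightarrow> (nat \<Rightarrow> mark set) \<Rightarrow> nat \<Rightarrow> tape" where
  "part T X i = (\<lambda>j. if 0 \<le> j \<and> j < int i
     then scode ((if j = 0 then first_marks else {}) \<union> inp (T j) \<union> X (nat j)) else T j)"

lemma inp_sub: "inp a \<subseteq> {I False, I True}"
  by (auto simp: inp_def)

lemma fill_step:
  "((part T X i, int i), c') \<in> act_rel \<Gamma> (fill (if i = 0 then first_marks else {})) \<longleftrightarrow>
    (\<exists>Y\<subseteq>G ` {..<m}. T (int i) \<in> {0, b0, b1} \<and> c' = (part T (X(i := Y)) (Suc i), int (Suc i)))"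
proof -
  let ?E = "if i = 0 then first_marks else {}"
  have T: "part T X i (int i) = T (int i)" by (simp add: part_def)
  have sub: "?E \<union> inp a \<union> Y \<subseteq> marks" if "Y \<subseteq> G ` {..<m}" for a Y
    using that inp_sub[of a] by (auto simp: marks_def first_marks_def)
  have upd: "(part T X i)(int i := scode (?E \<union> inp (T (int i)) \<union> Y)) = part T (X(i := Y)) (Suc i)" for Y
    by (auto simp: part_def fun_eq_iff)
  show ?thesis
  proof
    assume "((part T X i, int i), c') \<in> act_rel \<Gamma> (fill ?E)"
    then obtain Y where "Y \<subseteq> G ` {..<m}" "T (int i) \<in> {0, b0, b1}"
      "c' = ((part T X i)(int i := scode (?E \<union> inp (T (int i)) \<union> Y)), int i + 1)"
      unfolding act_rel_def fill_def mem_Collect_eq Pair_inject T by (elim exE conjE) (simp add: T)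
    then show "\<exists>Y\<subseteq>G ` {..<m}. T (int i) \<in> {0, b0, b1} \<and> c' = (part T (X(i := Y)) (Suc i), int (Suc i))"
      unfolding upd by auto
  next
    assume "\<exists>Y\<subseteq>G ` {..<m}. T (int i) \<in> {0, b0, b1} \<and> c' = (part T (X(i := Y)) (Suc i), int (Suc i))"
    then obtain Y where Y: "Y \<subseteq> G ` {..<m}" "T (int i) \<in> {0, b0, b1}"
      "c' = (part T (X(i := Y)) (Suc i), int (Suc i))" by blast
    have c': "c' = ((part T X i)(int i := scode (?E \<union> inp (T (int i)) \<union> Y)), int i + 1)"
      unfolding upd using Y by simp
    have "(T (int i), scode (?E \<union> inp (T (int i)) \<union> Y), 1) \<in> fill ?E"
      unfolding fill_def using Y by blast
    moreover have "scode (?E \<union> inp (T (int i)) \<union> Y) \<in> \<Gamma>" unfolding \<Gamma>_def using sub[OF Y(1)] by blast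
    moreover have "T (int i) \<in> \<Gamma>" using Y(2) by (auto simp: \<Gamma>_def)
    ultimately show "((part T X i, int i), c') \<in> act_rel \<Gamma> (fill ?E)"
      unfolding act_rel_def using c' T by auto
  qed
qed

definition content :: "tape \<Rightarrow> nat \<Rightarrow> (nat \<Rightarrow> mark set) \<Rightarrow> nat \<Rightarrow> mark set" where
  "content T N X i = (if i < N then inp (T (int i)) \<union> X i else {})"

lemma tape_content_content:
  assumes "0 < N" "\<And>i. X i \<subseteq> G ` {..<m}"
  shows "tape_content m N (content T N X)"
proof
  show "content T N X i \<subseteq> {I False, I True} \<union> G ` {..<m}" for i
    unfolding content_def using inp_sub[of "T (int i)"] assms(2)[of i] by (simp split: if_split) blast
  show "content T N X i = {}" if "N \<le> i" for i
    using that by (simp add: content_def)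
qed (rule assms(1))

lemma part_finish:
  assumes "0 < N" "\<And>i. X i \<subseteq> G ` {..<m}" "\<And>j. j < 0 \<or> int N \<le> j \<Longrightarrow> T j = 0"
  shows "(part T X N)(int N := scode {RE}) = tape_content.tp K N (content T N X) (\<lambda>_. 0)"
proof
  fix j
  interpret tape_content K m N "content T N X" by (rule tape_content_content[OF assms(1,2)])
  have first: "(\<lambda>x. R x) ` {..<K} = {R r | r. r < K}" by auto
  consider "j < 0 \<or> j > int N" | "j = int N" | "0 \<le> j" "j < int N" by linarith
  then show "((part T X N)(int N := scode {RE})) j = tp (\<lambda>_. 0) j"
  proof cases
    case 1
    then show ?thesis using assms(3)[of j] by (auto simp: part_def tp_def)
  next
    case 2
    then show ?thesis using assms(1) by (simp add: cell_def content_def)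
  next
    case 3
    then obtain i where "j = int i" "i < N" by (metis nonneg_int_cases of_nat_less_iff)
    then show ?thesis
      by (auto simp: part_def cell_def content_def first_marks_def first Un_ac intro!: arg_cong[of _ _ scode])
  qed
qed

lemma fill_star_sound:
  assumes "((part T X i, int i), c') \<in> (act_rel \<Gamma> (fill {}))\<^sup>*" "0 < i" "\<And>i. X i \<subseteq> G ` {..<m}"
  shows "\<exists>n X'. 0 < n \<and> (\<forall>i. X' i \<subseteq> G ` {..<m}) \<and> c' = (part T X' n, int n)"
  using assms(1)
proof (induction rule: rtrancl_induct)
  case base
  then show ?case using assms by blast
next
  case (step y z)
  then obtain n X' where n: "0 < n" "\<forall>i. X' i \<subseteq> G ` {..<m}" "y = (part T X' n, int n)" by blast
  then obtain Y where "Y \<subseteq> G ` {..<m}" "z = (part T (X'(n := Y)) (Suc n), int (Suc n))"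
    using step.hyps(2) fill_step[of T X' n z] by auto
  moreover then have "\<forall>i. (X'(n := Y)) i \<subseteq> G ` {..<m}" using n by simp
  ultimately show ?case by blast
qed

lemma input_tape_zero:
  assumes "w \<in> lists {b0, b1}"
  shows "input_tape w (int N) = 0 \<longleftrightarrow> length w \<le> N"
    and "length w \<le> N \<Longrightarrow> j < 0 \<or> int N \<le> j \<Longrightarrow> input_tape w j = 0"
    and "input_tape w j \<in> {0, b0, b1}"
proof -
  have nth: "w ! i \<in> {b0, b1}" if "i < length w" for i using that assms by (auto simp: in_lists_conv_set)
  show "input_tape w (int N) = 0 \<longleftrightarrow> length w \<le> N"
    using nth[of N] by (auto simp: input_tape_def b0_def b1_def not_less)
  show "input_tape w j = 0" if "length w \<le> N" "j < 0 \<or> int N \<le> j"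
    using that by (auto simp: input_tape_def)
  show "input_tape w j \<in> {0, b0, b1}"
    using nth[of "nat j"] by (auto simp: input_tape_def nat_less_iff)
qed

lemma prepare_sound:
  assumes "((input_tape w, 0), c) \<in> sem (act_rel \<Gamma>) prepare" "w \<in> lists {b0, b1}"
  shows "\<exists>N X. 0 < N \<and> length w \<le> N \<and> (\<forall>i. X i \<subseteq> G ` {..<m}) \<and>
    c = (tape_content.tp K N (content (input_tape w) N X) (\<lambda>_. 0), 0)"
proof -
  let ?T = "input_tape w"
  obtain c1 c2 c3 where c: "((?T, 0), c1) \<in> act_rel \<Gamma> (fill first_marks)"
    "(c1, c2) \<in> (act_rel \<Gamma> (fill {}))\<^sup>*" "(c2, c3) \<in> act_rel \<Gamma> {(0, scode {RE}, 0)}"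
    "(c3, c) \<in> sem (act_rel \<Gamma>) home"
    using assms(1) unfolding prepare_def sem.simps by blast
  have "part ?T (\<lambda>_. {}) 0 = ?T" by (auto simp: part_def)
  then obtain Y where Y: "Y \<subseteq> G ` {..<m}" "c1 = (part ?T ((\<lambda>_. {})(0 := Y)) 1, int 1)"
    using c(1) fill_step[of ?T "\<lambda>_. {}" 0 c1] by auto
  have "((\<lambda>_. {})(0 := Y)) i \<subseteq> G ` {..<m}" for i :: nat using Y(1) by simp
  then obtain N X where N: "0 < N" "\<And>i. X i \<subseteq> G ` {..<m}" "c2 = (part ?T X N, int N)"
    using fill_star_sound[of ?T _ 1 c2] c(2) unfolding Y(2) by (metis zero_less_one)
  have "part ?T X N (int N) = ?T (int N)" by (simp add: part_def)
  then have 3: "?T (int N) = 0" "c3 = ((part ?T X N)(int N := scode {RE}), int N)"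
    using c(3) by (auto simp: N act_rel_def)
  then have len: "length w \<le> N" using input_tape_zero(1)[OF assms(2)] by blast
  interpret tape_content K m N "content ?T N X" by (rule tape_content_content[OF N(1,2)])
  have "c3 = (tp (\<lambda>_. 0), int N)"
    using part_finish[OF N(1,2) input_tape_zero(2)[OF assms(2) len]] 3(2) by simp
  then have "c = (tp (\<lambda>_. 0), 0)" using home_sound c(4) by blast
  then show ?thesis using N len by blast
qed

lemma prepare_complete:
  assumes "0 < N" "\<And>i. X i \<subseteq> G ` {..<m}" "length w \<le> N" "w \<in> lists {b0, b1}"
  shows "runs (act_rel \<Gamma>) (4 * N + 20) (prepare # k, (input_tape w, 0))
    (k, (tape_content.tp K N (content (input_tape w) N X) (\<lambda>_. 0), 0))"
proof -
  let ?T = "input_tape w" and ?r = "act_rel \<Gamma>"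
  interpret tape_content K m N "content ?T N X" by (rule tape_content_content[OF assms(1,2)])
  have step: "((part ?T X i, int i), (part ?T X (Suc i), int (Suc i))) \<in> ?r (fill (if i = 0 then first_marks else {}))" for i
    unfolding fill_step using assms(2)[of i] input_tape_zero(3)[OF assms(4)] by (intro exI[of _ "X i"]) simp
  have "part ?T X 0 = ?T" by (auto simp: part_def)
  then have 1: "runs ?r 1 (Act (fill first_marks) # k, (?T, 0)) (k, (part ?T X 1, int 1))" for k
    using step[of 0] by (intro runs_Act) simp
  have 2: "runs ?r (2 * (N - i) + 1) (Star (Act (fill {})) # k, (part ?T X i, int i)) (k, (part ?T X N, int N))"
    if "i \<le> N" "0 < i" for i k
    using that
  proof (induction i rule: inc_induct)
    case base
    then show ?case using runs_Star_stop[of ?r] by simp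
  next
    case (step i)
    have "runs ?r 1 (Act (fill {}) # k, (part ?T X i, int i)) (k, (part ?T X (Suc i), int (Suc i)))" for k
      using \<open>\<And>i. ((part ?T X i, int i), (part ?T X (Suc i), int (Suc i))) \<in> _\<close>[of i] step.prems
      by (intro runs_Act) simp
    from runs_Star_more[OF this step.IH] step.hyps show ?case by (auto elim: runs_mono)
  qed
  have T: "part ?T X N (int N) = 0"
    using input_tape_zero(1)[OF assms(4), of N] assms(3) by (simp add: part_def)
  have "{RE} \<subseteq> marks" by (simp add: marks_def)
  then have "((part ?T X N, int N), ((part ?T X N)(int N := scode {RE}), int N)) \<in> ?r {(0, scode {RE}, 0)}"
    using T unfolding act_rel_def by (auto simp: \<Gamma>_def)
  then have "((part ?T X N, int N), (tp (\<lambda>_. 0), int N)) \<in> ?r {(0, scode {RE}, 0)}"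
    using part_finish[OF assms(1,2) input_tape_zero(2)[OF assms(4,3)]] by simp
  then have 3: "runs ?r 1 (Act {(0, scode {RE}, 0)} # k, (part ?T X N, int N)) (k, (tp (\<lambda>_. 0), int N))" for k
    by (rule runs_Act)
  from runs_Seq[OF 1 runs_Seq[OF 2[of 1] runs_Seq[OF 3 runs_home[OF order_refl]]]]
  show ?thesis unfolding prepare_def by (rule runs_mono) (use assms(1) in auto)
qed

end

section \<open>First-order formulas over marked tapes\<close>

datatype tm = V nat | C nat | Add tm tm | Mul tm tm

text \<open>Formulas use de Bruijn levels: at depth \<open>d\<close> the quantifier binds variable \<open>d\<close>.\<close>

datatype fo = Eq tm nat | Mk mark tm | Neg fo | Conj fo fo | Ex fo

primrec tval :: "(nat \<Rightarrow> nat) \<Rightarrow> tm \<Rightarrow> nat" where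
  "tval s (V i) = s i"
| "tval s (C n) = n"
| "tval s (Add t u) = tval s t + tval s u"
| "tval s (Mul t u) = tval s t * tval s u"

text \<open>Quantifiers are bounded by \<open>N\<close>, but terms take their true values, possibly
  beyond. One side of an equation is a variable, hence below \<open>N\<close> in every assignment of
  interest, so evaluation that saturates at \<open>N\<close> still decides it.\<close>

primrec holds :: "nat \<Rightarrow> (nat \<Rightarrow> mark set) \<Rightarrow> fo \<Rightarrow> nat \<Rightarrow> (nat \<Rightarrow> nat) \<Rightarrow> bool" where
  "holds N B (Eq t j) d s \<longleftrightarrow> tval s t = s j"
| "holds N B (Mk mk t) d s \<longleftrightarrow> mk \<in> B (tval s t)"
| "holds N B (Neg f) d s \<longleftrightarrow> \<not> holds N B f d s"
| "holds N B (Conj f g) d s \<longleftrightarrow> holds N B f d s \<and> holds N B g d s"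
| "holds N B (Ex f) d s \<longleftrightarrow> (\<exists>v<N. holds N B f (Suc d) (s(d := v)))"

primrec tvars_below :: "tm \<Rightarrow> nat \<Rightarrow> bool" where
  "tvars_below (V i) d \<longleftrightarrow> i < d"
| "tvars_below (C n) d \<longleftrightarrow> True"
| "tvars_below (Add t u) d \<longleftrightarrow> tvars_below t d \<and> tvars_below u d"
| "tvars_below (Mul t u) d \<longleftrightarrow> tvars_below t d \<and> tvars_below u d"

primrec wf_fo :: "fo \<Rightarrow> nat \<Rightarrow> bool" where
  "wf_fo (Eq t j) d \<longleftrightarrow> tvars_below t d \<and> j < d"
| "wf_fo (Mk mk t) d \<longleftrightarrow> tvars_below t d \<and> (case mk of I _ \<Rightarrow> True | G _ \<Rightarrow> True | _ \<Rightarrow> False)"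
| "wf_fo (Neg f) d \<longleftrightarrow> wf_fo f d"
| "wf_fo (Conj f g) d \<longleftrightarrow> wf_fo f d \<and> wf_fo g d"
| "wf_fo (Ex f) d \<longleftrightarrow> wf_fo f (Suc d)"

lemma tval_cong: "\<lbrakk>tvars_below t d; \<And>i. i < d \<Longrightarrow> s i = s' i\<rbrakk> \<Longrightarrow> tval s t = tval s' t"
  by (induction t) auto

lemma tvars_below_mono: "\<lbrakk>tvars_below t d; d \<le> d'\<rbrakk> \<Longrightarrow> tvars_below t d'"
  by (induction t) auto

lemma holds_cong: "\<lbrakk>wf_fo f d; \<And>i. i < d \<Longrightarrow> s i = s' i\<rbrakk> \<Longrightarrow> holds N B f d s = holds N B f d s'"
proof (induction f arbitrary: d s s')
  case (Eq t j)
  then show ?case using tval_cong[of t d s s'] by simp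
next
  case (Mk mk t)
  then show ?case using tval_cong[of t d s s'] by simp
next
  case (Ex f)
  have "holds N B f (Suc d) (s(d := v)) = holds N B f (Suc d) (s'(d := v))" for v
    by (rule Ex.IH) (use Ex.prems in \<open>auto simp: less_Suc_eq\<close>)
  then show ?case by simp
next
  case (Conj f g)
  then show ?case by (metis holds.simps(4) wf_fo.simps(4))
next
  case (Neg f)
  then show ?case by (metis holds.simps(3) wf_fo.simps(3))
qed

declare sem.simps(2) [simp del]

lemma in_sem_Seq [simp]:
  "(s, s') \<in> sem f (Seq p q) \<longleftrightarrow> (\<exists>t. (s, t) \<in> sem f p \<and> (t, s') \<in> sem f q)"
  by (auto simp: sem.simps(2))

section \<open>Compiling terms and formulas\<close>

definition loop :: "nat \<Rightarrow> nat \<Rightarrow> reg_op prog \<Rightarrow> reg_op prog" where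
  "loop c i p = Seq (Act (Reset c))
     (Seq (Star (Seq (Act (Has c (R i) False)) (Seq p (Act (Inc c))))) (Act (Has c (R i) True)))"

text \<open>The value ends up in register \<open>r\<close>, and the registers above it are scratch
  space. A test that must succeed serves as a skip: for \<open>V i\<close> the loop guard has just
  made it, and for \<open>C n\<close> a register is compared with itself.\<close>

primrec tcomp :: "tm \<Rightarrow> nat \<Rightarrow> reg_op prog" where
  "tcomp (V i) r = loop r i (Act (Has r (R i) False))"
| "tcomp (C n) r = Seq (Act (Reset r)) (((Seq (Act (Inc r))) ^^ n) (Act (Has r (R r) True)))"
| "tcomp (Add t u) r = Seq (tcomp t r) (Seq (tcomp u (r + 1)) (loop (r + 2) (r + 1) (Act (Inc r))))"
| "tcomp (Mul t u) r = Seq (tcomp t (r + 1)) (Seq (tcomp u (r + 2)) (Seq (Act (Reset r))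
     (loop (r + 3) (r + 1) (loop (r + 4) (r + 2) (Act (Inc r))))))"

text \<open>\<open>comp f d b\<close> can run to completion iff the truth value of \<open>f\<close> is \<open>b\<close>: an existential
quantifier is guessed, a universal one (\<open>b = False\<close>) runs through all values.\<close>

primrec comp :: "fo \<Rightarrow> nat \<Rightarrow> bool \<Rightarrow> reg_op prog" where
  "comp (Eq t j) d b = Seq (tcomp t d) (Act (Has d (R j) b))"
| "comp (Mk mk t) d b = Seq (tcomp t d) (Act (Has d mk b))"
| "comp (Neg f) d b = comp f d (\<not> b)"
| "comp (Conj f g) d b = (if b then Seq (comp f d b) (comp g d b) else Alt (comp f d b) (comp g d b))"
| "comp (Ex f) d b = Seq (Act (Reset d))
     (if b then Seq (Star (Act (Inc d))) (Seq (Act (Has d RE False)) (comp f (Suc d) b))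
      else Seq (Star (Seq (Act (Has d RE False)) (Seq (comp f (Suc d) b) (Act (Inc d))))) (Act (Has d RE True)))"

context tape_content
begin

abbreviation "rsem \<equiv> sem op_rel"

lemma op_rel_simps [simp]:
  "(s, s') \<in> op_rel (Has r mk b) \<longleftrightarrow> s' = s \<and> (mk \<in> cell s (s r)) = b"
  "(s, s') \<in> op_rel (Inc r) \<longleftrightarrow> s' = s(r := min N (Suc (s r)))"
  "(s, s') \<in> op_rel (Reset r) \<longleftrightarrow> s' = s(r := 0)"
  by (auto simp: op_rel_def)

text \<open>The existence of a run is asserted along with the invariant: a blocked run is later read
  as a truth value, so the arithmetic must never block.\<close>

lemma loop_correct:
  assumes "ok s" "c \<noteq> i" "i < K"
    and base: "Inv 0 (s(c := 0))"
    and step: "\<And>k t. \<lbrakk>ok t; Inv k t; t c = k; t i = s i; k < s i\<rbrakk> \<Longrightarrow>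
      (\<exists>t'. (t, t') \<in> rsem p) \<and>
      (\<forall>t'. (t, t') \<in> rsem p \<longrightarrow> t' c = k \<and> t' i = s i \<and> Inv (Suc k) (t'(c := Suc k)))"
  shows "(\<exists>s'. (s, s') \<in> rsem (loop c i p)) \<and>
    (\<forall>s'. (s, s') \<in> rsem (loop c i p) \<longrightarrow> Inv (s i) s' \<and> s' c = s i \<and> s' i = s i)"
proof -
  define J where "J k t \<longleftrightarrow> ok t \<and> Inv k t \<and> t c = k \<and> t i = s i \<and> k \<le> s i" for k t
  let ?body = "Seq (Act (Has c (R i) False)) (Seq p (Act (Inc c)))"
  have J0: "J 0 (s(c := 0))" using assms by (simp add: J_def ok_def)
  have iN: "s i \<le> N" using assms(1) by (simp add: ok_def)
  have body: "(\<exists>t'. (t, t') \<in> rsem ?body) \<and> (\<forall>t'. (t, t') \<in> rsem ?body \<longrightarrow> J (Suc k) t')"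
    if J: "J k t" "k < s i" for k t
  proof -
    have t: "ok t" "Inv k t" "t c = k" "t i = s i" "k < s i" using J by (auto simp: J_def)
    have "(t, t) \<in> op_rel (Has c (R i) False)" using t assms by simp
    moreover obtain t1 where t1: "(t, t1) \<in> rsem p" using step[OF t] by blast
    moreover have "(t1, t1(c := min N (Suc (t1 c)))) \<in> op_rel (Inc c)" by simp
    ultimately have "(t, t1(c := min N (Suc (t1 c)))) \<in> rsem ?body" by (auto simp del: op_rel_simps)
    moreover have "J (Suc k) t'" if t': "(t, t') \<in> rsem ?body" for t'
    proof -
      obtain t1 where t1: "(t, t1) \<in> rsem p" "t' = t1(c := min N (Suc (t1 c)))"
        using t' by auto
      have "t1 c = k" "t1 i = s i" "Inv (Suc k) (t1(c := Suc k))" using step[OF t] t1(1) by auto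
      moreover have "ok t1" using sem_ok t1(1) t(1) by blast
      moreover have "min N (Suc k) = Suc k" using t(5) iN by simp
      ultimately show ?thesis using t t1(2) assms(2) iN by (simp add: J_def ok_upd)
    qed
    ultimately show ?thesis by blast
  qed
  have sound: "\<exists>k. J k t" if "(s(c := 0), t) \<in> (rsem ?body)\<^sup>*" for t
    using that
  proof (induction rule: rtrancl_induct)
    case base
    then show ?case using J0 by blast
  next
    case (step y z)
    then obtain k where k: "J k y" by blast
    have "k < s i" using step.hyps(2) k assms by (auto simp: J_def)
    then show ?case using body[OF k] step.hyps(2) by blast
  qed
  have total: "\<exists>t'. (t, t') \<in> (rsem ?body)\<^sup>* \<and> J (s i) t'" if "J k t" for k t
  proof -
    have "k \<le> s i" using that by (simp add: J_def)
    then show ?thesis using that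
    proof (induction k arbitrary: t rule: inc_induct)
      case base
      then show ?case by blast
    next
      case (step k)
      then obtain t1 where "(t, t1) \<in> rsem ?body" "J (Suc k) t1" using body by blast
      then show ?case using step.IH by (meson converse_rtrancl_into_rtrancl)
    qed
  qed
  have "\<exists>s'. (s, s') \<in> rsem (loop c i p)"
  proof -
    obtain t' where t': "(s(c := 0), t') \<in> (rsem ?body)\<^sup>*" "J (s i) t'" using total[OF J0] by blast
    then have "(t', t') \<in> op_rel (Has c (R i) True)" using assms by (simp add: J_def)
    moreover have "(s, s(c := 0)) \<in> op_rel (Reset c)" by simp
    ultimately have "(s, t') \<in> rsem (loop c i p)"
      unfolding loop_def sem.simps using t'(1)[unfolded sem.simps] by blast
    then show ?thesis by blast
  qed
  moreover have "Inv (s i) s' \<and> s' c = s i \<and> s' i = s i" if "(s, s') \<in> rsem (loop c i p)" for s'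
  proof -
    have "(s(c := 0), s') \<in> (rsem ?body)\<^sup>*" and eq: "s' i = s' c"
      using that by (auto simp: loop_def)
    then obtain k where J: "J k s'" using sound by blast
    then have "k = s i" using eq by (simp add: J_def)
    then show ?thesis using J by (simp add: J_def)
  qed
  ultimately show ?thesis by blast
qed

lemma incs_correct:
  assumes "ok s" "r < K"
  shows "(s, s') \<in> rsem (((Seq (Act (Inc r))) ^^ n) (Act (Has r (R r) True))) \<longleftrightarrow> s' = s(r := min N (s r + n))"
  using assms(1)
proof (induction n arbitrary: s)
  case 0
  then have "min N (s r) = s r" by (simp add: ok_def)
  then show ?case using assms(2) by (simp add: fun_upd_idem)
next
  case (Suc n)
  have "ok (s(r := min N (Suc (s r))))" using Suc.prems by (simp add: ok_def)
  from Suc.IH[OF this] have IH: "(s(r := min N (Suc (s r))), s') \<in> rsem (((Seq (Act (Inc r))) ^^ n) (Act (Has r (R r) True))) \<longleftrightarrow>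
     s' = s(r := min N (min N (Suc (s r)) + n))" unfolding fun_upd_same fun_upd_upd .
  have "(s, s') \<in> rsem (((Seq (Act (Inc r))) ^^ Suc n) (Act (Has r (R r) True))) \<longleftrightarrow>
     s' = s(r := min N (min N (Suc (s r)) + n))" unfolding IH[symmetric] by simp
  moreover have "min N (min N (Suc (s r)) + n) = min N (s r + Suc n)" by simp
  ultimately show ?case by (simp only:)
qed

text \<open>If both factors are positive and one of them exceeds \<open>N\<close>, the product is at
  least \<open>N\<close> with or without the cut.\<close>

lemma min_mult_min: "min N (min N a * min N b) = min N (a * b :: nat)"
proof (cases "a = 0 \<or> b = 0")
  case False
  show ?thesis
  proof (cases "a \<le> N \<and> b \<le> N")
    case False': False
    have "N \<le> a * b" "N \<le> min N a * min N b"
      using False False' N_pos mult_le_mono[of N a 1 b] mult_le_mono[of 1 a N b]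
        mult_le_mono[of N "min N a" 1 "min N b"] mult_le_mono[of 1 "min N a" N "min N b"]
      by (auto simp: min_def)
    then show ?thesis by simp
  qed simp
qed auto

text \<open>Registers saturate at \<open>N\<close>, which commutes with addition and multiplication.\<close>

lemma tcomp_correct:
  assumes "ok s" "tvars_below t r" "regs_ok (tcomp t r)"
  shows "(\<exists>s'. (s, s') \<in> rsem (tcomp t r)) \<and>
    (\<forall>s'. (s, s') \<in> rsem (tcomp t r) \<longrightarrow> s' r = min N (tval s t) \<and> (\<forall>i<r. s' i = s i))"
  using assms
proof (induction t arbitrary: s r)
  case (V i)
  have "i < K" "i \<noteq> r" using V by (auto simp: loop_def)
  have "(\<exists>s'. (s, s') \<in> rsem (tcomp (V i) r)) \<and>
    (\<forall>s'. (s, s') \<in> rsem (tcomp (V i) r) \<longrightarrow> (\<forall>j<r. s' j = s j) \<and> s' r = s i \<and> s' i = s i)"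
    unfolding tcomp.simps
    by (rule loop_correct[where Inv = "\<lambda>_ t. \<forall>j<r. t j = s j"]) (use V \<open>i < K\<close> in auto)
  then show ?case using V.prems(1) by (auto simp: ok_def)
next
  case (C n)
  have "r < K" using C by simp
  have "ok (s(r := 0))" using C by (simp add: ok_def)
  from incs_correct[OF this \<open>r < K\<close>, of _ n]
  have *: "(s, s') \<in> rsem (tcomp (C n) r) \<longleftrightarrow> s' = s(r := min N n)" for s' by auto
  show ?case unfolding * by simp
next
  case (Add t u)
  have reg: "regs_ok (tcomp t r)" "regs_ok (tcomp u (r + 1))" "r < K" "r + 1 < K" "r + 2 < K"
    using Add.prems(3) by (auto simp: loop_def)
  have u: "tvars_below u (r + 1)" "tvars_below u r" using Add.prems(2) tvars_below_mono by auto
  note T = Add.IH(1)[OF Add.prems(1) _ reg(1)]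
  have L: "(\<exists>s'. (s2, s') \<in> rsem (loop (r + 2) (r + 1) (Act (Inc r)))) \<and>
    (\<forall>s'. (s2, s') \<in> rsem (loop (r + 2) (r + 1) (Act (Inc r))) \<longrightarrow>
      ((\<forall>j<r. s' j = s2 j) \<and> s' r = min N (s2 r + s2 (r + 1))) \<and> s' (r + 2) = s2 (r + 1) \<and> s' (r + 1) = s2 (r + 1))"
    if "ok s2" for s2
    by (rule loop_correct[where Inv = "\<lambda>k t. (\<forall>j<r. t j = s2 j) \<and> t r = min N (s2 r + k)"])
      (use that reg in \<open>auto simp: ok_def\<close>)
  have U: "(\<exists>s'. (s1, s') \<in> rsem (tcomp u (r + 1))) \<and>
    (\<forall>s'. (s1, s') \<in> rsem (tcomp u (r + 1)) \<longrightarrow> s' (r + 1) = min N (tval s1 u) \<and> (\<forall>i<r + 1. s' i = s1 i))"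
    if "ok s1" for s1
    using Add.IH(2)[OF that u(1) reg(2)] .
  obtain s1 where s1: "(s, s1) \<in> rsem (tcomp t r)" using T Add.prems by auto
  then have "ok s1" using sem_ok Add.prems(1) by blast
  then obtain s2 where s2: "(s1, s2) \<in> rsem (tcomp u (r + 1))" using U by blast
  then have "ok s2" using sem_ok \<open>ok s1\<close> by blast
  then obtain s3 where "(s2, s3) \<in> rsem (loop (r + 2) (r + 1) (Act (Inc r)))" using L by blast
  then have ex: "\<exists>s'. (s, s') \<in> rsem (tcomp (Add t u) r)" using s1 s2 by auto
  have "s3 r = min N (tval s (Add t u)) \<and> (\<forall>i<r. s3 i = s i)"
    if "(s, s1) \<in> rsem (tcomp t r)" "(s1, s2) \<in> rsem (tcomp u (r + 1))"
      "(s2, s3) \<in> rsem (loop (r + 2) (r + 1) (Act (Inc r)))" for s1 s2 s3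
  proof -
    have ok: "ok s1" "ok s2" using sem_ok that Add.prems(1) by blast+
    have 1: "s1 r = min N (tval s t)" "\<forall>i<r. s1 i = s i" using T that(1) Add.prems by auto
    have 2: "s2 (r + 1) = min N (tval s1 u)" "\<forall>i<r + 1. s2 i = s1 i" using U[OF ok(1)] that(2) by auto
    have 3: "\<forall>j<r. s3 j = s2 j" "s3 r = min N (s2 r + s2 (r + 1))" using L[OF ok(2)] that(3) by auto
    have "tval s1 u = tval s u" using u(2) 1(2) by (auto intro: tval_cong)
    then have "s3 r = min N (min N (tval s t) + min N (tval s u))" using 1 2 3 by simp
    also have "\<dots> = min N (tval s t + tval s u)" by simp
    finally show ?thesis using 1 2 3 by simp
  qed
  then show ?case using ex by auto
next
  case (Mul t u)
  have reg: "regs_ok (tcomp t (r + 1))" "regs_ok (tcomp u (r + 2))" "r < K" "r + 1 < K" "r + 2 < K"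
    using Mul.prems(3) by (auto simp: loop_def)
  have tu: "tvars_below t (r + 1)" "tvars_below u (r + 2)" "tvars_below u r"
    using Mul.prems(2) tvars_below_mono[of _ r] by auto
  let ?in = "loop (r + 4) (r + 2) (Act (Inc r))" and ?out = "loop (r + 3) (r + 1) (loop (r + 4) (r + 2) (Act (Inc r)))"
  note T = Mul.IH(1)[OF Mul.prems(1) tu(1) reg(1)]
  have U: "(\<exists>s'. (s1, s') \<in> rsem (tcomp u (r + 2))) \<and>
    (\<forall>s'. (s1, s') \<in> rsem (tcomp u (r + 2)) \<longrightarrow> s' (r + 2) = min N (tval s1 u) \<and> (\<forall>i<r + 2. s' i = s1 i))"
    if "ok s1" for s1
    using Mul.IH(2)[OF that tu(2) reg(2)] .
  have L1: "(\<exists>s'. (s2, s') \<in> rsem ?in) \<and>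
    (\<forall>s'. (s2, s') \<in> rsem ?in \<longrightarrow>
      ((\<forall>j<r + 4. j \<noteq> r \<longrightarrow> s' j = s2 j) \<and> s' r = min N (s2 r + s2 (r + 2))) \<and> s' (r + 4) = s2 (r + 2) \<and> s' (r + 2) = s2 (r + 2))"
    if "ok s2" for s2
    by (rule loop_correct[where Inv = "\<lambda>k t. (\<forall>j<r + 4. j \<noteq> r \<longrightarrow> t j = s2 j) \<and> t r = min N (s2 r + k)"])
      (use that reg in \<open>auto simp: ok_def\<close>)
  have L2: "(\<exists>s'. (s2, s') \<in> rsem ?out) \<and>
    (\<forall>s'. (s2, s') \<in> rsem ?out \<longrightarrow>
      ((\<forall>j<r. s' j = s2 j) \<and> s' (r + 2) = s2 (r + 2) \<and> s' r = min N (s2 (r + 1) * s2 (r + 2))) \<and>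
        s' (r + 3) = s2 (r + 1) \<and> s' (r + 1) = s2 (r + 1))"
    if "ok s2" "s2 r = 0" for s2
  proof (rule loop_correct[where Inv = "\<lambda>k t. (\<forall>j<r. t j = s2 j) \<and> t (r + 2) = s2 (r + 2) \<and> t r = min N (k * s2 (r + 2))"])
    show "ok s2" "r + 3 \<noteq> r + 1" "r + 1 < K" using that reg by auto
    show "(\<forall>j<r. (s2(r + 3 := 0)) j = s2 j) \<and> (s2(r + 3 := 0)) (r + 2) = s2 (r + 2) \<and>
        (s2(r + 3 := 0)) r = min N (0 * s2 (r + 2))" using that by simp
  next
    fix k t
    assume t: "ok t" "(\<forall>j<r. t j = s2 j) \<and> t (r + 2) = s2 (r + 2) \<and> t r = min N (k * s2 (r + 2))"
      "t (r + 3) = k" "t (r + 1) = s2 (r + 1)" "k < s2 (r + 1)"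
    have "t' (r + 3) = k \<and> t' (r + 1) = s2 (r + 1) \<and> (\<forall>j<r. (t'(r + 3 := Suc k)) j = s2 j) \<and>
        (t'(r + 3 := Suc k)) (r + 2) = s2 (r + 2) \<and> (t'(r + 3 := Suc k)) r = min N (Suc k * s2 (r + 2))"
      if "(t, t') \<in> rsem ?in" for t'
    proof -
      have *: "\<forall>j<r + 4. j \<noteq> r \<longrightarrow> t' j = t j" "t' r = min N (t r + t (r + 2))"
        using L1[OF t(1)] that by auto
      have "min N (min N (k * s2 (r + 2)) + s2 (r + 2)) = min N (Suc k * s2 (r + 2))" by simp
      then show ?thesis using * t by simp
    qed
    then show "(\<exists>t'. (t, t') \<in> rsem ?in) \<and> (\<forall>t'. (t, t') \<in> rsem ?in \<longrightarrow> t' (r + 3) = k \<and>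
      t' (r + 1) = s2 (r + 1) \<and> (\<forall>j<r. (t'(r + 3 := Suc k)) j = s2 j) \<and>
        (t'(r + 3 := Suc k)) (r + 2) = s2 (r + 2) \<and> (t'(r + 3 := Suc k)) r = min N (Suc k * s2 (r + 2)))"
      using L1[OF t(1)] by blast
  qed
  obtain s1 where s1: "(s, s1) \<in> rsem (tcomp t (r + 1))" using T by blast
  then have "ok s1" using sem_ok Mul.prems(1) by blast
  then obtain s2 where s2: "(s1, s2) \<in> rsem (tcomp u (r + 2))" using U by blast
  then have "ok s2" using sem_ok \<open>ok s1\<close> by blast
  then have "ok (s2(r := 0))" by (simp add: ok_def)
  then obtain s3 where "(s2(r := 0), s3) \<in> rsem ?out" using L2[of "s2(r := 0)"] by auto
  then have ex: "\<exists>s'. (s, s') \<in> rsem (tcomp (Mul t u) r)" using s1 s2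
    unfolding tcomp.simps sem.simps by (meson op_rel_simps(3) relcompI)
  have "s3 r = min N (tval s (Mul t u)) \<and> (\<forall>i<r. s3 i = s i)"
    if "(s, s1) \<in> rsem (tcomp t (r + 1))" "(s1, s2) \<in> rsem (tcomp u (r + 2))"
      "(s2(r := 0), s3) \<in> rsem ?out" for s1 s2 s3
  proof -
    have ok: "ok s1" "ok s2" using sem_ok that Mul.prems(1) by blast+
    have ok2: "ok (s2(r := 0))" using ok(2) by (simp add: ok_def)
    have 1: "s1 (r + 1) = min N (tval s t)" "\<forall>i<r + 1. s1 i = s i" using T that(1) by auto
    have 2: "s2 (r + 2) = min N (tval s1 u)" "\<forall>i<r + 2. s2 i = s1 i" using U[OF ok(1)] that(2) by auto
    have 3: "\<forall>j<r. s3 j = (s2(r := 0)) j" "s3 r = min N ((s2(r := 0)) (r + 1) * (s2(r := 0)) (r + 2))"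
      using L2[OF ok2] that(3) by auto
    have "tval s1 u = tval s u" using tu(3) 1(2) by (auto intro: tval_cong)
    then have "s3 r = min N (min N (tval s t) * min N (tval s u))" using 1 2 3 by simp
    then show ?thesis using 1 2 3 min_mult_min by simp
  qed
  then show ?case using ex by auto
qed

text \<open>The induction covers both polarities \<open>b\<close>, so negation only flips the
  polarity and no failure of a run has to be detected. Registers below \<open>d\<close> are
  preserved so that the second conjunct and later rounds of a loop see the same assignment.\<close>

lemma comp_correct:
  assumes "ok s" "wf_fo f d" "\<And>i. i < d \<Longrightarrow> s i < N" "regs_ok (comp f d b)"
  shows "((\<exists>s'. (s, s') \<in> rsem (comp f d b)) \<longleftrightarrow> holds N B f d s = b) \<and>
    (\<forall>s'. (s, s') \<in> rsem (comp f d b) \<longrightarrow> (\<forall>i<d. s' i = s i))"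
  using assms
proof (induction f arbitrary: d b s)
  case (Eq t j)
  then have t: "tvars_below t d" "j < d" "regs_ok (tcomp t d)" "d < K" "j < K" by auto
  note T = tcomp_correct[OF Eq.prems(1) t(1,3)]
  have E: "s' j = s' d \<longleftrightarrow> tval s t = s j" if "(s, s') \<in> rsem (tcomp t d)" for s'
  proof -
    have "s' d = min N (tval s t)" "s' j = s j" using T that t by auto
    \<comment> \<open>Below \<open>N\<close> saturation is invisible: \<open>min N x = s j\<close>
      together with \<open>s j < N\<close> forces \<open>x = s j\<close>.\<close>
    moreover have "s j < N" using Eq.prems(3) t(2) .
    ultimately show ?thesis by (auto simp: min_def)
  qed
  have *: "(s, s') \<in> rsem (comp (Eq t j) d b) \<longleftrightarrow>
      (s, s') \<in> rsem (tcomp t d) \<and> (tval s t = s j) = b" for s'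
    using t(5) E[of s'] by auto
  show ?case unfolding * using T by auto
next
  case (Mk mk t)
  then have t: "tvars_below t d" "regs_ok (tcomp t d)" by auto
  note T = tcomp_correct[OF Mk.prems(1) t]
  have E: "mk \<in> cell s' (s' d) \<longleftrightarrow> mk \<in> B (tval s t)" if "(s, s') \<in> rsem (tcomp t d)" for s'
  proof -
    have d: "s' d = min N (tval s t)" using T that by auto
    have "mk \<in> cell s' (s' d) \<longleftrightarrow> mk \<in> B (s' d)" using Mk.prems(2) by (cases mk) auto
    \<comment> \<open>An address beyond the tape is cut down to \<open>N\<close>, where
      \<open>B\<close> is empty as well.\<close>
    moreover have "B (min N (tval s t)) = B (tval s t)" using B_outside by (auto simp: min_def)
    ultimately show ?thesis using d by simp
  qed
  have *: "(s, s') \<in> rsem (comp (Mk mk t) d b) \<longleftrightarrow>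
      (s, s') \<in> rsem (tcomp t d) \<and> (mk \<in> B (tval s t)) = b" for s'
    using E[of s'] by auto
  show ?case unfolding * using T by auto
next
  case (Neg f)
  have "((\<exists>s'. (s, s') \<in> rsem (comp f d (\<not> b))) \<longleftrightarrow> holds N B f d s = (\<not> b)) \<and>
    (\<forall>s'. (s, s') \<in> rsem (comp f d (\<not> b)) \<longrightarrow> (\<forall>i<d. s' i = s i))"
    by (rule Neg.IH) (use Neg.prems in auto)
  then show ?case by auto
next
  case (Conj f g)
  have wf: "wf_fo f d" "wf_fo g d" and reg: "regs_ok (comp f d b)" "regs_ok (comp g d b)"
    using Conj.prems(2,4) by (auto split: if_splits)
  note F = Conj.IH(1)[OF Conj.prems(1) wf(1) Conj.prems(3) reg(1)]
  note Gs = Conj.IH(2)[OF Conj.prems(1) wf(2) Conj.prems(3) reg(2)]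
  show ?case
  proof (cases b)
    case False
    have sem: "(s, s') \<in> rsem (comp (Conj f g) d b) \<longleftrightarrow>
        (s, s') \<in> rsem (comp f d b) \<or> (s, s') \<in> rsem (comp g d b)" for s'
      using False by simp
    have "(\<exists>s'. (s, s') \<in> rsem (comp f d b)) \<longleftrightarrow> \<not> holds N B f d s"
      "(\<exists>s'. (s, s') \<in> rsem (comp g d b)) \<longleftrightarrow> \<not> holds N B g d s"
      using conjunct1[OF F] conjunct1[OF Gs] False by simp_all
    then have "(\<exists>s'. (s, s') \<in> rsem (comp (Conj f g) d b)) \<longleftrightarrow> \<not> (holds N B f d s \<and> holds N B g d s)"
      unfolding sem by blast
    moreover have "\<forall>i<d. s' i = s i" if "(s, s') \<in> rsem (comp (Conj f g) d b)" for s'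
      using that F Gs unfolding sem by blast
    ultimately show ?thesis using False by simp
  next
    case True
    have G1: "((\<exists>s'. (s1, s') \<in> rsem (comp g d b)) \<longleftrightarrow> holds N B g d s = b) \<and>
        (\<forall>s'. (s1, s') \<in> rsem (comp g d b) \<longrightarrow> (\<forall>i<d. s' i = s i))"
      if s1: "(s, s1) \<in> rsem (comp f d b)" for s1
    proof -
      have eq: "\<forall>i<d. s1 i = s i" using F s1 by blast
      have "ok s1" using sem_ok s1 Conj.prems(1) by blast
      moreover have "holds N B g d s1 = holds N B g d s" using eq by (intro holds_cong[OF wf(2)]) auto
      ultimately show ?thesis
        using Conj.IH(2)[of s1 d b] wf(2) reg(2) eq Conj.prems(3) by metis
    qed
    have sem: "(s, s') \<in> rsem (comp (Conj f g) d b) \<longleftrightarrow>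
        (\<exists>s1. (s, s1) \<in> rsem (comp f d b) \<and> (s1, s') \<in> rsem (comp g d b))" for s'
      using True by auto
    have "(\<exists>s'. (s, s') \<in> rsem (comp (Conj f g) d b)) \<longleftrightarrow> holds N B f d s \<and> holds N B g d s"
      unfolding sem using F G1 True by blast
    moreover have "\<forall>i<d. s' i = s i" if "(s, s') \<in> rsem (comp (Conj f g) d b)" for s'
      using that G1 unfolding sem by blast
    ultimately show ?thesis using True by simp
  qed
next
  case (Ex f)
  have wf: "wf_fo f (Suc d)" and reg: "regs_ok (comp f (Suc d) b)" "d < K"
    using Ex.prems by (auto split: if_splits)
  \<comment> \<open>\<open>A v t\<close> describes the stores met during the quantifier: the free
    variables are intact, \<open>v\<close> is the current value, and the registers above
    \<open>d\<close> are arbitrary.\<close>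
  define A where "A v t \<longleftrightarrow> ok t \<and> (\<forall>i<d. t i = s i) \<and> t d = v" for v t
  have A0: "A 0 (s(d := 0))" using Ex.prems(1) by (simp add: A_def ok_def)
  have AInc: "A (min N (Suc v)) t'" if "A v t" "(t, t') \<in> op_rel (Inc d)" for v t t'
    using that by (auto simp: A_def ok_def)
  have ASuc: "A (Suc v) (t(d := min N (Suc (t d))))" if "A v t" "v < N" for v t
    using that by (auto simp: A_def ok_def)
  have F: "((\<exists>t'. (t, t') \<in> rsem (comp f (Suc d) b)) \<longleftrightarrow> holds N B f (Suc d) (s(d := v)) = b) \<and>
     (\<forall>t'. (t, t') \<in> rsem (comp f (Suc d) b) \<longrightarrow> A v t')" if "A v t" "v < N" for v t
  proof -
    have t: "ok t" "\<forall>i<d. t i = s i" "t d = v" using that by (auto simp: A_def)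
    have lt: "t i < N" if "i < Suc d" for i
      using that t Ex.prems(3) \<open>v < N\<close> by (cases "i = d") auto
    have "holds N B f (Suc d) t = holds N B f (Suc d) (s(d := v))"
      by (rule holds_cong[OF wf]) (use t in \<open>auto simp: less_Suc_eq\<close>)
    moreover have "A v t'" if "\<forall>i<Suc d. t' i = t i" "ok t'" for t'
      using that t by (auto simp: A_def)
    ultimately show ?thesis
      using Ex.IH[OF t(1) wf lt reg(1)] sem_ok[OF _ t(1)] by blast
  qed
  show ?case
  proof (cases b)
    case True
    have reach: "\<exists>v\<le>N. A v t" if "(s(d := 0), t) \<in> (op_rel (Inc d))\<^sup>*" for t
      using that
    proof (induction rule: rtrancl_induct)
      case (step y z)
      then show ?case using AInc by (meson min.cobounded1)
    qed (use A0 in blast)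
    have total: "\<exists>t. (s(d := 0), t) \<in> (op_rel (Inc d))\<^sup>* \<and> A v t" if "v \<le> N" for v
      using that
    proof (induction v)
      case (Suc v)
      then obtain t where t: "(s(d := 0), t) \<in> (op_rel (Inc d))\<^sup>*" "A v t" using Suc_leD by blast
      have "(t, t(d := min N (Suc (t d)))) \<in> op_rel (Inc d)" by simp
      then show ?case using t AInc[OF t(2)] Suc.prems by (metis min.absorb2 rtrancl_into_rtrancl)
    qed (use A0 in blast)
    have sem: "(s, s') \<in> rsem (comp (Ex f) d b) \<longleftrightarrow>
        (\<exists>t. (s(d := 0), t) \<in> (op_rel (Inc d))\<^sup>* \<and> t d \<noteq> N \<and> (t, s') \<in> rsem (comp f (Suc d) b))" for s'
      using True by auto
    have "(\<exists>s'. (s, s') \<in> rsem (comp (Ex f) d b)) \<longleftrightarrow> (\<exists>v<N. holds N B f (Suc d) (s(d := v)))"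
    proof
      assume "\<exists>s'. (s, s') \<in> rsem (comp (Ex f) d b)"
      then obtain s' t where t: "(s(d := 0), t) \<in> (op_rel (Inc d))\<^sup>*" "t d \<noteq> N"
        "(t, s') \<in> rsem (comp f (Suc d) b)" unfolding sem by blast
      then obtain v where v: "v \<le> N" "A v t" using reach by blast
      then have "v < N" using t(2) by (auto simp: A_def)
      then show "\<exists>v<N. holds N B f (Suc d) (s(d := v))" using F[OF v(2)] t(3) True by blast
    next
      assume "\<exists>v<N. holds N B f (Suc d) (s(d := v))"
      then obtain v where v: "v < N" "holds N B f (Suc d) (s(d := v))" by blast
      then obtain t where t: "(s(d := 0), t) \<in> (op_rel (Inc d))\<^sup>*" "A v t" using total[OF less_imp_le[OF v(1)]] by blast
      then have "t d \<noteq> N" using v(1) by (simp add: A_def)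
      then show "\<exists>s'. (s, s') \<in> rsem (comp (Ex f) d b)" unfolding sem using t F[OF t(2) v(1)] v(2) True by blast
    qed
    moreover have "\<forall>i<d. s' i = s i" if s': "(s, s') \<in> rsem (comp (Ex f) d b)" for s'
    proof -
      obtain t where t: "(s(d := 0), t) \<in> (op_rel (Inc d))\<^sup>*" "t d \<noteq> N"
        "(t, s') \<in> rsem (comp f (Suc d) b)" using s' unfolding sem by blast
      then obtain v where v: "v \<le> N" "A v t" using reach by blast
      then have "v < N" using t(2) by (auto simp: A_def)
      then have "A v s'" using F[OF v(2)] t(3) by blast
      then show ?thesis by (simp add: A_def)
    qed
    ultimately show ?thesis using True by simp
  next
    case False
    let ?body = "{(t, t'). t d \<noteq> N \<and> (\<exists>t1. (t, t1) \<in> rsem (comp f (Suc d) b) \<and> t' = t1(d := min N (Suc (t1 d))))}"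
    have body: "rsem (Seq (Act (Has d RE False)) (Seq (comp f (Suc d) b) (Act (Inc d)))) = ?body"
    proof -
      have "(t, t') \<in> rsem (Seq (Act (Has d RE False)) (Seq (comp f (Suc d) b) (Act (Inc d)))) \<longleftrightarrow> (t, t') \<in> ?body" for t t'
        by simp
      then show ?thesis by (intro set_eqI) (simp only: split_paired_all)
    qed
    \<comment> \<open>The body is passed only by a run refuting \<open>f\<close>, so arriving at
      \<open>v\<close> shows that \<open>f\<close> fails for all smaller values.\<close>
    have reach: "\<exists>v\<le>N. A v t \<and> (\<forall>u<v. \<not> holds N B f (Suc d) (s(d := u)))"
      if "(s(d := 0), t) \<in> ?body\<^sup>*" for t
      using that
    proof (induction rule: rtrancl_induct)
      case (step y z)
      then obtain v where v: "v \<le> N" "A v y" "\<forall>u<v. \<not> holds N B f (Suc d) (s(d := u))" by blast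
      obtain t1 where t1: "y d \<noteq> N" "(y, t1) \<in> rsem (comp f (Suc d) b)" "z = t1(d := min N (Suc (t1 d)))"
        using step.hyps(2) by auto
      have "v < N" using v t1(1) by (auto simp: A_def)
      then have "\<not> holds N B f (Suc d) (s(d := v))" "A v t1" using F[OF v(2)] t1(2) False by blast+
      moreover then have "A (Suc v) z" using ASuc[OF _ \<open>v < N\<close>] t1(3) by blast
      ultimately show ?case using v(3) \<open>v < N\<close> by (metis Suc_leI less_SucE)
    qed (use A0 in blast)
    have total: "\<exists>t. (s(d := 0), t) \<in> ?body\<^sup>* \<and> A v t"
      if "v \<le> N" "\<forall>u<v. \<not> holds N B f (Suc d) (s(d := u))" for v
      using that
    proof (induction v)
      case (Suc v)
      then obtain t where t: "(s(d := 0), t) \<in> ?body\<^sup>*" "A v t" by (meson Suc_leD less_SucI)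
      then obtain t1 where t1: "(t, t1) \<in> rsem (comp f (Suc d) b)" "A v t1"
        using F[OF t(2)] Suc.prems False by (metis Suc_le_lessD lessI)
      let ?t = "t1(d := min N (Suc (t1 d)))"
      have "(t, ?t) \<in> ?body" using t1(1) t(2) Suc.prems(1) by (auto simp: A_def)
      moreover have "A (Suc v) ?t" using ASuc[OF t1(2)] Suc.prems(1) by auto
      ultimately show ?case using t(1) by (meson rtrancl_into_rtrancl)
    qed (use A0 in blast)
    have sem: "(s, s') \<in> rsem (comp (Ex f) d b) \<longleftrightarrow> (s(d := 0), s') \<in> ?body\<^sup>* \<and> s' d = N" for s'
      unfolding comp.simps using False body by simp
    have "(\<exists>s'. (s, s') \<in> rsem (comp (Ex f) d b)) \<longleftrightarrow> \<not> (\<exists>v<N. holds N B f (Suc d) (s(d := v)))"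
    proof
      assume "\<exists>s'. (s, s') \<in> rsem (comp (Ex f) d b)"
      then obtain s' where "(s(d := 0), s') \<in> ?body\<^sup>*" "s' d = N" unfolding sem by blast
      then show "\<not> (\<exists>v<N. holds N B f (Suc d) (s(d := v)))" using reach[of s'] by (auto simp: A_def)
    next
      assume "\<not> (\<exists>v<N. holds N B f (Suc d) (s(d := v)))"
      then obtain t where "(s(d := 0), t) \<in> ?body\<^sup>*" "A N t" using total[of N] by blast
      then show "\<exists>s'. (s, s') \<in> rsem (comp (Ex f) d b)" unfolding sem A_def by blast
    qed
    moreover have "\<forall>i<d. s' i = s i" if "(s, s') \<in> rsem (comp (Ex f) d b)" for s'
      using that reach[of s'] unfolding sem A_def by blast
    ultimately show ?thesis using False by simp
  qed
qed

end

section \<open>From monadic guesses to exponential time\<close>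

definition word_structure :: "nat \<Rightarrow> nat list \<Rightarrow> nat \<Rightarrow> (nat \<Rightarrow> mark set) \<Rightarrow> bool" where
  "word_structure m w N B \<longleftrightarrow> 0 < N \<and> length w \<le> N \<and>
     (\<forall>i. \<exists>X\<subseteq>G ` {..<m}. B i = (if i < N then (if i < length w then inp (w ! i) else {}) \<union> X else {}))"

text \<open>The formula is fixed, so its registers and its loop nesting are constants: checking it
  is polynomial in \<open>N\<close> and hence singly exponential in the input. Since the machine
  guesses \<open>N\<close>, \<open>sound\<close> is required for every length and
  \<open>complete\<close> only for one.\<close>

theorem monadic_guess_NEXPTIME:
  assumes L: "L \<subseteq> lists {b0, b1}" and wf: "wf_fo \<Psi> 0"
    and sound: "\<And>w N B s. \<lbrakk>w \<in> lists {b0, b1}; word_structure m w N B; holds N B \<Psi> 0 s\<rbrakk> \<Longrightarrow> w \<in> L"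
    and complete: "\<And>w. w \<in> L \<Longrightarrow> \<exists>N B. N \<le> 2 ^ (c * (length w + 1)) \<and> word_structure m w N B \<and> (\<forall>s. holds N B \<Psi> 0 s)"
  shows "NEXPTIME L"
proof -
  define p where "p = comp \<Psi> 0 True"
  define K where "K = Suc (Max (insert 0 (\<Union>a\<in>set_prog p. op_regs a)))"
  have fin_set: "finite (set_prog q)" for q :: "reg_op prog" by (induction q) auto
  have fin_regs: "finite (op_regs a)" for a by (cases a) (auto split: mark.split)
  interpret marked_tape K m .
  have regK: "r < K" if "a \<in> set_prog p" "r \<in> op_regs a" for a r
  proof -
    have "r \<le> Max (insert 0 (\<Union>a\<in>set_prog p. op_regs a))"
      using that fin_set fin_regs by (intro Max_ge) auto
    then show ?thesis by (simp add: K_def)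
  qed
  define prg where "prg = Seq prepare (psubst gadget p)"
  have fin: "finite \<Gamma>" by (rule finite_\<Gamma>)
  obtain M where M: "ntm_wf M"
    "\<And>w t. ntm_accepts_within M w t \<Longrightarrow> \<exists>c. ((input_tape w, 0), c) \<in> sem (act_rel \<Gamma>) prg"
    "\<And>w t c. \<lbrakk>insert 0 (set w) \<subseteq> \<Gamma>; runs (act_rel \<Gamma>) t ([prg], (input_tape w, 0)) ([], c)\<rbrakk> \<Longrightarrow>
        ntm_accepts_within M w t"
    using prog_to_ntm[OF fin, of prg] by blast
  have inp_T: "inp (input_tape w (int i)) = (if i < length w then inp (w ! i) else {})" for w i
    by (simp add: input_tape_def inp_def b0_def b1_def)
  have accept_sound: "w \<in> L" if acc: "ntm_accepts_within M w t" and w: "w \<in> lists {b0, b1}" for w t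
  proof -
    obtain c c1 where c: "((input_tape w, 0), c1) \<in> sem (act_rel \<Gamma>) prepare"
      "(c1, c) \<in> sem (act_rel \<Gamma>) (psubst gadget p)"
      using M(2)[OF acc] unfolding prg_def sem.simps by blast
    obtain N X where N: "0 < N" "length w \<le> N" "\<And>i. X i \<subseteq> G ` {..<m}"
      "c1 = (tape_content.tp K N (content (input_tape w) N X) (\<lambda>_. 0), 0)"
      using prepare_sound[OF c(1) w] by blast
    let ?B = "content (input_tape w) N X"
    interpret tape_content K m N ?B by (rule tape_content_content[OF N(1,3)])
    have ok0: "ok (\<lambda>_. 0)" by (simp add: ok_def)
    have reg: "regs_ok p" using regK by (auto simp: regs_ok_def)
    obtain s' where "(\<lambda>_. 0, s') \<in> sem op_rel p"
      using psubst_sound[OF c(2)[unfolded N(4)] ok0] by blast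
    then have "holds N ?B \<Psi> 0 (\<lambda>_. 0)"
      using comp_correct[OF ok0 wf _ reg[unfolded p_def]] unfolding p_def by auto
    moreover have "word_structure m w N ?B"
      unfolding word_structure_def content_def inp_T using N by auto
    ultimately show ?thesis using sound[OF w] by blast
  qed
  obtain C d where ptime: "\<And>N. ptime K N p \<le> C * (N + 1) ^ d" using ptime_polynomial by blast
  \<comment> \<open>The total time is at most \<open>(21 + C) * (N + 1) ^ (d + 1)\<close>, and
    \<open>N + 1\<close> is at most 2 to the power \<open>(c + 1) * (length w + 1)\<close>;
    \<open>e\<close> collects the resulting exponent with some slack.\<close>
  define e where "e = C + 25 + (d + 1) * (c + 1)"
  have accept_complete: "ntm_accepts_within M w (2 ^ (e * (length w + 1) ^ 1))" if w: "w \<in> L" for w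
  proof -
    have lw: "w \<in> lists {b0, b1}" using w L by blast
    obtain N B where N: "N \<le> 2 ^ (c * (length w + 1))" "word_structure m w N B" "\<forall>s. holds N B \<Psi> 0 s"
      using complete[OF w] by blast
    then have N0: "0 < N" "length w \<le> N" by (auto simp: word_structure_def)
    obtain X where X: "\<And>i. X i \<subseteq> G ` {..<m}"
      "\<And>i. B i = (if i < N then (if i < length w then inp (w ! i) else {}) \<union> X i else {})"
      using N(2) unfolding word_structure_def by metis
    have B: "B = content (input_tape w) N X"
      by (rule ext) (simp add: content_def inp_T X(2))
    interpret tape_content K m N B unfolding B by (rule tape_content_content[OF N0(1) X(1)])
    have ok0: "ok (\<lambda>_. 0)" by (simp add: ok_def)
    have reg: "regs_ok p" using regK by (auto simp: regs_ok_def)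
    obtain s' where s': "(\<lambda>_. 0, s') \<in> sem op_rel p"
      using comp_correct[OF ok0 wf _ reg[unfolded p_def]] N(3) unfolding p_def by auto
    have "(\<lambda>_. 0) \<in> stores" using ok0 by (simp add: stores_def)
    from psubst_complete[OF s' reg this]
    have 2: "runs (act_rel \<Gamma>) (ptime K N p) ([psubst gadget p], (tp (\<lambda>_. 0), 0)) ([], (tp s', 0))" .
    have 1: "runs (act_rel \<Gamma>) (4 * N + 20) (prepare # [psubst gadget p], (input_tape w, 0)) ([psubst gadget p], (tp (\<lambda>_. 0), 0))"
      using prepare_complete[where X = X, OF N0(1) X(1) N0(2) lw] unfolding B by blast
    have runs: "runs (act_rel \<Gamma>) (1 + (4 * N + 20) + ptime K N p) ([prg], (input_tape w, 0)) ([], (tp s', 0))"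
      unfolding prg_def by (rule runs_Seq[OF 1 2])
    have "1 + (4 * N + 20) + ptime K N p \<le> 2 ^ (e * (length w + 1))"
    proof -
      let ?n = "length w + 1"
      have "N + 1 \<le> 2 ^ (c * ?n) + 2 ^ (c * ?n)" using N(1) one_le_power[of "2::nat" "c * ?n"] by linarith
      also have "\<dots> = 2 ^ (c * ?n + 1)" by simp
      also have "\<dots> \<le> 2 ^ ((c + 1) * ?n)" by (rule power_increasing) auto
      finally have N1: "N + 1 \<le> 2 ^ ((c + 1) * ?n)" .
      have "1 + (4 * N + 20) + ptime K N p \<le> 21 * (N + 1) + C * (N + 1) ^ d" using ptime[of N] by simp
      also have "\<dots> \<le> 21 * (N + 1) ^ (d + 1) + C * (N + 1) ^ (d + 1)"
        by (intro add_mono mult_left_mono self_le_power power_increasing) auto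
      also have "\<dots> = (21 + C) * (N + 1) ^ (d + 1)" by (simp add: algebra_simps)
      also have "\<dots> \<le> 2 ^ (21 + C) * (2 ^ ((c + 1) * ?n)) ^ (d + 1)"
        using N1 less_exp[of "21 + C"] by (intro mult_mono power_mono) auto
      also have "\<dots> = 2 ^ (21 + C + (d + 1) * (c + 1) * ?n)"
        by (simp only: power_add[symmetric] power_mult[symmetric] mult_ac)
      also have "\<dots> \<le> 2 ^ (e * ?n)"
        by (intro power_increasing) (auto simp: e_def algebra_simps)
      finally show ?thesis .
    qed
    then have "runs (act_rel \<Gamma>) (2 ^ (e * (length w + 1))) ([prg], (input_tape w, 0)) ([], (tp s', 0))"
      using runs_mono[OF runs] by blast
    moreover have "insert 0 (set w) \<subseteq> \<Gamma>" using lw by (auto simp: \<Gamma>_def in_lists_conv_set)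
    ultimately show ?thesis using M(3) by simp
  qed
  show ?thesis
    unfolding NEXPTIME_def using L M(1) accept_sound accept_complete by blast
qed

section \<open>Certificates for satisfiable formulas\<close>

primrec at :: "nat list \<Rightarrow> nat \<Rightarrow> nat list \<Rightarrow> nat \<Rightarrow> bool" where
  "at w p [] q \<longleftrightarrow> q = p"
| "at w p (x # xs) q \<longleftrightarrow> p < length w \<and> w ! p = x \<and> at w (Suc p) xs q"

lemma at_append: "at w p (xs @ ys) q \<longleftrightarrow> (\<exists>m. at w p xs m \<and> at w m ys q)"
  by (induction xs arbitrary: p) auto

lemma at_end: "at w p xs q \<Longrightarrow> q = p + length xs"
  by (induction xs arbitrary: p) fastforce+

lemma at_le: "at w p xs q \<Longrightarrow> p \<le> length w \<Longrightarrow> q \<le> length w"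
  by (induction xs arbitrary: p) auto

lemma at_take: "at w p xs q \<Longrightarrow> take (length xs) (drop p w) = xs"
  by (induction xs arbitrary: p) (auto simp: Cons_nth_drop_Suc[symmetric])

lemma at_self: "at (us @ xs @ vs) (length us) xs (length us + length xs)"
proof (induction xs arbitrary: us)
  case (Cons x xs)
  from Cons.IH[of "us @ [x]"] show ?case by (simp add: nth_append)
qed simp

text \<open>A pairing by addition and multiplication alone, without the halving in Cantor's
  function. It is injective because \<open>a\<close> is smaller than the gap between the squares of
  \<open>a + b\<close> and \<open>a + b + 1\<close>.\<close>

definition pv :: "nat \<Rightarrow> nat \<Rightarrow> nat" where
  "pv a b = (a + b) * (a + b) + a"

text \<open>Hence a pair coded by a cell of the tape has both components within the range of the
  quantifiers.\<close>

lemma pv_ge: "a \<le> pv a b" "b \<le> pv a b"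
proof -
  have "b \<le> a + b" "a + b \<le> (a + b) * (a + b)" by (rule le_add2, rule le_square)
  then show "b \<le> pv a b" unfolding pv_def by linarith
qed (simp add: pv_def)

lemma pv_inject [simp]: "pv a b = pv a' b' \<longleftrightarrow> a = a' \<and> b = b'"
proof
  assume eq: "pv a b = pv a' b'"
  have bnd: "(a + b) * (a + b) \<le> pv a b" "pv a b < Suc (a + b) * Suc (a + b)" for a b
    by (simp_all add: pv_def)
  have le: "a + b \<le> a' + b'" if "pv a b = pv a' b'" for a b a' b'
  proof (rule ccontr)
    assume "\<not> a + b \<le> a' + b'"
    then have "Suc (a' + b') * Suc (a' + b') \<le> (a + b) * (a + b)" by (intro mult_le_mono) auto
    then show False using bnd[of a b] bnd[of a' b'] that by linarith
  qed
  have "a + b = a' + b'" using le[OF eq] le[OF eq[symmetric]] by simp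
  moreover then have "a = a'" using eq by (simp add: pv_def)
  ultimately show "a = a' \<and> b = b'" by simp
qed simp

definition Disj :: "fo \<Rightarrow> fo \<Rightarrow> fo" where "Disj f g = Neg (Conj (Neg f) (Neg g))"
definition Imp :: "fo \<Rightarrow> fo \<Rightarrow> fo" where "Imp f g = Neg (Conj f (Neg g))"
definition Iff :: "fo \<Rightarrow> fo \<Rightarrow> fo" where "Iff f g = Conj (Imp f g) (Imp g f)"
definition All :: "fo \<Rightarrow> fo" where "All f = Neg (Ex (Neg f))"
definition Lit :: "bool \<Rightarrow> fo \<Rightarrow> fo" where "Lit b f = (if b then f else Neg f)"
text \<open>The syntax has no constant for falsity, so a contradiction built from \<open>f\<close>
  stands in for it.\<close>

definition Guard :: "bool \<Rightarrow> fo \<Rightarrow> fo" where "Guard b f = (if b then f else Conj f (Neg f))"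
definition ExBool :: "(bool \<Rightarrow> fo) \<Rightarrow> fo" where "ExBool f = Disj (f True) (f False)"

lemma holds_derived [simp]:
  "holds N B (Disj f g) d s \<longleftrightarrow> holds N B f d s \<or> holds N B g d s"
  "holds N B (Imp f g) d s \<longleftrightarrow> (holds N B f d s \<longrightarrow> holds N B g d s)"
  "holds N B (Iff f g) d s \<longleftrightarrow> (holds N B f d s \<longleftrightarrow> holds N B g d s)"
  "holds N B (All f) d s \<longleftrightarrow> (\<forall>v<N. holds N B f (Suc d) (s(d := v)))"
  "holds N B (Lit b f) d s \<longleftrightarrow> (holds N B f d s \<longleftrightarrow> b)"
  "holds N B (Guard b f) d s \<longleftrightarrow> b \<and> holds N B f d s"
  "holds N B (ExBool F) d s \<longleftrightarrow> (\<exists>b. holds N B (F b) d s)"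
  by (auto simp: Disj_def Imp_def Iff_def All_def Lit_def Guard_def ExBool_def) (metis (full_types))+

lemma wf_derived [simp]:
  "wf_fo (Disj f g) d \<longleftrightarrow> wf_fo f d \<and> wf_fo g d"
  "wf_fo (Imp f g) d \<longleftrightarrow> wf_fo f d \<and> wf_fo g d"
  "wf_fo (Iff f g) d \<longleftrightarrow> wf_fo f d \<and> wf_fo g d"
  "wf_fo (All f) d \<longleftrightarrow> wf_fo f (Suc d)"
  "wf_fo (Lit b f) d \<longleftrightarrow> wf_fo f d"
  "wf_fo (Guard b f) d \<longleftrightarrow> wf_fo f d"
  "wf_fo (ExBool F) d \<longleftrightarrow> wf_fo (F True) d \<and> wf_fo (F False) d"
  by (auto simp: Disj_def Imp_def Iff_def All_def Lit_def Guard_def ExBool_def)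

definition prt :: "tm \<Rightarrow> tm \<Rightarrow> tm" where
  "prt a b = Add (Mul (Add a b) (Add a b)) a"

lemma prt_simps [simp]:
  "tval s (prt a b) = pv (tval s a) (tval s b)"
  "tvars_below (prt a b) d \<longleftrightarrow> tvars_below a d \<and> tvars_below b d"
  by (auto simp: prt_def pv_def)

text \<open>The guessed relations of a certificate.  \<open>inb b i\<close>: letter \<open>i\<close> of the word is the bit \<open>b\<close>;
\<open>Val p q x\<close>: the letters from \<open>p\<close> up to \<open>q\<close> encode the number \<open>x\<close>; \<open>W b p q\<close>: they encode a
formula of truth value \<open>b\<close>; the remaining ones describe a place system.\<close>

record cert =
  inb :: "bool \<Rightarrow> nat \<Rightarrow> bool"
  Pl :: "nat \<Rightarrow> bool"
  Mem :: "nat \<Rightarrow> nat \<Rightarrow> bool"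
  Prd :: "nat \<Rightarrow> nat \<Rightarrow> nat \<Rightarrow> bool"
  Ot :: "nat \<Rightarrow> nat \<Rightarrow> bool"
  W :: "bool \<Rightarrow> nat \<Rightarrow> nat \<Rightarrow> bool"
  Val :: "nat \<Rightarrow> nat \<Rightarrow> nat \<Rightarrow> bool"

section \<open>Local conditions on a certificate\<close>

definition cert_of :: "(nat \<Rightarrow> mark set) \<Rightarrow> cert" where
  "cert_of B = \<lparr>inb = \<lambda>b i. I b \<in> B i, Pl = \<lambda>k. G 0 \<in> B k, Mem = \<lambda>k x. G 1 \<in> B (pv k x),
     Prd = \<lambda>k y z. G 2 \<in> B (pv (pv k y) z), Ot = \<lambda>y z. G 3 \<in> B (pv y z),
     W = \<lambda>b p q. G (if b then 4 else 5) \<in> B (pv p q), Val = \<lambda>p q x. G 6 \<in> B (pv (pv p q) x)\<rparr>"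

definition val_ok :: "nat \<Rightarrow> cert \<Rightarrow> bool" where
  "val_ok N c \<longleftrightarrow> (\<forall>p<N. \<forall>q<N. \<forall>x<N. Val c p q x \<longrightarrow>
     inb c False p \<and> 0 = x \<and> p + 1 = q \<or>
     (\<exists>y<N. inb c True p \<and> Val c (p + 2) q y \<and>
       (inb c True (p + 1) \<and> y + y + 1 = x \<or> inb c False (p + 1) \<and> y + y = x \<and> 0 \<noteq> x)))"

definition tag :: "cert \<Rightarrow> nat \<Rightarrow> bool \<Rightarrow> bool \<Rightarrow> bool \<Rightarrow> bool" where
  "tag c p b2 b3 b4 \<longleftrightarrow> inb c b2 (p + 2) \<and> inb c b3 (p + 3) \<and> inb c b4 (p + 4)"

text \<open>\<open>p\<close> is the start of the whole formula: two letters announce an atom, three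
  give its kind, and the numerals begin at \<open>p + 5\<close>. Requiring \<open>Ot c y z\<close>
  puts every product that is parsed under the control of the place conditions.\<close>

definition atom_ok :: "nat \<Rightarrow> cert \<Rightarrow> bool \<Rightarrow> nat \<Rightarrow> nat \<Rightarrow> bool" where
  "atom_ok N c b p q \<longleftrightarrow> (\<exists>i<N. \<exists>j<N. \<exists>x<N. \<exists>y<N. \<exists>z<N. Val c (p + 5) i x \<and>
     (Val c i j y \<and> Val c j q z \<and>
       (tag c p False False False \<and> ((\<forall>k<N. Pl c k \<longrightarrow> (Mem c k x \<longleftrightarrow> Mem c k y \<or> Mem c k z)) \<longleftrightarrow> b) \<or>
        tag c p False False True \<and> ((\<forall>k<N. Pl c k \<longrightarrow> (Mem c k x \<longleftrightarrow> Mem c k y \<and> Mem c k z)) \<longleftrightarrow> b) \<or>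
        tag c p False True False \<and> ((\<forall>k<N. Pl c k \<longrightarrow> (Mem c k x \<longleftrightarrow> Mem c k y \<and> \<not> Mem c k z)) \<longleftrightarrow> b) \<or>
        tag c p False True True \<and> Ot c y z \<and> ((\<forall>k<N. Pl c k \<longrightarrow> (Mem c k x \<longleftrightarrow> Prd c k y z)) \<longleftrightarrow> b)) \<or>
      Val c i q y \<and> tag c p True False False \<and> ((\<forall>k<N. Pl c k \<longrightarrow> (Mem c k x \<longrightarrow> Mem c k y)) \<longleftrightarrow> b)))"

text \<open>Falsity is claimed explicitly as \<open>W c False\<close>. Negation thus rests on a
  positive claim, and the absence of a claim means nothing.\<close>

definition truth_ok :: "nat \<Rightarrow> cert \<Rightarrow> bool \<Rightarrow> bool" where
  "truth_ok N c b \<longleftrightarrow> (\<forall>p<N. \<forall>q<N. W c b p q \<longrightarrow>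
     inb c False p \<and> inb c False (p + 1) \<and> atom_ok N c b p q \<or>
     inb c False p \<and> inb c True (p + 1) \<and> W c (\<not> b) (p + 2) q \<or>
     (\<exists>m<N. \<exists>b1 b2. inb c True p \<and> W c b1 (p + 2) m \<and> W c b2 m q \<and>
       (((b1 \<and> b2) = b) \<and> inb c False (p + 1) \<or> ((b1 \<or> b2) = b) \<and> inb c True (p + 1))))"

definition match :: "cert \<Rightarrow> nat \<Rightarrow> nat \<Rightarrow> nat \<Rightarrow> nat \<Rightarrow> bool" where
  "match c i j y z \<longleftrightarrow> Mem c i y \<and> Mem c j z \<or> Mem c i z \<and> Mem c j y"

text \<open>\<open>i < k\<close> is spelled \<open>i + 1 + u = k\<close>, in the only form of
  equation that the formulas offer: a term against a variable.\<close>

definition target_ok :: "nat \<Rightarrow> cert \<Rightarrow> bool" where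
  "target_ok N c \<longleftrightarrow> (\<forall>i<N. \<forall>j<N. Pl c i \<and> Pl c j \<and> (\<exists>y<N. \<exists>z<N. Ot c y z \<and> match c i j y z) \<longrightarrow>
     (\<exists>k<N. Pl c k \<and> (\<exists>u<N. i + 1 + u = k) \<and> (\<exists>u<N. j + 1 + u = k) \<and>
       (\<forall>y<N. \<forall>z<N. Ot c y z \<longrightarrow> (Prd c k y z \<longleftrightarrow> match c i j y z))))"

definition source_ok :: "nat \<Rightarrow> cert \<Rightarrow> bool" where
  "source_ok N c \<longleftrightarrow> (\<forall>k<N. Pl c k \<and> (\<exists>y<N. \<exists>z<N. Ot c y z \<and> Prd c k y z) \<longrightarrow>
     (\<exists>i<N. \<exists>j<N. Pl c i \<and> Pl c j \<and> (\<exists>u<N. i + 1 + u = k) \<and> (\<exists>u<N. j + 1 + u = k) \<and>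
       (\<forall>y<N. \<forall>z<N. Ot c y z \<longrightarrow> (Prd c k y z \<longleftrightarrow> match c i j y z))))"

definition main_ok :: "nat \<Rightarrow> cert \<Rightarrow> bool" where
  "main_ok N c \<longleftrightarrow> (\<exists>e<N. \<not> inb c False e \<and> \<not> inb c True e \<and> W c True 0 e)"

definition cert_ok :: "nat \<Rightarrow> cert \<Rightarrow> bool" where
  "cert_ok N c \<longleftrightarrow> val_ok N c \<and> truth_ok N c True \<and> truth_ok N c False \<and>
     target_ok N c \<and> source_ok N c \<and> main_ok N c"

section \<open>The conditions as first-order formulas\<close>

abbreviation "fMem k x \<equiv> Mk (G 1) (prt (V k) (V x))"
abbreviation "fPrd k y z \<equiv> Mk (G 2) (prt (prt (V k) (V y)) (V z))"
abbreviation "fOt y z \<equiv> Mk (G 3) (prt (V y) (V z))"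
abbreviation "fW b t u \<equiv> Mk (G (if b then 4 else 5)) (prt t u)"
abbreviation "fVal t u v \<equiv> Mk (G 6) (prt (prt t u) v)"
abbreviation "fPl k \<equiv> Mk (G 0) (V k)"
abbreviation "fIn b t \<equiv> Mk (I b) t"
abbreviation "off t n \<equiv> Add t (C n)"

definition fo_val :: fo where
  "fo_val = All (All (All (Imp (fVal (V 0) (V 1) (V 2)) (Disj
     (Conj (fIn False (V 0)) (Conj (Eq (C 0) 2) (Eq (off (V 0) 1) 1)))
     (Ex (Conj (fIn True (V 0)) (Conj (fVal (off (V 0) 2) (V 1) (V 3))
       (Disj (Conj (fIn True (off (V 0) 1)) (Eq (off (Add (V 3) (V 3)) 1) 2))
         (Conj (fIn False (off (V 0) 1)) (Conj (Eq (Add (V 3) (V 3)) 2) (Neg (Eq (C 0) 2))))))))))))"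

definition fo_tag :: "bool \<Rightarrow> bool \<Rightarrow> bool \<Rightarrow> fo" where
  "fo_tag b2 b3 b4 = Conj (fIn b2 (off (V 0) 2)) (Conj (fIn b3 (off (V 0) 3)) (fIn b4 (off (V 0) 4)))"

text \<open>To be read at depth 2: variables 0 and 1 are \<open>p\<close> and \<open>q\<close>,
  variables 2 to 6 are \<open>i\<close>, \<open>j\<close>, \<open>x\<close>, \<open>y\<close>,
  \<open>z\<close>, and 7 is the index \<open>k\<close>.\<close>

definition fo_atom :: "bool \<Rightarrow> fo" where
  "fo_atom b = Ex (Ex (Ex (Ex (Ex (Conj (fVal (off (V 0) 5) (V 2) (V 4)) (Disj
     (Conj (fVal (V 2) (V 3) (V 5)) (Conj (fVal (V 3) (V 1) (V 6))
       (Disj (Conj (fo_tag False False False) (Lit b (All (Imp (fPl 7) (Iff (fMem 7 4) (Disj (fMem 7 5) (fMem 7 6)))))))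
       (Disj (Conj (fo_tag False False True) (Lit b (All (Imp (fPl 7) (Iff (fMem 7 4) (Conj (fMem 7 5) (fMem 7 6)))))))
       (Disj (Conj (fo_tag False True False) (Lit b (All (Imp (fPl 7) (Iff (fMem 7 4) (Conj (fMem 7 5) (Neg (fMem 7 6))))))))
         (Conj (fo_tag False True True) (Conj (fOt 5 6) (Lit b (All (Imp (fPl 7) (Iff (fMem 7 4) (fPrd 7 5 6))))))))))))
     (Conj (fVal (V 2) (V 1) (V 5)) (Conj (fo_tag True False False)
       (Lit b (All (Imp (fPl 7) (Imp (fMem 7 4) (fMem 7 5)))))))))))))"

definition fo_truth :: "bool \<Rightarrow> fo" where
  "fo_truth b = All (All (Imp (fW b (V 0) (V 1)) (Disj
     (Conj (fIn False (V 0)) (Conj (fIn False (off (V 0) 1)) (fo_atom b))) (Disj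
     (Conj (fIn False (V 0)) (Conj (fIn True (off (V 0) 1)) (fW (\<not> b) (off (V 0) 2) (V 1))))
     (Ex (ExBool (\<lambda>b1. ExBool (\<lambda>b2. Conj (fIn True (V 0)) (Conj (fW b1 (off (V 0) 2) (V 2)) (Conj (fW b2 (V 2) (V 1))
       (Disj (Guard ((b1 \<and> b2) = b) (fIn False (off (V 0) 1))) (Guard ((b1 \<or> b2) = b) (fIn True (off (V 0) 1))))))))))))))"

definition fo_match :: "nat \<Rightarrow> nat \<Rightarrow> nat \<Rightarrow> nat \<Rightarrow> fo" where
  "fo_match i j y z = Disj (Conj (fMem i y) (fMem j z)) (Conj (fMem i z) (fMem j y))"

definition fo_less :: "nat \<Rightarrow> nat \<Rightarrow> nat \<Rightarrow> fo" where
  "fo_less d i k = Ex (Eq (Add (off (V i) 1) (V d)) k)"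

definition fo_target :: fo where
  "fo_target = All (All (Imp
     (Conj (fPl 0) (Conj (fPl 1) (Ex (Ex (Conj (fOt 2 3) (fo_match 0 1 2 3))))))
     (Ex (Conj (fPl 2) (Conj (fo_less 3 0 2) (Conj (fo_less 3 1 2)
       (All (All (Imp (fOt 3 4) (Iff (fPrd 2 3 4) (fo_match 0 1 3 4)))))))))))"

definition fo_source :: fo where
  "fo_source = All (Imp
     (Conj (fPl 0) (Ex (Ex (Conj (fOt 1 2) (fPrd 0 1 2)))))
     (Ex (Ex (Conj (fPl 1) (Conj (fPl 2) (Conj (fo_less 3 1 0) (Conj (fo_less 3 2 0)
       (All (All (Imp (fOt 3 4) (Iff (fPrd 0 3 4) (fo_match 1 2 3 4))))))))))))"

definition fo_main :: fo where
  "fo_main = Ex (Conj (Neg (fIn False (V 0))) (Conj (Neg (fIn True (V 0))) (fW True (C 0) (V 0))))"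

definition fo_cert :: fo where
  "fo_cert = Conj fo_val (Conj (fo_truth True) (Conj (fo_truth False)
     (Conj fo_target (Conj fo_source fo_main))))"

lemmas fo_defs = fo_val_def fo_tag_def fo_atom_def fo_truth_def fo_match_def fo_less_def
  fo_target_def fo_source_def fo_main_def

lemma wf_fo_cert: "wf_fo fo_cert 0"
  by (simp add: fo_cert_def fo_defs)

lemma holds_fo_val: "holds N B fo_val 0 s \<longleftrightarrow> val_ok N (cert_of B)"
  by (simp add: fo_val_def val_ok_def cert_of_def eval_nat_numeral)

lemma holds_fo_atom:
  "holds N B (fo_atom b) 2 s \<longleftrightarrow> atom_ok N (cert_of B) b (s 0) (s 1)"
  by (simp add: fo_atom_def fo_tag_def atom_ok_def tag_def cert_of_def eval_nat_numeral)

lemma holds_fo_truth: "holds N B (fo_truth b) 0 s \<longleftrightarrow> truth_ok N (cert_of B) b"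
  using holds_fo_atom[of N B b, unfolded eval_nat_numeral BitM.simps]
  by (simp add: fo_truth_def truth_ok_def eval_nat_numeral) (simp add: cert_of_def eval_nat_numeral)

lemma holds_fo_target: "holds N B fo_target 0 s \<longleftrightarrow> target_ok N (cert_of B)"
  by (simp add: fo_target_def fo_less_def fo_match_def target_ok_def match_def cert_of_def eval_nat_numeral)

lemma holds_fo_source: "holds N B fo_source 0 s \<longleftrightarrow> source_ok N (cert_of B)"
  by (simp add: fo_source_def fo_less_def fo_match_def source_ok_def match_def cert_of_def eval_nat_numeral)

lemma holds_fo_main: "holds N B fo_main 0 s \<longleftrightarrow> main_ok N (cert_of B)"
  by (simp add: fo_main_def main_ok_def cert_of_def)

lemma holds_fo_cert: "holds N B fo_cert 0 s \<longleftrightarrow> cert_ok N (cert_of B)"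
  by (simp add: fo_cert_def cert_ok_def holds_fo_val holds_fo_truth holds_fo_target holds_fo_source holds_fo_main)

section \<open>Size of the encoding\<close>

lemma enc_nat_pos: "0 < x \<Longrightarrow> enc_nat x = b1 # (if odd x then b1 else b0) # enc_nat (x div 2)"
  by (cases x) simp_all

lemma b_simps [simp]: "b0 \<noteq> b1" "b1 \<noteq> b0"
  by (simp_all add: b0_def b1_def)

lemma enc_form_in_lists: "enc_form f \<in> lists {b0, b1}"
proof -
  have n: "enc_nat x \<in> lists {b0, b1}" for x
    by (induction x rule: enc_nat.induct) auto
  have "enc_atom a \<in> lists {b0, b1}" for a using n by (cases a) auto
  then show ?thesis by (induction f) auto
qed

lemma less_exp_enc_nat: "x < 2 ^ length (enc_nat x)"
proof (induction x rule: less_induct)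
  case (less x)
  show ?case
  proof (cases "x = 0")
    case False
    then have "x div 2 < 2 ^ length (enc_nat (x div 2))" using less by simp
    then show ?thesis using False by (simp add: enc_nat_pos)
  qed simp
qed

lemma form_vars_bounds:
  "finite (form_vars f) \<and> finite (form_prods f) \<and> form_prods f \<subseteq> form_vars f \<times> form_vars f"
proof (induction f)
  case (FAtom a)
  then show ?case by (cases a) auto
qed auto

text \<open>Each occurrence of a variable or of a product spends letters of its own. Names are
  written in binary, so a variable may be exponentially large in the length of the input, but no
  larger.\<close>

lemma enc_form_bounds:
  "card (form_vars f) \<le> length (enc_form f)" "card (form_prods f) \<le> length (enc_form f)"
  "x \<in> form_vars f \<Longrightarrow> x < 2 ^ length (enc_form f)"
proof -
  have exp: "x < 2 ^ l" if "x < 2 ^ k" "k \<le> l" for x k l :: nat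
    using that by (meson less_le_trans one_le_numeral power_increasing)
  have c3: "card {x, y, z} \<le> 3" and c2: "card {x, y} \<le> 2" for x y z :: nat
    by (simp_all add: card_insert_if)
  have "card (atom_vars a) \<le> length (enc_atom a) \<and> card (atom_prods a) \<le> length (enc_atom a) \<and>
      (\<forall>x\<in>atom_vars a. x < 2 ^ length (enc_atom a))" for a
  proof (cases a)
    case (ASub x y)
    then show ?thesis using c2[of x y] by (auto simp del: power_Suc intro!: exp[OF less_exp_enc_nat])
  next
    case (AUn x y z)
    then show ?thesis using c3[of x y z] by (auto simp del: power_Suc intro!: exp[OF less_exp_enc_nat])
  next
    case (AInt x y z)
    then show ?thesis using c3[of x y z] by (auto simp del: power_Suc intro!: exp[OF less_exp_enc_nat])
  next
    case (ADiff x y z)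
    then show ?thesis using c3[of x y z] by (auto simp del: power_Suc intro!: exp[OF less_exp_enc_nat])
  next
    case (AOtimes x y z)
    then show ?thesis using c3[of x y z] by (auto simp del: power_Suc intro!: exp[OF less_exp_enc_nat])
  qed
  note atom = this
  have "card (form_vars f) \<le> length (enc_form f) \<and> card (form_prods f) \<le> length (enc_form f) \<and>
      (\<forall>x\<in>form_vars f. x < 2 ^ length (enc_form f))"
  proof (induction f)
    case (FAtom a)
    then show ?case using atom[of a] by (auto simp del: power_Suc intro: exp[of _ "length (enc_atom a)"])
  next
    case (FNot f)
    then show ?case by (auto simp del: power_Suc intro: exp[of _ "length (enc_form f)"])
  next
    case (FAnd f g)
    then show ?case
      using card_Un_le[of "form_vars f" "form_vars g"] card_Un_le[of "form_prods f" "form_prods g"]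
      by (auto simp del: power_Suc intro: exp[of _ "length (enc_form f)"] exp[of _ "length (enc_form g)"])
  next
    case (FOr f g)
    then show ?case
      using card_Un_le[of "form_vars f" "form_vars g"] card_Un_le[of "form_prods f" "form_prods g"]
      by (auto simp del: power_Suc intro: exp[of _ "length (enc_form f)"] exp[of _ "length (enc_form g)"])
  qed
  then show "card (form_vars f) \<le> length (enc_form f)" "card (form_prods f) \<le> length (enc_form f)"
    "x \<in> form_vars f \<Longrightarrow> x < 2 ^ length (enc_form f)" by auto
qed

section \<open>Soundness of certificates\<close>

definition bitsym :: "bool \<Rightarrow> nat" where
  "bitsym b = (if b then b1 else b0)"

text \<open>What every marked tape provides before any condition is checked. The bounds let
  quantifiers below \<open>N\<close> in the conditions stand for unrestricted ones.\<close>

locale certificate =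
  fixes N :: nat and c :: cert and w :: "nat list"
  assumes inb_iff: "inb c b i \<longleftrightarrow> i < length w \<and> w ! i = bitsym b"
    and len: "length w \<le> N"
    and Pl_less: "Pl c k \<Longrightarrow> k < N"
    and Ot_less: "Ot c y z \<Longrightarrow> y < N \<and> z < N"
    and W_less: "W c b p q \<Longrightarrow> p < N \<and> q < N"
    and Val_less: "Val c p q x \<Longrightarrow> p < N \<and> q < N \<and> x < N"
begin

text \<open>A justification that refers to another claim needs a letter at \<open>p\<close> and a
  claim starting at \<open>p + 2\<close>. The rest of the word gets shorter, so even an arbitrary
  guess cannot be justified in a circle.\<close>

lemma Val_sound:
  assumes ok: "val_ok N c" and "Val c p q x"
  shows "at w p (enc_nat x) q"
  using assms(2)
proof (induction "length w - p" arbitrary: p q x rule: less_induct)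
  case less
  note lt = Val_less[OF less.prems]
  from ok[unfolded val_ok_def] lt less.prems
  consider "inb c False p" "x = 0" "q = p + 1"
    | y where "inb c True p" "Val c (p + 2) q y"
      "inb c True (p + 1) \<and> y + y + 1 = x \<or> inb c False (p + 1) \<and> y + y = x \<and> 0 \<noteq> x"
    by blast
  then show ?case
  proof cases
    case 1
    then show ?thesis by (simp add: inb_iff bitsym_def)
  next
    case (2 y)
    then have "p < length w" by (simp add: inb_iff)
    then have IH: "at w (p + 2) (enc_nat y) q" using less.hyps[OF _ 2(2)] by simp
    have x: "0 < x" "x div 2 = y" "inb c (odd x) (p + 1)"
      using 2(3) by auto
    then have "w ! (p + 1) = (if odd x then b1 else b0)" "p + 1 < length w"
      unfolding inb_iff bitsym_def by auto
    then show ?thesis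
      using 2(1) IH x(1,2) by (simp add: enc_nat_pos inb_iff bitsym_def)
  qed
qed

definition "Pset = {k. Pl c k}"
definition "Oset = {(y, z). Ot c y z}"

lemma all_Pset: "(\<forall>k<N. Pl c k \<longrightarrow> Q k) \<longleftrightarrow> (\<forall>k\<in>Pset. Q k)"
  using Pl_less by (auto simp: Pset_def)

lemma atom_sound:
  assumes "val_ok N c" "atom_ok N c b p q"
  shows "\<exists>a. at w (p + 2) (enc_atom a) q \<and> atom_prods a \<subseteq> Oset \<and> place_atom Pset (Mem c) (Prd c) a = b"
proof -
  obtain i j x y z where v: "at w (p + 5) (enc_nat x) i" and
    alt: "(Val c i j y \<and> Val c j q z \<and>
       (tag c p False False False \<and> ((\<forall>k\<in>Pset. (Mem c k x \<longleftrightarrow> Mem c k y \<or> Mem c k z)) \<longleftrightarrow> b) \<or>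
        tag c p False False True \<and> ((\<forall>k\<in>Pset. (Mem c k x \<longleftrightarrow> Mem c k y \<and> Mem c k z)) \<longleftrightarrow> b) \<or>
        tag c p False True False \<and> ((\<forall>k\<in>Pset. (Mem c k x \<longleftrightarrow> Mem c k y \<and> \<not> Mem c k z)) \<longleftrightarrow> b) \<or>
        tag c p False True True \<and> Ot c y z \<and> ((\<forall>k\<in>Pset. (Mem c k x \<longleftrightarrow> Prd c k y z)) \<longleftrightarrow> b)) \<or>
      Val c i q y \<and> tag c p True False False \<and> ((\<forall>k\<in>Pset. (Mem c k x \<longrightarrow> Mem c k y)) \<longleftrightarrow> b))"
    using assms(2)[unfolded atom_ok_def all_Pset] Val_sound[OF assms(1)] by blast
  have tagD: "at w (p + 2) ([bitsym b2, bitsym b3, bitsym b4] @ enc_nat x @ us) q"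
    if "tag c p b2 b3 b4" "at w i us q" for b2 b3 b4 us
    using that v by (auto simp: tag_def inb_iff at_append numeral_eq_Suc)
  have at2: "at w i (enc_nat y @ enc_nat z) q" if "Val c i j y" "Val c j q z"
    using that Val_sound[OF assms(1)] by (auto simp: at_append)
  have at1: "at w i (enc_nat y) q" if "Val c i q y" using that Val_sound[OF assms(1)] by blast
  from alt consider
      "tag c p False False False" "at w i (enc_nat y @ enc_nat z) q" "(\<forall>k\<in>Pset. (Mem c k x \<longleftrightarrow> Mem c k y \<or> Mem c k z)) \<longleftrightarrow> b"
    | "tag c p False False True" "at w i (enc_nat y @ enc_nat z) q" "(\<forall>k\<in>Pset. (Mem c k x \<longleftrightarrow> Mem c k y \<and> Mem c k z)) \<longleftrightarrow> b"
    | "tag c p False True False" "at w i (enc_nat y @ enc_nat z) q" "(\<forall>k\<in>Pset. (Mem c k x \<longleftrightarrow> Mem c k y \<and> \<not> Mem c k z)) \<longleftrightarrow> b"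
    | "tag c p False True True" "at w i (enc_nat y @ enc_nat z) q" "Ot c y z" "(\<forall>k\<in>Pset. (Mem c k x \<longleftrightarrow> Prd c k y z)) \<longleftrightarrow> b"
    | "tag c p True False False" "at w i (enc_nat y) q" "(\<forall>k\<in>Pset. (Mem c k x \<longrightarrow> Mem c k y)) \<longleftrightarrow> b"
    using at1 at2 by blast
  then show ?thesis
  proof cases
    case 1
    then show ?thesis using tagD[OF 1(1,2)] by (intro exI[of _ "AUn x y z"]) (simp add: bitsym_def)
  next
    case 2
    then show ?thesis using tagD[OF 2(1,2)] by (intro exI[of _ "AInt x y z"]) (simp add: bitsym_def)
  next
    case 3
    then show ?thesis using tagD[OF 3(1,2)] by (intro exI[of _ "ADiff x y z"]) (simp add: bitsym_def)
  next
    case 4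
    then show ?thesis using tagD[OF 4(1,2)] by (intro exI[of _ "AOtimes x y z"]) (simp add: bitsym_def Oset_def)
  next
    case 5
    then show ?thesis using tagD[OF 5(1,2)] by (intro exI[of _ "ASub x y"]) (simp add: bitsym_def)
  qed
qed

text \<open>The same descent along the word as for numbers. Truth is that of
  \<open>place_form\<close> over the guessed places, for both polarities; the products collected lie
  in \<open>Oset\<close>, as the transfer to the model requires.\<close>

lemma W_sound:
  assumes ok: "val_ok N c" "\<And>b. truth_ok N c b" and "W c b p q"
  shows "\<exists>f. at w p (enc_form f) q \<and> form_prods f \<subseteq> Oset \<and> place_form Pset (Mem c) (Prd c) f = b"
  using assms(3)
proof (induction "length w - p" arbitrary: p q b rule: less_induct)
  case less
  have lt: "p < N" "q < N" using W_less[OF less.prems] by auto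
  from ok(2)[of b, unfolded truth_ok_def, rule_format, OF lt less.prems]
  consider "inb c False p" "inb c False (p + 1)" "atom_ok N c b p q"
    | "inb c False p" "inb c True (p + 1)" "W c (\<not> b) (p + 2) q"
    | m d1 d2 where "inb c True p" "W c d1 (p + 2) m" "W c d2 m q"
      "((d1 \<and> d2) = b) \<and> inb c False (p + 1) \<or> ((d1 \<or> d2) = b) \<and> inb c True (p + 1)"
    by blast
  then show ?case
  proof cases
    case 1
    then obtain a where "at w (p + 2) (enc_atom a) q" "atom_prods a \<subseteq> Oset" "place_atom Pset (Mem c) (Prd c) a = b"
      using atom_sound ok(1) by blast
    then show ?thesis using 1 by (intro exI[of _ "FAtom a"]) (simp add: inb_iff bitsym_def)
  next
    case 2
    then have "p < length w" by (simp add: inb_iff)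
    then have "length w - (p + 2) < length w - p" by linarith
    then obtain f where "at w (p + 2) (enc_form f) q" "form_prods f \<subseteq> Oset" "place_form Pset (Mem c) (Prd c) f = (\<not> b)"
      using less.hyps[OF _ 2(3)] by blast
    then show ?thesis using 2 by (intro exI[of _ "FNot f"]) (simp add: inb_iff bitsym_def)
  next
    case (3 m d1 d2)
    then have p: "p < length w" by (simp add: inb_iff)
    then have "length w - (p + 2) < length w - p" by linarith
    then obtain f where f: "at w (p + 2) (enc_form f) m" "form_prods f \<subseteq> Oset" "place_form Pset (Mem c) (Prd c) f = d1"
      using less.hyps[OF _ 3(2)] by blast
    \<comment> \<open>\<open>m\<close> is merely guessed. It lies to the right of \<open>p\<close>
      because the claim for the first operand has already been turned into actual letters.\<close>
    then have "length w - m < length w - p" using at_end[OF f(1)] p by simp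
    then obtain g where g: "at w m (enc_form g) q" "form_prods g \<subseteq> Oset" "place_form Pset (Mem c) (Prd c) g = d2"
      using less.hyps[OF _ 3(3)] by blast
    have fg: "at w (p + 2) (enc_form f @ enc_form g) q" using f g by (auto simp: at_append)
    from 3(4) show ?thesis
    proof
      assume "((d1 \<and> d2) = b) \<and> inb c False (p + 1)"
      then show ?thesis using 3(1) f g fg by (intro exI[of _ "FAnd f g"]) (simp add: inb_iff bitsym_def)
    next
      assume "((d1 \<or> d2) = b) \<and> inb c True (p + 1)"
      then show ?thesis using 3(1) f g fg by (intro exI[of _ "FOr f g"]) (simp add: inb_iff bitsym_def)
    qed
  qed
qed

lemma place_system_cert:
  assumes "target_ok N c" "source_ok N c"
  shows "place_system Pset Oset (Mem c) (Prd c)"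
proof
  have "Pset \<subseteq> {..<N}" using Pl_less by (auto simp: Pset_def)
  then show "finite Pset" by (rule finite_subset) simp
  have psig: "(y, z) \<in> pair_sig Oset (Mem c) i j \<longleftrightarrow> Ot c y z \<and> match c i j y z" for i j y z
    by (auto simp: pair_sig_def match_def Oset_def)
  have wsig: "(y, z) \<in> place_sig Oset (Prd c) k \<longleftrightarrow> Ot c y z \<and> Prd c k y z" for k y z
    by (auto simp: place_sig_def Oset_def)
  have sig: "place_sig Oset (Prd c) k = pair_sig Oset (Mem c) i j"
    if "\<forall>y<N. \<forall>z<N. Ot c y z \<longrightarrow> (Prd c k y z \<longleftrightarrow> match c i j y z)" for i j k
  proof (rule set_eqI)
    fix yz show "yz \<in> place_sig Oset (Prd c) k \<longleftrightarrow> yz \<in> pair_sig Oset (Mem c) i j"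
      using that Ot_less by (cases yz) (auto simp: psig wsig)
  qed
  show "\<exists>k\<in>Pset. i < k \<and> j < k \<and> place_sig Oset (Prd c) k = pair_sig Oset (Mem c) i j"
    if ij: "i \<in> Pset" "j \<in> Pset" "pair_sig Oset (Mem c) i j \<noteq> {}" for i j
  proof -
    obtain y z where "Ot c y z" "match c i j y z" using ij(3) psig by auto
    then have "\<exists>y<N. \<exists>z<N. Ot c y z \<and> match c i j y z" using Ot_less by blast
    moreover have "i < N" "j < N" "Pl c i" "Pl c j" using ij Pl_less by (auto simp: Pset_def)
    ultimately obtain k where k: "Pl c k" "\<exists>u<N. i + 1 + u = k" "\<exists>u<N. j + 1 + u = k"
      "\<forall>y<N. \<forall>z<N. Ot c y z \<longrightarrow> (Prd c k y z \<longleftrightarrow> match c i j y z)"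
      using assms(1)[unfolded target_ok_def, THEN spec, THEN mp, THEN spec, THEN mp, of i j] by auto
    then have "i < k" "j < k" by auto
    then show ?thesis using k(1) sig[OF k(4)] by (auto simp: Pset_def)
  qed
  show "\<exists>i\<in>Pset. \<exists>j\<in>Pset. i < k \<and> j < k \<and> pair_sig Oset (Mem c) i j = place_sig Oset (Prd c) k"
    if kP: "k \<in> Pset" "place_sig Oset (Prd c) k \<noteq> {}" for k
  proof -
    obtain y z where "Ot c y z" "Prd c k y z" using kP(2) wsig by auto
    then have "\<exists>y<N. \<exists>z<N. Ot c y z \<and> Prd c k y z" using Ot_less by blast
    moreover have "k < N" "Pl c k" using kP Pl_less by (auto simp: Pset_def)
    ultimately obtain i j where ij: "Pl c i" "Pl c j" "\<exists>u<N. i + 1 + u = k" "\<exists>u<N. j + 1 + u = k"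
      "\<forall>y<N. \<forall>z<N. Ot c y z \<longrightarrow> (Prd c k y z \<longleftrightarrow> match c i j y z)"
      using assms(2)[unfolded source_ok_def, THEN spec, THEN mp, of k] by auto
    then have "i < k" "j < k" by auto
    then show ?thesis using ij(1,2) sig[OF ij(5)] by (auto simp: Pset_def)
  qed
qed

lemma cert_sound:
  assumes "cert_ok N c" "w \<in> lists {b0, b1}"
  shows "w \<in> FINSAT_BST_otimes"
proof -
  have ok: "val_ok N c" "\<And>b. truth_ok N c b" "target_ok N c" "source_ok N c" "main_ok N c"
    using assms(1) by (auto simp: cert_ok_def) (metis (full_types))
  obtain e where e: "\<not> inb c False e" "\<not> inb c True e" "W c True 0 e"
    using ok(5) by (auto simp: main_ok_def)
  obtain f where f: "at w 0 (enc_form f) e" "form_prods f \<subseteq> Oset" "place_form Pset (Mem c) (Prd c) f"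
    using W_sound[OF ok(1,2) e(3)] by auto
  \<comment> \<open>A position carrying neither bit is past the end of the word, so the parsed
    formula takes up the entire input and leaves no suffix.\<close>
  have "\<not> e < length w"
  proof
    assume "e < length w"
    then have "w ! e \<in> {b0, b1}" using assms(2) by (auto simp: in_lists_conv_set)
    then show False using e(1,2) \<open>e < length w\<close> by (auto simp: inb_iff bitsym_def)
  qed
  moreover have "e = length (enc_form f)" using at_end[OF f(1)] by simp
  moreover have "take (length (enc_form f)) w = enc_form f" using at_take[OF f(1)] by simp
  ultimately have "w = enc_form f" by simp
  moreover interpret place_system Pset Oset "Mem c" "Prd c" by (rule place_system_cert[OF ok(3,4)])
  have "form_holds model f" using model_form[OF f(2)] f(3) by simp
  ultimately show ?thesis unfolding FINSAT_BST_otimes_def hf_satisfiable_def by blast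
qed

end

lemma word_structure_inb:
  assumes "word_structure m w N B" "w \<in> lists {b0, b1}"
  shows "I b \<in> B i \<longleftrightarrow> i < length w \<and> w ! i = bitsym b"
proof -
  obtain X where X: "X \<subseteq> G ` {..<m}" "B i = (if i < N then (if i < length w then inp (w ! i) else {}) \<union> X else {})"
    and "length w \<le> N" using assms(1) unfolding word_structure_def by blast
  moreover have "w ! i \<in> {b0, b1}" if "i < length w" using that assms(2) by (auto simp: in_lists_conv_set)
  ultimately show ?thesis by (auto simp: inp_def bitsym_def)
qed

lemma certificate_cert_of:
  assumes "word_structure m w N B" "w \<in> lists {b0, b1}"
  shows "certificate N (cert_of B) w"
proof -
  have out: "i < N" if "mk \<in> B i" for mk i
    using assms(1) that unfolding word_structure_def by (metis empty_iff)
  have pv: "a < N \<and> b < N" if "mk \<in> B (pv a b)" for mk a b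
    using out[OF that] pv_ge[of a b] pv_ge(2)[of b a] by (intro conjI; linarith)
  show ?thesis
  proof
    show "inb (cert_of B) b i \<longleftrightarrow> i < length w \<and> w ! i = bitsym b" for b i
      using word_structure_inb[OF assms] by (simp add: cert_of_def)
    show "length w \<le> N" using assms(1) by (simp add: word_structure_def)
    show "Pl (cert_of B) k \<Longrightarrow> k < N" for k using out by (auto simp: cert_of_def)
    show "Ot (cert_of B) y z \<Longrightarrow> y < N \<and> z < N" for y z using pv by (auto simp: cert_of_def)
    show "W (cert_of B) b p q \<Longrightarrow> p < N \<and> q < N" for b p q using pv by (auto simp: cert_of_def)
    show "p < N \<and> q < N \<and> x < N" if "Val (cert_of B) p q x" for p q x
    proof -
      have "G 6 \<in> B (pv (pv p q) x)" using that by (simp add: cert_of_def)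
      then have "pv p q < N" "x < N" using pv by auto
      then show ?thesis using pv_ge(1)[of p q] pv_ge(2)[of q p] by (intro conjI; linarith)
    qed
  qed
qed

section \<open>Completeness: the certificate of a satisfiable formula\<close>

lemma pv_less:
  assumes "a < 2 ^ k" "b < 2 ^ k"
  shows "pv a b < 2 ^ (2 * k + 2)"
proof -
  have "pv a b < Suc (a + b) * Suc (a + b)" by (simp add: pv_def)
  also have "\<dots> \<le> (2 * 2 ^ k) * (2 * 2 ^ k)" using assms by (intro mult_le_mono) auto
  also have "\<dots> = 2 ^ (2 * k + 2)" by (simp add: mult_2[of k] power_add)
  finally show ?thesis .
qed

lemma less_two_power: "\<lbrakk>x < 2 ^ k; k \<le> l\<rbrakk> \<Longrightarrow> x < (2::nat) ^ l"
  by (meson less_le_trans one_le_numeral power_increasing)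

locale satisfied_form =
  fixes f :: bst_form and M :: "nat \<Rightarrow> nat" and n :: nat
    and Mem\<^sub>0 :: "nat \<Rightarrow> nat \<Rightarrow> bool" and Prd\<^sub>0 :: "nat \<Rightarrow> nat \<Rightarrow> nat \<Rightarrow> bool"
  assumes sat: "form_holds M f"
    and n_le: "n \<le> 2 * 2 ^ (card (form_vars f) + card (form_prods f))"
    and places: "place_system {..<n} (form_prods f) Mem\<^sub>0 Prd\<^sub>0"
    and agree: "\<And>g. \<lbrakk>form_vars g \<subseteq> form_vars f; form_prods g \<subseteq> form_prods f\<rbrakk> \<Longrightarrow>
      place_form {..<n} Mem\<^sub>0 Prd\<^sub>0 g \<longleftrightarrow> form_holds M g"
begin

abbreviation "w \<equiv> enc_form f"
abbreviation "Vs \<equiv> form_vars f"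
abbreviation "Os \<equiv> form_prods f"

text \<open>The largest cell needed is \<open>pv (pv a b) d\<close> with arguments below
  \<open>2 ^ h\<close>, where \<open>h = 2 * length w + 1\<close>. Each pairing takes an exponent
  \<open>k\<close> to \<open>2 * k + 2\<close>, so the final exponent is
  \<open>8 * length w + 10\<close>.\<close>

definition N :: nat where "N = 2 ^ (10 * (length w + 1))"

text \<open>This ranges over all segments of the input that happen to code a formula, not only over
  subformulas of \<open>f\<close>. The restriction to \<open>Vs\<close> and \<open>Os\<close> is
  what lets \<open>agree\<close> transfer their truth to the places.\<close>

definition Tru :: "bool \<Rightarrow> nat \<Rightarrow> nat \<Rightarrow> bool" where
  "Tru b p q \<longleftrightarrow> (\<exists>g. at w p (enc_form g) q \<and> form_vars g \<subseteq> Vs \<and> form_prods g \<subseteq> Os \<and> form_holds M g = b)"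

definition track :: "nat \<Rightarrow> nat set" where
  "track t = [{k. k < n}, {pv k x | k x. k < n \<and> x \<in> Vs \<and> Mem\<^sub>0 k x},
     {pv (pv k y) z | k y z. k < n \<and> (y, z) \<in> Os \<and> Prd\<^sub>0 k y z}, {pv y z | y z. (y, z) \<in> Os},
     {pv p q | p q. Tru True p q}, {pv p q | p q. Tru False p q},
     {pv (pv p q) x | p q x. at w p (enc_nat x) q}] ! t"

definition B :: "nat \<Rightarrow> mark set" where
  "B i = (if i < N then (if i < length w then inp (w ! i) else {}) \<union> {G t | t. t < 7 \<and> i \<in> track t} else {})"

abbreviation "c \<equiv> cert_of B"

lemma len_less_N: "length w < N"
proof -
  have "length w < 2 ^ length w" by (rule less_exp)
  also have "\<dots> \<le> N" unfolding N_def by (rule power_increasing) auto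
  finally show ?thesis .
qed

lemma word_structure_B: "word_structure 7 w N B"
proof -
  have "\<exists>X\<subseteq>G ` {..<7}. B i = (if i < N then (if i < length w then inp (w ! i) else {}) \<union> X else {})" for i
    by (rule exI[of _ "{G t | t. t < 7 \<and> i \<in> track t}"]) (auto simp: B_def)
  then show ?thesis using len_less_N by (auto simp: word_structure_def)
qed

lemma G_in_B: "G t \<in> B i \<longleftrightarrow> i < N \<and> t < 7 \<and> i \<in> track t"
  by (auto simp: B_def inp_def)

text \<open>There are at most \<open>length w\<close> variables and as many products, so
  \<open>n\<close> is at most 2 to the power \<open>2 * length w + 1\<close>.\<close>

definition h :: nat where "h = 2 * length w + 1"

lemma small:
  "k < n \<Longrightarrow> k < 2 ^ h" "x \<in> Vs \<Longrightarrow> x < 2 ^ h" "(y, z) \<in> Os \<Longrightarrow> y < 2 ^ h \<and> z < 2 ^ h"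
  "p \<le> length w \<Longrightarrow> p < 2 ^ h"
proof -
  note eb = enc_form_bounds[where f = f]
  have "n \<le> 2 ^ (1 + (card Vs + card Os))" using n_le by simp
  also have "\<dots> \<le> 2 ^ h" using eb(1,2) by (intro power_increasing) (auto simp: h_def)
  finally show "k < n \<Longrightarrow> k < 2 ^ h" by simp
  have v: "x < 2 ^ h" if "x \<in> Vs" for x
    by (rule less_two_power[OF eb(3)[OF that]]) (simp add: h_def)
  then show "x \<in> Vs \<Longrightarrow> x < 2 ^ h" .
  show "(y, z) \<in> Os \<Longrightarrow> y < 2 ^ h \<and> z < 2 ^ h" using v form_vars_bounds[of f] by blast
  show "p < 2 ^ h" if "p \<le> length w"
    using that less_two_power[OF less_exp, of "length w" h] by (simp add: h_def)
qed

lemma pv3_less: "\<lbrakk>a < 2 ^ h; b < 2 ^ h; d < 2 ^ h\<rbrakk> \<Longrightarrow> pv (pv a b) d < N"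
proof -
  assume a: "a < 2 ^ h" "b < 2 ^ h" "d < 2 ^ h"
  have "pv (pv a b) d < 2 ^ (2 * (2 * h + 2) + 2)"
    by (rule pv_less[OF pv_less[OF a(1,2)] less_two_power[OF a(3)]]) simp
  then show ?thesis unfolding N_def by (rule less_two_power) (simp add: h_def)
qed

lemma pv2_less: "\<lbrakk>a < 2 ^ h; b < 2 ^ h\<rbrakk> \<Longrightarrow> pv a b < N"
  using pv3_less[of a b 0] pv_ge(1)[of "pv a b" 0] by simp

lemma less_N: "a < 2 ^ h \<Longrightarrow> a < N"
  using pv2_less[of a 0] pv_ge(1)[of a 0] by simp

lemma at_range: "\<lbrakk>at w p xs q; xs \<noteq> []\<rbrakk> \<Longrightarrow> p < length w \<and> q \<le> length w"
  using at_le[of w p xs q] by (cases xs) auto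

lemma enc_nonempty [simp]: "enc_nat x \<noteq> []" "enc_form g \<noteq> []"
  by (cases x; simp) (cases g; simp)

lemma at_enc_nat_small:
  assumes "at w p (enc_nat x) q"
  shows "p < 2 ^ h" "q < 2 ^ h" "x < 2 ^ h"
proof -
  have pq: "p < length w" "q \<le> length w" using at_range[OF assms] by auto
  then show "p < 2 ^ h" "q < 2 ^ h" using small(4) by auto
  have "length (enc_nat x) \<le> h" using at_end[OF assms] pq by (simp add: h_def)
  then show "x < 2 ^ h" using less_two_power[OF less_exp_enc_nat] by blast
qed

lemma cPl: "Pl c k \<longleftrightarrow> k < n"
  using less_N small(1) by (auto simp: cert_of_def G_in_B track_def)

lemma cMem: "Mem c k x \<longleftrightarrow> k < n \<and> x \<in> Vs \<and> Mem\<^sub>0 k x"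
  using pv2_less small(1,2) by (auto simp: cert_of_def G_in_B track_def)

lemma cPrd: "Prd c k y z \<longleftrightarrow> k < n \<and> (y, z) \<in> Os \<and> Prd\<^sub>0 k y z"
  using pv3_less small(1,3) by (auto simp: cert_of_def G_in_B track_def)

lemma cOt: "Ot c y z \<longleftrightarrow> (y, z) \<in> Os"
  using pv2_less small(3) by (auto simp: cert_of_def G_in_B track_def)

lemma cW: "W c b p q \<longleftrightarrow> Tru b p q"
proof -
  have "pv p q < N" if T: "Tru b p q"
  proof -
    obtain g where "at w p (enc_form g) q" using T by (auto simp: Tru_def)
    then have "p \<le> length w" "q \<le> length w" using at_range[of p "enc_form g" q] by auto
    then show ?thesis using pv2_less small(4) by blast
  qed
  then show ?thesis by (cases b) (auto simp: cert_of_def G_in_B track_def)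
qed

lemma cVal: "Val c p q x \<longleftrightarrow> at w p (enc_nat x) q"
  using pv3_less at_enc_nat_small[of p x q] by (auto simp: cert_of_def G_in_B track_def)

lemma cinb: "inb c b i \<longleftrightarrow> i < length w \<and> w ! i = bitsym b"
  using word_structure_inb[OF word_structure_B enc_form_in_lists] by (simp add: cert_of_def)

lemma cert_val_ok: "val_ok N c"
  unfolding val_ok_def cVal
proof (intro allI impI)
  fix p q x assume at: "at w p (enc_nat x) q"
  show "inb c False p \<and> 0 = x \<and> p + 1 = q \<or>
     (\<exists>y<N. inb c True p \<and> at w (p + 2) (enc_nat y) q \<and>
       (inb c True (p + 1) \<and> y + y + 1 = x \<or> inb c False (p + 1) \<and> y + y = x \<and> 0 \<noteq> x))"
  proof (cases "x = 0")
    case True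
    then show ?thesis using at by (simp add: cinb bitsym_def)
  next
    case False
    then have *: "at w (p + 2) (enc_nat (x div 2)) q" "inb c True p" "inb c (odd x) (p + 1)"
      using at by (auto simp: enc_nat_pos cinb bitsym_def)
    have "x div 2 < N" using less_N at_enc_nat_small(3)[OF *(1)] by blast
    moreover have "inb c True (p + 1) \<and> x div 2 + x div 2 + 1 = x \<or> inb c False (p + 1) \<and> x div 2 + x div 2 = x \<and> 0 \<noteq> x"
      using *(3) False by (cases "odd x") (auto elim: oddE evenE)
    ultimately show ?thesis using * by blast
  qed
qed

lemma cert_atom_ok:
  assumes at: "at w (p + 2) (enc_atom a) q" and a: "atom_vars a \<subseteq> Vs" "atom_prods a \<subseteq> Os"
  shows "atom_ok N c (atom_holds M a) p q"
proof -
  have truth: "place_atom {..<n} Mem\<^sub>0 Prd\<^sub>0 a = atom_holds M a" using agree[of "FAtom a"] a by simp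
  have all: "(\<forall>k<N. Pl c k \<longrightarrow> Q k) \<longleftrightarrow> (\<forall>k\<in>{..<n}. Q k)" for Q
    using less_N small(1) by (auto simp: cPl)
  have Mem: "Mem c k x = Mem\<^sub>0 k x" if "k \<in> {..<n}" "x \<in> Vs" for k x using that by (simp add: cMem)
  have Prd: "Prd c k y z = Prd\<^sub>0 k y z" if "k \<in> {..<n}" "(y, z) \<in> Os" for k y z using that by (simp add: cPrd)
  have ternary: ?thesis
    if at: "at w (p + 2) (map bitsym [b2, b3, b4] @ enc_nat x @ enc_nat y @ enc_nat z) q"
      and alt: "tag c p b2 b3 b4 \<Longrightarrow>
         (tag c p False False False \<and> ((\<forall>k\<in>{..<n}. (Mem c k x \<longleftrightarrow> Mem c k y \<or> Mem c k z)) \<longleftrightarrow> atom_holds M a) \<or>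
          tag c p False False True \<and> ((\<forall>k\<in>{..<n}. (Mem c k x \<longleftrightarrow> Mem c k y \<and> Mem c k z)) \<longleftrightarrow> atom_holds M a) \<or>
          tag c p False True False \<and> ((\<forall>k\<in>{..<n}. (Mem c k x \<longleftrightarrow> Mem c k y \<and> \<not> Mem c k z)) \<longleftrightarrow> atom_holds M a) \<or>
          tag c p False True True \<and> Ot c y z \<and> ((\<forall>k\<in>{..<n}. (Mem c k x \<longleftrightarrow> Prd c k y z)) \<longleftrightarrow> atom_holds M a))"
    for b2 b3 b4 x y z
  proof -
    obtain i j where ij: "at w (p + 5) (enc_nat x) i" "at w i (enc_nat y) j" "at w j (enc_nat z) q"
      using at by (auto simp: at_append numeral_eq_Suc)
    have tag: "tag c p b2 b3 b4"
      using at by (auto simp: tag_def cinb numeral_eq_Suc)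
    have "i < N" "j < N" "x < N" "y < N" "z < N"
      using at_enc_nat_small[OF ij(2)] at_enc_nat_small[OF ij(3)] at_enc_nat_small[OF ij(1)] less_N by auto
    note lt = this
    show ?thesis unfolding atom_ok_def all cVal
      by (rule exI[of _ i], rule conjI[OF lt(1)], rule exI[of _ j], rule conjI[OF lt(2)],
          rule exI[of _ x], rule conjI[OF lt(3)], rule exI[of _ y], rule conjI[OF lt(4)],
          rule exI[of _ z], rule conjI[OF lt(5)], rule conjI[OF ij(1)], rule disjI1,
          rule conjI[OF ij(2)], rule conjI[OF ij(3)], rule alt[OF tag])
  qed
  show ?thesis
  proof (cases a)
    case (AUn x y z)
    show ?thesis
      by (rule ternary[of False False False x y z])
        (use at a truth in \<open>simp_all add: AUn bitsym_def Mem\<close>)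
  next
    case (AInt x y z)
    show ?thesis
      by (rule ternary[of False False True x y z])
        (use at a truth in \<open>simp_all add: AInt bitsym_def Mem\<close>)
  next
    case (ADiff x y z)
    show ?thesis
      by (rule ternary[of False True False x y z])
        (use at a truth in \<open>simp_all add: ADiff bitsym_def Mem\<close>)
  next
    case (AOtimes x y z)
    show ?thesis
      by (rule ternary[of False True True x y z])
        (use at a truth in \<open>simp_all add: AOtimes bitsym_def Mem Prd cOt del: atom_holds.simps\<close>)
  next
    case (ASub x y)
    obtain i where i: "at w (p + 5) (enc_nat x) i" "at w i (enc_nat y) q"
      using at by (auto simp: ASub at_append numeral_eq_Suc)
    have tag: "tag c p True False False"
      using at by (auto simp: ASub tag_def cinb numeral_eq_Suc bitsym_def)
    have lt: "i < N" "x < N" "y < N"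
      using at_enc_nat_small[OF i(1)] at_enc_nat_small[OF i(2)] less_N by auto
    have eq: "(\<forall>k\<in>{..<n}. Mem c k x \<longrightarrow> Mem c k y) \<longleftrightarrow> atom_holds M a"
      using truth a by (simp add: ASub Mem)
    show ?thesis unfolding atom_ok_def all cVal
      by (rule exI[of _ i], rule conjI[OF lt(1)], rule exI[of _ i], rule conjI[OF lt(1)],
          rule exI[of _ x], rule conjI[OF lt(2)], rule exI[of _ y], rule conjI[OF lt(3)],
          rule exI[of _ y], rule conjI[OF lt(3)], rule conjI[OF i(1)], rule disjI2,
          rule conjI[OF i(2)], rule conjI[OF tag eq])
  qed
qed

lemma cert_truth_ok: "truth_ok N c b"
  unfolding truth_ok_def cW
proof (intro allI impI)
  fix p q assume "Tru b p q"
  then obtain g where g: "at w p (enc_form g) q" "form_vars g \<subseteq> Vs" "form_prods g \<subseteq> Os" "form_holds M g = b"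
    by (auto simp: Tru_def)
  have two: "\<exists>m<N. \<exists>d1 d2. inb c True p \<and> Tru d1 (p + 2) m \<and> Tru d2 m q \<and>
       (((d1 \<and> d2) = b) \<and> inb c False (p + 1) \<or> ((d1 \<or> d2) = b) \<and> inb c True (p + 1))"
    if at: "at w (p + 2) (enc_form g1 @ enc_form g2) q" and p: "inb c True p"
      and sub: "form_vars g1 \<union> form_vars g2 \<subseteq> Vs" "form_prods g1 \<union> form_prods g2 \<subseteq> Os"
      and t: "((form_holds M g1 \<and> form_holds M g2) = b) \<and> inb c False (p + 1) \<or>
        ((form_holds M g1 \<or> form_holds M g2) = b) \<and> inb c True (p + 1)" for g1 g2
  proof -
    obtain m where m: "at w (p + 2) (enc_form g1) m" "at w m (enc_form g2) q"
      using at by (auto simp: at_append)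
    have "m < N" using at_range[OF m(1)] len_less_N by simp
    moreover have "Tru (form_holds M g1) (p + 2) m" "Tru (form_holds M g2) m q"
      using m sub unfolding Tru_def by blast+
    ultimately show ?thesis using p t by blast
  qed
  show "inb c False p \<and> inb c False (p + 1) \<and> atom_ok N c b p q \<or>
     inb c False p \<and> inb c True (p + 1) \<and> Tru (\<not> b) (p + 2) q \<or>
     (\<exists>m<N. \<exists>b1 b2. inb c True p \<and> Tru b1 (p + 2) m \<and> Tru b2 m q \<and>
       (((b1 \<and> b2) = b) \<and> inb c False (p + 1) \<or> ((b1 \<or> b2) = b) \<and> inb c True (p + 1)))"
  proof (cases g)
    case (FAtom a)
    then have "inb c False p" "inb c False (p + 1)" "at w (p + 2) (enc_atom a) q"
      using g(1) by (auto simp: cinb bitsym_def)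
    then show ?thesis using cert_atom_ok[of p a q] g FAtom by auto
  next
    case (FNot g')
    then have "inb c False p" "inb c True (p + 1)" "at w (p + 2) (enc_form g') q"
      using g(1) by (auto simp: cinb bitsym_def)
    then show ?thesis using g FNot by (auto simp: Tru_def)
  next
    case (FAnd g1 g2)
    then show ?thesis
      using two[of g1 g2] g by (auto simp: cinb bitsym_def)
  next
    case (FOr g1 g2)
    then show ?thesis
      using two[of g1 g2] g by (auto simp: cinb bitsym_def)
  qed
qed

lemma later:
  assumes "(i::nat) < k" "k < N"
  shows "\<exists>u<N. i + 1 + u = k"
  by (rule exI[of _ "k - i - 1"]) (use assms in auto)

lemma match_iff:
  assumes "i < n" "j < n" "(y, z) \<in> Os"
  shows "match c i j y z \<longleftrightarrow> (y, z) \<in> pair_sig Os Mem\<^sub>0 i j"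
proof -
  have "y \<in> Vs" "z \<in> Vs" using assms(3) form_vars_bounds[of f] by auto
  then show ?thesis using assms by (auto simp: match_def cMem pair_sig_def)
qed

lemma Prd_iff: "k < n \<Longrightarrow> Prd c k y z \<longleftrightarrow> (y, z) \<in> place_sig Os Prd\<^sub>0 k"
  by (auto simp: cPrd place_sig_def)

lemma cert_target_ok: "target_ok N c"
  unfolding target_ok_def
proof (intro allI impI)
  interpret place_system "{..<n}" Os Mem\<^sub>0 Prd\<^sub>0 by (rule places)
  fix i j
  assume "Pl c i \<and> Pl c j \<and> (\<exists>y<N. \<exists>z<N. Ot c y z \<and> match c i j y z)"
  then obtain y z where ij: "i < n" "j < n" "(y, z) \<in> Os" "match c i j y z" by (auto simp: cPl cOt)
  then have "pair_sig Os Mem\<^sub>0 i j \<noteq> {}" using match_iff by blast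
  then obtain k where k: "k < n" "i < k" "j < k" "place_sig Os Prd\<^sub>0 k = pair_sig Os Mem\<^sub>0 i j"
    using target[of i j] ij by auto
  then have "k < N" using less_N small(1) by blast
  moreover have "\<forall>y<N. \<forall>z<N. Ot c y z \<longrightarrow> (Prd c k y z \<longleftrightarrow> match c i j y z)"
    using k match_iff[OF ij(1,2)] Prd_iff by (simp add: cOt)
  ultimately show "\<exists>k<N. Pl c k \<and> (\<exists>u<N. i + 1 + u = k) \<and> (\<exists>u<N. j + 1 + u = k) \<and>
       (\<forall>y<N. \<forall>z<N. Ot c y z \<longrightarrow> (Prd c k y z \<longleftrightarrow> match c i j y z))"
    using later[OF k(2) \<open>k < N\<close>] later[OF k(3) \<open>k < N\<close>] cPl k(1)
    by - (rule exI[of _ k], simp)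
qed

lemma cert_source_ok: "source_ok N c"
  unfolding source_ok_def
proof (intro allI impI)
  interpret place_system "{..<n}" Os Mem\<^sub>0 Prd\<^sub>0 by (rule places)
  fix k
  assume "k < N" and "Pl c k \<and> (\<exists>y<N. \<exists>z<N. Ot c y z \<and> Prd c k y z)"
  then obtain y z where k: "k < n" "Prd c k y z" by (auto simp: cPl)
  then have "place_sig Os Prd\<^sub>0 k \<noteq> {}" using Prd_iff by blast
  then obtain i j where ij: "i < n" "j < n" "i < k" "j < k" "pair_sig Os Mem\<^sub>0 i j = place_sig Os Prd\<^sub>0 k"
    using source[of k] k by auto
  then have "i < N" "j < N" using less_N small(1) by blast+
  moreover have "\<forall>y<N. \<forall>z<N. Ot c y z \<longrightarrow> (Prd c k y z \<longleftrightarrow> match c i j y z)"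
    using ij match_iff[OF ij(1,2)] Prd_iff[OF k(1)] by (simp add: cOt)
  ultimately show "\<exists>i<N. \<exists>j<N. Pl c i \<and> Pl c j \<and> (\<exists>u<N. i + 1 + u = k) \<and> (\<exists>u<N. j + 1 + u = k) \<and>
       (\<forall>y<N. \<forall>z<N. Ot c y z \<longrightarrow> (Prd c k y z \<longleftrightarrow> match c i j y z))"
    using later[OF ij(3) \<open>k < N\<close>] later[OF ij(4) \<open>k < N\<close>] cPl ij(1,2)
    by - (rule exI[of _ i], rule conjI, simp, rule exI[of _ j], simp)
qed

lemma cert_main_ok: "main_ok N c"
proof -
  have "at w 0 w (length w)" using at_self[of "[]" w "[]"] by simp
  then have "Tru True 0 (length w)" unfolding Tru_def using sat by blast
  then show ?thesis unfolding main_ok_def cW using len_less_N cinb by blast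
qed

lemma cert_complete: "cert_ok N c"
  by (simp add: cert_ok_def cert_val_ok cert_truth_ok cert_target_ok cert_source_ok cert_main_ok)

end

theorem mainTheorem4:
  shows "NEXPTIME FINSAT_BST_otimes"
\<comment> \<open>Seven tracks: one for each guessed relation of a certificate, with two for the
  polarities of \<open>W\<close>. The 10 is the factor in the exponent of the tape length.\<close>
proof (rule monadic_guess_NEXPTIME[where m = 7 and c = 10, OF _ wf_fo_cert])
  show "FINSAT_BST_otimes \<subseteq> lists {b0, b1}"
    using enc_form_in_lists by (auto simp: FINSAT_BST_otimes_def)
next
  fix w N B s
  assume w: "w \<in> lists {b0, b1}" and str: "word_structure 7 w N B" and "holds N B fo_cert 0 s"
  then have ok: "cert_ok N (cert_of B)" by (simp add: holds_fo_cert)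
  interpret certificate N "cert_of B" w by (rule certificate_cert_of[OF str w])
  show "w \<in> FINSAT_BST_otimes" using cert_sound[OF ok w] .
next
  fix w assume "w \<in> FINSAT_BST_otimes"
  then obtain f M where f: "w = enc_form f" "form_holds M f"
    by (auto simp: FINSAT_BST_otimes_def hf_satisfiable_def)
  obtain n Mem\<^sub>0 Prd\<^sub>0 where "n \<le> 2 * 2 ^ (card (form_vars f) + card (form_prods f))"
    "place_system {..<n} (form_prods f) Mem\<^sub>0 Prd\<^sub>0"
    "\<And>g. \<lbrakk>form_vars g \<subseteq> form_vars f; form_prods g \<subseteq> form_prods f\<rbrakk> \<Longrightarrow>
      place_form {..<n} Mem\<^sub>0 Prd\<^sub>0 g \<longleftrightarrow> form_holds M g"
    using small_place_system[of "form_vars f" "form_prods f" M] form_vars_bounds[of f] by blast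
  with f(2) interpret satisfied_form f M n Mem\<^sub>0 Prd\<^sub>0 by (rule satisfied_form.intro)
  show "\<exists>N B. N \<le> 2 ^ (10 * (length w + 1)) \<and> word_structure 7 w N B \<and> (\<forall>s. holds N B fo_cert 0 s)"
    unfolding f(1) holds_fo_cert using word_structure_B cert_complete N_def by (metis order_refl)
qed

end
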